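(* Let $\mathcal{G}$ be a groupoid and let $R=B\rtimes_\beta\mathcal{G}$ be an object twisted groupoid ring. Put $R_0=\bigoplus_{e\in\mathcal{G}_0}R_e$. Then $R/R_0$ is separable if and only if for all $e\in\mathcal{G}_0$ the group $\mathcal{G}(e)$ is finite and $|\mathcal{G}(e)|\in U(B)$.
   Context: Rings are associative but not necessarily unital. A groupoid $\mathcal{G}$ is a small category in which every morphism is an isomorphism, identified with its set of morphisms; $d(\sigma)=\sigma^{-1}\sigma$, $r(\sigma)=\sigma\sigma^{-1}$; $\mathcal{G}_0$ is the set of identity elements; $\sigma\tau$ is defined iff $d(\sigma)=r(\tau)$; $\mathcal{G}_2$, $\mathcal{G}_3$ are the sets of composable pairs and triples; $\mathcal{G}(e)=\{\sigma\in\mathcal{G}\mid d(\sigma)=r(\sigma)=e\}$, a group. An object twisted groupoid ring $B\rtimes_\beta\mathcal{G}$ is given by a non-zero unital ring $B$ and elements $\beta_{\sigma,\tau}\in U(Z(B))$ for $(\sigma,\tau)\in\mathcal{G}_2$ (units of the center of $B$) with $\beta_{\sigma,d(\sigma)}=\beta_{r(\sigma),\sigma}=1_B$ for all $\sigma\in\mathcal{G}$ and $\beta_{\sigma,\tau}\beta_{\sigma\tau,\rho}=\beta_{\tau,\rho}\beta_{\sigma,\tau\rho}$ for all $(\sigma,\tau,\rho)\in\mathcal{G}_3$: it consists of formal sums $\sum_\sigma b_\sigma u_\sigma$, $b_\sigma\in B$ almost all zero, with product the additive extension of $bu_\sigma\cdot b'u_\tau=bb'\beta_{\sigma,\tau}u_{\sigma\tau}$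 if $(\sigma,\tau)\in\mathcal{G}_2$ and $0$ otherwise, graded by $R_\sigma=Bu_\sigma$. A ring extension $S/T$ (i.e. $T$ is a subring of $S$) is separable if the multiplication map $\mu:S\otimes_TS\to S$ has an $S$-bimodule section. $U(B)$ is the group of units of $B$, and $|\mathcal{G}(e)|\in U(B)$ means that $|\mathcal{G}(e)|\cdot1_B$ is a unit. *)

theory Defs
  imports "HOL-Algebra.Free_Abelian_Groups" "HOL-Algebra.Generated_Groups" "HOL-Algebra.Ring"
begin

section \<open>Associative rings that need not have a unit\<close>

text \<open>The record type \<^typ>\<open>'a ring\<close> has a field \<open>one\<close>; it is unconstrained and unused for the
  structures considered in this section and the next two.\<close>

locale rng = abelian_group R for R (structure) +
  assumes m_closed: "\<lbrakk>x \<in> carrier R; y \<in> carrier R\<rbrakk> \<Longrightarrow> x \<otimes> y \<in> carrier R"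
    and m_assoc: "\<lbrakk>x \<in> carrier R; y \<in> carrier R; z \<in> carrier R\<rbrakk>
      \<Longrightarrow> (x \<otimes> y) \<otimes> z = x \<otimes> (y \<otimes> z)"
    and l_distr: "\<lbrakk>x \<in> carrier R; y \<in> carrier R; z \<in> carrier R\<rbrakk>
      \<Longrightarrow> (x \<oplus> y) \<otimes> z = x \<otimes> z \<oplus> y \<otimes> z"
    and r_distr: "\<lbrakk>x \<in> carrier R; y \<in> carrier R; z \<in> carrier R\<rbrakk>
      \<Longrightarrow> z \<otimes> (x \<oplus> y) = z \<otimes> x \<oplus> z \<otimes> y"

locale rng_extension = rng S for S (structure) and T +
  assumes subring_add: "subgroup T (add_monoid S)"
    and subring_mult: "\<lbrakk>x \<in> T; y \<in> T\<rbrakk> \<Longrightarrow> x \<otimes> y \<in> T"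


section \<open>The tensor product of S with itself over a subring T\<close>

text \<open>The tensor product is the free abelian group on pairs modulo biadditivity and
  \<open>T\<close>-balancedness. Its elements are cosets, and the group operation is written multiplicatively.\<close>

definition tensor_free :: "('a, 'm) ring_scheme \<Rightarrow> ('a \<times> 'a \<Rightarrow>\<^sub>0 int) monoid" where
  "tensor_free S = free_Abelian_group (carrier S \<times> carrier S)"

definition tensor_relators :: "('a, 'm) ring_scheme \<Rightarrow> 'a set \<Rightarrow> ('a \<times> 'a \<Rightarrow>\<^sub>0 int) set" where
  "tensor_relators S T =
     {frag_of (a \<oplus>\<^bsub>S\<^esub> a', b) - frag_of (a, b) - frag_of (a', b) | a a' b.
        a \<in> carrier S \<and> a' \<in> carrier S \<and> b \<in> carrier S} \<union>
     {frag_of (a, b \<oplus>\<^bsub>S\<^esub> b') - frag_of (a, b) - frag_of (a, b') | a b b'.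
        a \<in> carrier S \<and> b \<in> carrier S \<and> b' \<in> carrier S} \<union>
     {frag_of (a \<otimes>\<^bsub>S\<^esub> t, b) - frag_of (a, t \<otimes>\<^bsub>S\<^esub> b) | a t b.
        a \<in> carrier S \<and> t \<in> T \<and> b \<in> carrier S}"

definition tensor_kernel :: "('a, 'm) ring_scheme \<Rightarrow> 'a set \<Rightarrow> ('a \<times> 'a \<Rightarrow>\<^sub>0 int) set" where
  "tensor_kernel S T = generate (tensor_free S) (tensor_relators S T)"

definition tensor_product ::
  "('a, 'm) ring_scheme \<Rightarrow> 'a set \<Rightarrow> ('a \<times> 'a \<Rightarrow>\<^sub>0 int) set monoid" where
  "tensor_product S T = tensor_free S Mod tensor_kernel S T"

definition tensor_class ::
  "('a, 'm) ring_scheme \<Rightarrow> 'a set \<Rightarrow> ('a \<times> 'a \<Rightarrow>\<^sub>0 int) \<Rightarrow> ('a \<times> 'a \<Rightarrow>\<^sub>0 int) set" where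
  "tensor_class S T x = tensor_kernel S T #>\<^bsub>tensor_free S\<^esub> x"

definition pure_tensor ::
  "('a, 'm) ring_scheme \<Rightarrow> 'a set \<Rightarrow> 'a \<Rightarrow> 'a \<Rightarrow> ('a \<times> 'a \<Rightarrow>\<^sub>0 int) set" where
  "pure_tensor S T a b = tensor_class S T (frag_of (a, b))"

text \<open>The next three maps are given on representatives. When \<open>S/T\<close> is a ring extension they are
  constant on cosets, so that \<^const>\<open>the_elem\<close> picks the common value; see \<open>tensor_mult_pure\<close>,
  \<open>tensor_left_pure\<close> and \<open>tensor_right_pure\<close> below.\<close>

definition free_mult :: "('a, 'm) ring_scheme \<Rightarrow> ('a \<times> 'a \<Rightarrow>\<^sub>0 int) \<Rightarrow> 'a" where
  "free_mult S x = (\<Oplus>\<^bsub>S\<^esub>p \<in> Poly_Mapping.keys x.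
      add_pow S (Poly_Mapping.lookup x p) (fst p \<otimes>\<^bsub>S\<^esub> snd p))"

definition tensor_mult :: "('a, 'm) ring_scheme \<Rightarrow> ('a \<times> 'a \<Rightarrow>\<^sub>0 int) set \<Rightarrow> 'a" where
  "tensor_mult S X = the_elem (free_mult S ` X)"

definition tensor_left ::
  "('a, 'm) ring_scheme \<Rightarrow> 'a set \<Rightarrow> 'a \<Rightarrow> ('a \<times> 'a \<Rightarrow>\<^sub>0 int) set \<Rightarrow> ('a \<times> 'a \<Rightarrow>\<^sub>0 int) set" where
  "tensor_left S T s X =
     the_elem ((\<lambda>x. tensor_class S T (frag_extend (\<lambda>(a, b). frag_of (s \<otimes>\<^bsub>S\<^esub> a, b)) x)) ` X)"

definition tensor_right ::
  "('a, 'm) ring_scheme \<Rightarrow> 'a set \<Rightarrow> ('a \<times> 'a \<Rightarrow>\<^sub>0 int) set \<Rightarrow> 'a \<Rightarrow> ('a \<times> 'a \<Rightarrow>\<^sub>0 int) set" where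
  "tensor_right S T X s =
     the_elem ((\<lambda>x. tensor_class S T (frag_extend (\<lambda>(a, b). frag_of (a, b \<otimes>\<^bsub>S\<^esub> s)) x)) ` X)"

context rng_extension
begin

lemma subring_subset: "T \<subseteq> carrier S"
  using subgroup.subset[OF subring_add] by simp

lemma tensor_relators_closed: "tensor_relators S T \<subseteq> carrier (tensor_free S)"
proof -
  have *: "Poly_Mapping.keys (frag_of p - frag_of q) \<subseteq> {p, q}"
    "Poly_Mapping.keys (frag_of p - frag_of q - frag_of r) \<subseteq> {p, q, r}" for p q r :: "'a \<times> 'a"
    using keys_diff[of "frag_of p" "frag_of q"] keys_diff[of "frag_of p - frag_of q" "frag_of r"]
    by auto
  show ?thesis
    using subring_subset[THEN subsetD]
    by (auto simp: tensor_relators_def tensor_free_def m_closed dest!: subsetD[OF *(1)] subsetD[OF *(2)])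
qed

lemma comm_group_tensor_free: "comm_group (tensor_free S)"
  by (simp add: tensor_free_def abelian_free_Abelian_group)

lemma tensor_kernel_subgroup: "subgroup (tensor_kernel S T) (tensor_free S)"
  unfolding tensor_kernel_def
  by (intro group.generate_is_subgroup tensor_relators_closed comm_group.axioms comm_group_tensor_free)

lemma tensor_kernel_normal: "tensor_kernel S T \<lhd> tensor_free S"
  using comm_group.normal_iff_subgroup comm_group_tensor_free tensor_kernel_subgroup by blast

lemma tensor_free_add [simp]: "x \<otimes>\<^bsub>tensor_free S\<^esub> y = x + y"
  by (simp add: tensor_free_def)

lemma tensor_free_inv:
  "x \<in> carrier (tensor_free S) \<Longrightarrow> inv\<^bsub>tensor_free S\<^esub> x = - x"
  by (simp add: tensor_free_def)

lemma comm_group_tensor_product: "comm_group (tensor_product S T)"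
  unfolding tensor_product_def
  by (intro comm_group.abelian_FactGroup comm_group_tensor_free tensor_kernel_subgroup)

lemma carrier_tensor_product:
  "carrier (tensor_product S T) = tensor_class S T ` carrier (tensor_free S)"
  by (simp add: tensor_product_def carrier_FactGroup tensor_class_def)

lemma tensor_class_hom: "tensor_class S T \<in> hom (tensor_free S) (tensor_product S T)"
  using normal.r_coset_hom_Mod[OF tensor_kernel_normal]
  by (simp add: tensor_class_def[abs_def] tensor_product_def)

lemma tensor_lift_eq:
  assumes "group H" and h: "h \<in> hom (tensor_free S) H"
    and rel: "\<And>x. x \<in> tensor_relators S T \<Longrightarrow> h x = \<one>\<^bsub>H\<^esub>"
    and x: "x \<in> carrier (tensor_free S)"
  shows "the_elem (h ` tensor_class S T x) = h x"
proof -
  interpret F: comm_group "tensor_free S" by (rule comm_group_tensor_free)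
  interpret h: group_hom "tensor_free S" H h
    using assms by (simp add: group_hom_def group_hom_axioms_def F.group_axioms)
  interpret K: subgroup "tensor_kernel S T" "tensor_free S" by (rule tensor_kernel_subgroup)
  have ker: "h k = \<one>\<^bsub>H\<^esub>" if "k \<in> tensor_kernel S T" for k
  proof -
    have "tensor_kernel S T \<subseteq> kernel (tensor_free S) H h"
      unfolding tensor_kernel_def
      using h.subgroup_kernel tensor_relators_closed rel
      by (intro F.generate_subgroup_incl) (auto simp: kernel_def)
    with that show ?thesis by (auto simp: kernel_def)
  qed
  have "h (k \<otimes>\<^bsub>tensor_free S\<^esub> x) = h x" if "k \<in> tensor_kernel S T" for k
    using that x by (simp add: ker K.subset[THEN subsetD] del: tensor_free_add)
  moreover have "tensor_class S T x = (\<lambda>k. k \<otimes>\<^bsub>tensor_free S\<^esub> x) ` tensor_kernel S T"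
    unfolding tensor_class_def r_coset_def by blast
  ultimately have "h ` tensor_class S T x = (\<lambda>k. h x) ` tensor_kernel S T"
    by (simp add: image_image del: tensor_free_add)
  then have "h ` tensor_class S T x = {h x}"
    using K.one_closed by blast
  then show ?thesis by simp
qed

lemma pure_tensor_closed:
  "\<lbrakk>a \<in> carrier S; b \<in> carrier S\<rbrakk> \<Longrightarrow> pure_tensor S T a b \<in> carrier (tensor_product S T)"
  by (simp add: pure_tensor_def carrier_tensor_product tensor_free_def)

lemma frag_in_tensor_free [simp]:
  "\<lbrakk>a \<in> carrier S; b \<in> carrier S\<rbrakk> \<Longrightarrow> frag_of (a, b) \<in> carrier (tensor_free S)"
  by (simp add: tensor_free_def)

lemma tensor_relator_trivial:
  assumes "x \<in> tensor_relators S T"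
  shows "tensor_class S T x = \<one>\<^bsub>tensor_product S T\<^esub>"
proof -
  interpret F: comm_group "tensor_free S" by (rule comm_group_tensor_free)
  have "x \<in> tensor_kernel S T" 
    using assms by (auto simp: tensor_kernel_def intro: generate.incl)
  then show ?thesis
    using F.coset_join2[OF _ tensor_kernel_subgroup] tensor_relators_closed assms
    by (auto simp: tensor_class_def tensor_product_def)
qed

lemma tensor_class_diff:
  assumes "x \<in> carrier (tensor_free S)" "y \<in> carrier (tensor_free S)"
    and "tensor_class S T (x - y) = \<one>\<^bsub>tensor_product S T\<^esub>"
  shows "tensor_class S T x = tensor_class S T y"
proof -
  interpret F: comm_group "tensor_free S" by (rule comm_group_tensor_free)
  interpret P: comm_group "tensor_product S T" by (rule comm_group_tensor_product)
  interpret h: group_hom "tensor_free S" "tensor_product S T" "tensor_class S T"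
    using tensor_class_hom by (simp add: group_hom_def group_hom_axioms_def F.group_axioms P.group_axioms)
  have "x - y \<in> carrier (tensor_free S)"
    using assms(1,2) keys_diff[of x y] by (auto simp: tensor_free_def)
  then have "tensor_class S T ((x - y) \<otimes>\<^bsub>tensor_free S\<^esub> y) = tensor_class S T y"
    using assms h.hom_mult[of "x - y" y] by (simp del: tensor_free_add)
  then show ?thesis by simp
qed

lemma pure_tensor_balanced:
  assumes "a \<in> carrier S" "t \<in> T" "b \<in> carrier S"
  shows "pure_tensor S T (a \<otimes> t) b = pure_tensor S T a (t \<otimes> b)"
  unfolding pure_tensor_def
  using assms subring_subset
  by (intro tensor_class_diff tensor_relator_trivial frag_in_tensor_free)
    (auto simp: m_closed, unfold tensor_relators_def, blast)

lemma pure_tensor_add_left: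
  assumes "a \<in> carrier S" "a' \<in> carrier S" "b \<in> carrier S"
  shows "pure_tensor S T (a \<oplus> a') b = pure_tensor S T a b \<otimes>\<^bsub>tensor_product S T\<^esub> pure_tensor S T a' b"
proof -
  have "pure_tensor S T (a \<oplus> a') b = tensor_class S T (frag_of (a, b) + frag_of (a', b))"
    unfolding pure_tensor_def
  proof (rule tensor_class_diff)
    show "frag_of (a, b) + frag_of (a', b) \<in> carrier (tensor_free S)"
      using assms keys_add[of "frag_of (a, b)" "frag_of (a', b)"] by (auto simp: tensor_free_def)
    have "frag_of (a \<oplus> a', b) - (frag_of (a, b) + frag_of (a', b)) \<in> tensor_relators S T"
      unfolding diff_diff_eq[symmetric] tensor_relators_def using assms by blast
    then show "tensor_class S T (frag_of (a \<oplus> a', b) - (frag_of (a, b) + frag_of (a', b))) = \<one>\<^bsub>tensor_product S T\<^esub>"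
      by (rule tensor_relator_trivial)
  qed (use assms in simp)
  then show ?thesis
    using hom_mult[OF tensor_class_hom, of "frag_of (a, b)" "frag_of (a', b)"] assms
    by (simp add: pure_tensor_def)
qed

lemma pure_tensor_add_right:
  assumes "a \<in> carrier S" "b \<in> carrier S" "b' \<in> carrier S"
  shows "pure_tensor S T a (b \<oplus> b') = pure_tensor S T a b \<otimes>\<^bsub>tensor_product S T\<^esub> pure_tensor S T a b'"
proof -
  have "pure_tensor S T a (b \<oplus> b') = tensor_class S T (frag_of (a, b) + frag_of (a, b'))"
    unfolding pure_tensor_def
  proof (rule tensor_class_diff)
    show "frag_of (a, b) + frag_of (a, b') \<in> carrier (tensor_free S)"
      using assms keys_add[of "frag_of (a, b)" "frag_of (a, b')"] by (auto simp: tensor_free_def)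
    have "frag_of (a, b \<oplus> b') - (frag_of (a, b) + frag_of (a, b')) \<in> tensor_relators S T"
      unfolding diff_diff_eq[symmetric] tensor_relators_def using assms by blast
    then show "tensor_class S T (frag_of (a, b \<oplus> b') - (frag_of (a, b) + frag_of (a, b'))) = \<one>\<^bsub>tensor_product S T\<^esub>"
      by (rule tensor_relator_trivial)
  qed (use assms in simp)
  then show ?thesis
    using hom_mult[OF tensor_class_hom, of "frag_of (a, b)" "frag_of (a, b')"] assms
    by (simp add: pure_tensor_def)
qed

lemma free_mult_gfinprod:
  assumes "x \<in> carrier (tensor_free S)"
  shows "free_mult S x = gfinprod (add_monoid S)
    (\<lambda>p. (fst p \<otimes> snd p) [^]\<^bsub>add_monoid S\<^esub> Poly_Mapping.lookup x p) (carrier S \<times> carrier S)"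
    (is "_ = gfinprod _ ?f _")
proof -
  have keys: "Poly_Mapping.keys x \<subseteq> carrier S \<times> carrier S"
    using assms by (simp add: tensor_free_def)
  have c: "fst p \<otimes> snd p \<in> carrier (add_monoid S)" if "p \<in> carrier S \<times> carrier S" for p
    using that by (auto simp: m_closed)
  then have cl: "?f p \<in> carrier (add_monoid S)" if "p \<in> carrier S \<times> carrier S" for p
    using that group.int_pow_closed[OF a_group] by blast
  have "free_mult S x = finprod (add_monoid S) ?f (Poly_Mapping.keys x)"
    by (simp add: free_mult_def finsum_def add_pow_def)
  also have "\<dots> = gfinprod (add_monoid S) ?f (Poly_Mapping.keys x)"
    using cl keys by (intro comm_monoid.gfinprod_eq_finprod[OF a_comm_monoid, symmetric]) (auto simp del: partial_object.simps)
  also have "\<dots> = gfinprod (add_monoid S) ?f (carrier S \<times> carrier S)"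
  proof (rule comm_monoid.gfinprod_mono_neutral_cong_left[OF a_comm_monoid keys])
    show "?f p = \<one>\<^bsub>add_monoid S\<^esub>" if "p \<in> carrier S \<times> carrier S - Poly_Mapping.keys x" for p
      using that by (simp add: in_keys_iff int_pow_def nat_pow_def)
  qed (use cl in \<open>auto simp del: partial_object.simps\<close>)
  finally show ?thesis .
qed

lemma free_mult_hom: "free_mult S \<in> hom (tensor_free S) (add_monoid S)"
proof -
  let ?C = "carrier S \<times> carrier S"
  have c: "fst p \<otimes> snd p \<in> carrier (add_monoid S)" if "p \<in> ?C" for p
    using that by (auto simp: m_closed)
  have cl: "(fst p \<otimes> snd p) [^]\<^bsub>add_monoid S\<^esub> (k::int) \<in> carrier (add_monoid S)" if "p \<in> ?C" for p k
    using that c group.int_pow_closed[OF a_group] by blast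
  have fin: "finite {p \<in> ?C. (fst p \<otimes> snd p) [^]\<^bsub>add_monoid S\<^esub> Poly_Mapping.lookup x p \<noteq> \<one>\<^bsub>add_monoid S\<^esub>}"
    for x :: "'a \<times> 'a \<Rightarrow>\<^sub>0 int"
    by (rule finite_subset[OF _ finite_keys[of x]]) (auto simp: in_keys_iff int_pow_def nat_pow_def)
  show ?thesis
  proof (rule homI)
    fix x assume x: "x \<in> carrier (tensor_free S)"
    show "free_mult S x \<in> carrier (add_monoid S)"
      unfolding free_mult_gfinprod[OF x] by (rule comm_monoid.gfinprod_closed[OF a_comm_monoid]) (use cl in blast)
  next
    fix x y assume x: "x \<in> carrier (tensor_free S)" and y: "y \<in> carrier (tensor_free S)"
    then have xy: "x \<otimes>\<^bsub>tensor_free S\<^esub> y \<in> carrier (tensor_free S)"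
      by (intro monoid.m_closed comm_group.axioms group.is_monoid comm_group_tensor_free)
    have "free_mult S (x \<otimes>\<^bsub>tensor_free S\<^esub> y) = gfinprod (add_monoid S)
      (\<lambda>p. (fst p \<otimes> snd p) [^]\<^bsub>add_monoid S\<^esub> Poly_Mapping.lookup x p \<otimes>\<^bsub>add_monoid S\<^esub>
          (fst p \<otimes> snd p) [^]\<^bsub>add_monoid S\<^esub> Poly_Mapping.lookup y p) ?C"
      unfolding free_mult_gfinprod[OF xy]
      by (rule comm_monoid.gfinprod_cong[OF a_comm_monoid refl])
        (use cl c group.int_pow_mult[OF a_group] monoid.m_closed[OF group.is_monoid[OF a_group]] in \<open>auto simp: Poly_Mapping.lookup_add simp_implies_def\<close>)
    also have "\<dots> = free_mult S x \<otimes>\<^bsub>add_monoid S\<^esub> free_mult S y"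
      unfolding free_mult_gfinprod[OF x] free_mult_gfinprod[OF y]
      by (rule comm_monoid.gfinprod_distrib[OF a_comm_monoid fin fin]) (use cl in blast)+
    finally show "free_mult S (x \<otimes>\<^bsub>tensor_free S\<^esub> y) = free_mult S x \<otimes>\<^bsub>add_monoid S\<^esub> free_mult S y" .
  qed
qed

lemma free_mult_frag: "\<lbrakk>a \<in> carrier S; b \<in> carrier S\<rbrakk> \<Longrightarrow> free_mult S (frag_of (a, b)) = a \<otimes> b"
  by (simp add: free_mult_def add_pow_def int_pow_def nat_pow_def m_closed)

lemma free_mult_relator:
  assumes "x \<in> tensor_relators S T"
  shows "free_mult S x = \<one>\<^bsub>add_monoid S\<^esub>"
proof -
  interpret F: comm_group "tensor_free S" by (rule comm_group_tensor_free)
  interpret h: group_hom "tensor_free S" "add_monoid S" "free_mult S"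
    using free_mult_hom by (simp add: group_hom_def group_hom_axioms_def F.group_axioms a_group)
  have add: "free_mult S (x + y) = free_mult S x \<oplus> free_mult S y"
    if "x \<in> carrier (tensor_free S)" "y \<in> carrier (tensor_free S)" for x y
    using h.hom_mult[OF that] by simp
  have diff: "free_mult S (x - y) = \<zero>"
    if x: "x \<in> carrier (tensor_free S)" and y: "y \<in> carrier (tensor_free S)"
      and eq: "free_mult S x = free_mult S y" for x y
  proof -
    have "x - y \<in> carrier (tensor_free S)"
      using that keys_diff[of x y] by (auto simp: tensor_free_def)
    then have "free_mult S (x - y) \<oplus> free_mult S y = \<zero> \<oplus> free_mult S y"
      "free_mult S (x - y) \<in> carrier S" "free_mult S y \<in> carrier S"
      using add[of "x - y" y] x y eq h.hom_closed[of "x - y"] h.hom_closed[of y] by simp_all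
    then show ?thesis by simp
  qed
  have sum_closed: "x + y \<in> carrier (tensor_free S)"
    if "x \<in> carrier (tensor_free S)" "y \<in> carrier (tensor_free S)" for x y
    using that F.m_closed[of x y] by simp
  have t: "t \<in> carrier S" if "t \<in> T" for t using that subring_subset by blast
  have "free_mult S x = \<zero>"
    using assms unfolding tensor_relators_def
    by (auto simp: diff_diff_eq intro!: diff)
      (simp_all add: sum_closed add free_mult_frag t m_closed l_distr r_distr m_assoc)
  then show ?thesis by simp
qed

lemma tensor_mult_class:
  assumes "x \<in> carrier (tensor_free S)"
  shows "tensor_mult S (tensor_class S T x) = free_mult S x"
  unfolding tensor_mult_def
  using assms free_mult_hom free_mult_relator a_group
  by (intro tensor_lift_eq[where H = "add_monoid S"]) auto

lemma tensor_mult_pure: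
  "\<lbrakk>a \<in> carrier S; b \<in> carrier S\<rbrakk> \<Longrightarrow> tensor_mult S (pure_tensor S T a b) = a \<otimes> b"
  by (simp add: pure_tensor_def tensor_mult_class free_mult_frag)

lemma tensor_mult_hom: "tensor_mult S \<in> hom (tensor_product S T) (add_monoid S)"
proof -
  interpret F: comm_group "tensor_free S" by (rule comm_group_tensor_free)
  show ?thesis
  proof (rule homI)
    fix X assume "X \<in> carrier (tensor_product S T)"
    then show "tensor_mult S X \<in> carrier (add_monoid S)"
      using free_mult_hom by (auto simp: carrier_tensor_product tensor_mult_class hom_def)
  next
    fix X Y assume "X \<in> carrier (tensor_product S T)" "Y \<in> carrier (tensor_product S T)"
    then obtain x y where x: "x \<in> carrier (tensor_free S)" "X = tensor_class S T x"
      and y: "y \<in> carrier (tensor_free S)" "Y = tensor_class S T y"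
      by (auto simp: carrier_tensor_product)
    then show "tensor_mult S (X \<otimes>\<^bsub>tensor_product S T\<^esub> Y) = tensor_mult S X \<otimes>\<^bsub>add_monoid S\<^esub> tensor_mult S Y"
      using hom_mult[OF tensor_class_hom x(1) y(1)] hom_mult[OF free_mult_hom x(1) y(1)]
        tensor_mult_class[OF F.m_closed[OF x(1) y(1)]]
      by (simp add: tensor_mult_class)
  qed
qed

lemma tensor_extend_class:
  assumes f: "\<And>a b. \<lbrakk>a \<in> carrier S; b \<in> carrier S\<rbrakk> \<Longrightarrow> f (a, b) \<in> carrier S \<times> carrier S"
    and rel: "\<And>x. x \<in> tensor_relators S T \<Longrightarrow> frag_extend (frag_of \<circ> f) x \<in> tensor_relators S T"
    and x: "x \<in> carrier (tensor_free S)"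
  shows "the_elem ((\<lambda>x. tensor_class S T (frag_extend (frag_of \<circ> f) x)) ` tensor_class S T x)
    = tensor_class S T (frag_extend (frag_of \<circ> f) x)"
proof (rule tensor_lift_eq[OF _ _ _ x, where H = "tensor_product S T"])
  show "group (tensor_product S T)"
    using comm_group_tensor_product comm_group.axioms by blast
  have "frag_extend (frag_of \<circ> f) \<in> hom (tensor_free S) (tensor_free S)"
  proof (rule homI)
    fix x assume x: "x \<in> carrier (tensor_free S)"
    show "frag_extend (frag_of \<circ> f) x \<in> carrier (tensor_free S)"
    proof -
      have "Poly_Mapping.keys (frag_extend (frag_of \<circ> f) x) \<subseteq> f ` Poly_Mapping.keys x"
        using keys_frag_extend[of "frag_of \<circ> f" x] by auto
      also have "\<dots> \<subseteq> carrier S \<times> carrier S"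
      proof
        fix q assume "q \<in> f ` Poly_Mapping.keys x"
        then obtain p where p: "p \<in> Poly_Mapping.keys x" "q = f p" by blast
        then have "p \<in> carrier S \<times> carrier S" using x by (auto simp: tensor_free_def)
        then show "q \<in> carrier S \<times> carrier S" using f p(2) by (cases p) blast
      qed
      finally show ?thesis by (simp add: tensor_free_def)
    qed
  qed (simp add: frag_extend_add)
  then show "(\<lambda>x. tensor_class S T (frag_extend (frag_of \<circ> f) x)) \<in> hom (tensor_free S) (tensor_product S T)"
    using hom_compose[OF _ tensor_class_hom] by (fastforce simp: comp_def)
  show "tensor_class S T (frag_extend (frag_of \<circ> f) x) = \<one>\<^bsub>tensor_product S T\<^esub>"
    if "x \<in> tensor_relators S T" for x
    using that rel tensor_relator_trivial by blast
qed

lemma tensor_left_class: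
  assumes s: "s \<in> carrier S" and x: "x \<in> carrier (tensor_free S)"
  shows "tensor_left S T s (tensor_class S T x)
    = tensor_class S T (frag_extend (\<lambda>(a, b). frag_of (s \<otimes> a, b)) x)"
proof -
  have eq: "(\<lambda>(a, b). frag_of (s \<otimes> a, b)) = frag_of \<circ> (\<lambda>(a, b). (s \<otimes> a, b))"
    by (auto simp: fun_eq_iff)
  have t: "t \<in> carrier S" if "t \<in> T" for t using that subring_subset by blast
  have "frag_extend (frag_of \<circ> (\<lambda>(a, b). (s \<otimes> a, b))) y \<in> tensor_relators S T"
    if "y \<in> tensor_relators S T" for y
    using that s t unfolding tensor_relators_def
    by (elim UnE CollectE exE conjE; simp add: frag_extend_diff r_distr m_assoc[symmetric])
      (use m_closed in blast)+
  then show ?thesis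
    unfolding tensor_left_def eq using s x by (intro tensor_extend_class) (auto simp: m_closed)
qed

lemma tensor_right_class:
  assumes s: "s \<in> carrier S" and x: "x \<in> carrier (tensor_free S)"
  shows "tensor_right S T (tensor_class S T x) s
    = tensor_class S T (frag_extend (\<lambda>(a, b). frag_of (a, b \<otimes> s)) x)"
proof -
  have eq: "(\<lambda>(a, b). frag_of (a, b \<otimes> s)) = frag_of \<circ> (\<lambda>(a, b). (a, b \<otimes> s))"
    by (auto simp: fun_eq_iff)
  have t: "t \<in> carrier S" if "t \<in> T" for t using that subring_subset by blast
  have "frag_extend (frag_of \<circ> (\<lambda>(a, b). (a, b \<otimes> s))) y \<in> tensor_relators S T"
    if "y \<in> tensor_relators S T" for y
    using that s t unfolding tensor_relators_def
    by (elim UnE CollectE exE conjE; simp add: frag_extend_diff l_distr m_assoc)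
      (use m_closed in blast)+
  then show ?thesis
    unfolding tensor_right_def eq using s x by (intro tensor_extend_class) (auto simp: m_closed)
qed

lemma tensor_left_pure:
  "\<lbrakk>s \<in> carrier S; a \<in> carrier S; b \<in> carrier S\<rbrakk>
    \<Longrightarrow> tensor_left S T s (pure_tensor S T a b) = pure_tensor S T (s \<otimes> a) b"
  by (simp add: pure_tensor_def tensor_left_class)

lemma tensor_right_pure:
  "\<lbrakk>s \<in> carrier S; a \<in> carrier S; b \<in> carrier S\<rbrakk>
    \<Longrightarrow> tensor_right S T (pure_tensor S T a b) s = pure_tensor S T a (b \<otimes> s)"
  by (simp add: pure_tensor_def tensor_right_class)

end


section \<open>Separable ring extensions\<close>

definition bimodule_section ::
  "('a, 'm) ring_scheme \<Rightarrow> 'a set \<Rightarrow> ('a \<Rightarrow> ('a \<times> 'a \<Rightarrow>\<^sub>0 int) set) \<Rightarrow> bool" where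
  "bimodule_section S T \<delta> \<longleftrightarrow>
     \<delta> \<in> hom (add_monoid S) (tensor_product S T) \<and>
     (\<forall>s \<in> carrier S. \<forall>x \<in> carrier S. \<delta> (s \<otimes>\<^bsub>S\<^esub> x) = tensor_left S T s (\<delta> x)) \<and>
     (\<forall>s \<in> carrier S. \<forall>x \<in> carrier S. \<delta> (x \<otimes>\<^bsub>S\<^esub> s) = tensor_right S T (\<delta> x) s) \<and>
     (\<forall>x \<in> carrier S. tensor_mult S (\<delta> x) = x)"

definition separable_extension :: "('a, 'm) ring_scheme \<Rightarrow> 'a set \<Rightarrow> bool" where
  "separable_extension S T \<longleftrightarrow> rng_extension S T \<and> (\<exists>\<delta>. bimodule_section S T \<delta>)"


section \<open>Groupoids\<close>

text \<open>A groupoid is identified with its set of morphisms, so \<open>src \<sigma>\<close> and \<open>tgt \<sigma>\<close> are identity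
  morphisms. The operation \<open>\<star>\<close> is total but meaningful only on composable pairs, i.e. when
  \<open>src \<sigma> = tgt \<tau>\<close>.\<close>

record 'g groupoid_data =
  arrows :: "'g set"
  src :: "'g \<Rightarrow> 'g"
  tgt :: "'g \<Rightarrow> 'g"
  gcomp :: "'g \<Rightarrow> 'g \<Rightarrow> 'g" (infixl \<open>\<star>\<index>\<close> 70)

locale groupoid = fixes G :: "('g, 'n) groupoid_data_scheme" (structure)
  assumes src_closed: "\<sigma> \<in> arrows G \<Longrightarrow> src G \<sigma> \<in> arrows G"
    and tgt_closed: "\<sigma> \<in> arrows G \<Longrightarrow> tgt G \<sigma> \<in> arrows G"
    and src_src: "\<sigma> \<in> arrows G \<Longrightarrow> src G (src G \<sigma>) = src G \<sigma>"
    and tgt_src: "\<sigma> \<in> arrows G \<Longrightarrow> tgt G (src G \<sigma>) = src G \<sigma>"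
    and src_tgt: "\<sigma> \<in> arrows G \<Longrightarrow> src G (tgt G \<sigma>) = tgt G \<sigma>"
    and tgt_tgt: "\<sigma> \<in> arrows G \<Longrightarrow> tgt G (tgt G \<sigma>) = tgt G \<sigma>"
    and comp_closed: "\<lbrakk>\<sigma> \<in> arrows G; \<tau> \<in> arrows G; src G \<sigma> = tgt G \<tau>\<rbrakk> \<Longrightarrow> \<sigma> \<star> \<tau> \<in> arrows G"
    and src_comp: "\<lbrakk>\<sigma> \<in> arrows G; \<tau> \<in> arrows G; src G \<sigma> = tgt G \<tau>\<rbrakk> \<Longrightarrow> src G (\<sigma> \<star> \<tau>) = src G \<tau>"
    and tgt_comp: "\<lbrakk>\<sigma> \<in> arrows G; \<tau> \<in> arrows G; src G \<sigma> = tgt G \<tau>\<rbrakk> \<Longrightarrow> tgt G (\<sigma> \<star> \<tau>) = tgt G \<sigma>"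
    and comp_assoc: "\<lbrakk>\<sigma> \<in> arrows G; \<tau> \<in> arrows G; \<rho> \<in> arrows G;
      src G \<sigma> = tgt G \<tau>; src G \<tau> = tgt G \<rho>\<rbrakk> \<Longrightarrow> (\<sigma> \<star> \<tau>) \<star> \<rho> = \<sigma> \<star> (\<tau> \<star> \<rho>)"
    and comp_src: "\<sigma> \<in> arrows G \<Longrightarrow> \<sigma> \<star> src G \<sigma> = \<sigma>"
    and tgt_comp_self: "\<sigma> \<in> arrows G \<Longrightarrow> tgt G \<sigma> \<star> \<sigma> = \<sigma>"
    and inverse_exists: "\<sigma> \<in> arrows G \<Longrightarrow> \<exists>\<tau> \<in> arrows G. src G \<tau> = tgt G \<sigma> \<and> tgt G \<tau> = src G \<sigma> \<and>
      \<tau> \<star> \<sigma> = src G \<sigma> \<and> \<sigma> \<star> \<tau> = tgt G \<sigma>"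

definition identities :: "('g, 'n) groupoid_data_scheme \<Rightarrow> 'g set" where
  "identities G = src G ` arrows G"

definition isotropy :: "('g, 'n) groupoid_data_scheme \<Rightarrow> 'g \<Rightarrow> 'g set" where
  "isotropy G e = {\<sigma> \<in> arrows G. src G \<sigma> = e \<and> tgt G \<sigma> = e}"


section \<open>Object twisted groupoid rings\<close>

definition center_ring :: "('b, 'm) ring_scheme \<Rightarrow> ('b, 'm) ring_scheme" where
  "center_ring B =
     B\<lparr>carrier := {z \<in> carrier B. \<forall>x \<in> carrier B. z \<otimes>\<^bsub>B\<^esub> x = x \<otimes>\<^bsub>B\<^esub> z}\<rparr>"

locale object_twist = B: ring B + groupoid G
  for B :: "('b, 'm) ring_scheme" and G :: "('g, 'n) groupoid_data_scheme"
    and \<beta> :: "'g \<Rightarrow> 'g \<Rightarrow> 'b" +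
  assumes nonzero: "\<one>\<^bsub>B\<^esub> \<noteq> \<zero>\<^bsub>B\<^esub>"
    and twist_unit: "\<lbrakk>\<sigma> \<in> arrows G; \<tau> \<in> arrows G; src G \<sigma> = tgt G \<tau>\<rbrakk>
      \<Longrightarrow> \<beta> \<sigma> \<tau> \<in> Units (center_ring B)"
    and twist_src: "\<sigma> \<in> arrows G \<Longrightarrow> \<beta> \<sigma> (src G \<sigma>) = \<one>\<^bsub>B\<^esub>"
    and twist_tgt: "\<sigma> \<in> arrows G \<Longrightarrow> \<beta> (tgt G \<sigma>) \<sigma> = \<one>\<^bsub>B\<^esub>"
    and cocycle: "\<lbrakk>\<sigma> \<in> arrows G; \<tau> \<in> arrows G; \<rho> \<in> arrows G; src G \<sigma> = tgt G \<tau>; src G \<tau> = tgt G \<rho>\<rbrakk>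
      \<Longrightarrow> \<beta> \<sigma> \<tau> \<otimes>\<^bsub>B\<^esub> \<beta> (\<sigma> \<star>\<^bsub>G\<^esub> \<tau>) \<rho> = \<beta> \<tau> \<rho> \<otimes>\<^bsub>B\<^esub> \<beta> \<sigma> (\<tau> \<star>\<^bsub>G\<^esub> \<rho>)"

text \<open>The formal sum of the \<open>b\<^sub>\<sigma> u\<^sub>\<sigma>\<close> is represented by its coefficient function, which is zero
  off \<open>arrows G\<close>. The field \<open>one\<close> is the sum of all \<open>u\<^sub>e\<close>; it lies in the carrier (and is then the
  unit) only when there are finitely many identities, and nothing below depends on it.\<close>

definition twisted_groupoid_ring ::
  "('b, 'm) ring_scheme \<Rightarrow> ('g, 'n) groupoid_data_scheme \<Rightarrow> ('g \<Rightarrow> 'g \<Rightarrow> 'b) \<Rightarrow> ('g \<Rightarrow> 'b) ring" where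
  "twisted_groupoid_ring B G \<beta> =
     \<lparr>carrier = {f. (\<forall>\<sigma>. f \<sigma> \<in> carrier B) \<and> (\<forall>\<sigma>. \<sigma> \<notin> arrows G \<longrightarrow> f \<sigma> = \<zero>\<^bsub>B\<^esub>) \<and>
        finite {\<sigma>. f \<sigma> \<noteq> \<zero>\<^bsub>B\<^esub>}},
      monoid.mult = (\<lambda>f g \<rho>. finsum B (\<lambda>(\<sigma>, \<tau>). f \<sigma> \<otimes>\<^bsub>B\<^esub> g \<tau> \<otimes>\<^bsub>B\<^esub> \<beta> \<sigma> \<tau>)
          {(\<sigma>, \<tau>). \<sigma> \<in> arrows G \<and> \<tau> \<in> arrows G \<and> src G \<sigma> = tgt G \<tau> \<and> \<sigma> \<star>\<^bsub>G\<^esub> \<tau> = \<rho> \<and>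
             f \<sigma> \<noteq> \<zero>\<^bsub>B\<^esub> \<and> g \<tau> \<noteq> \<zero>\<^bsub>B\<^esub>}),
      one = (\<lambda>\<sigma>. if \<sigma> \<in> identities G then \<one>\<^bsub>B\<^esub> else \<zero>\<^bsub>B\<^esub>),
      zero = (\<lambda>\<sigma>. \<zero>\<^bsub>B\<^esub>),
      add = (\<lambda>f g \<sigma>. f \<sigma> \<oplus>\<^bsub>B\<^esub> g \<sigma>)\<rparr>"

definition monomial :: "('b, 'm) ring_scheme \<Rightarrow> 'b \<Rightarrow> 'g \<Rightarrow> 'g \<Rightarrow> 'b" where
  "monomial B b \<sigma> = (\<lambda>\<rho>. if \<rho> = \<sigma> then b else \<zero>\<^bsub>B\<^esub>)"

definition homogeneous_component :: "('b, 'm) ring_scheme \<Rightarrow> 'g \<Rightarrow> ('g \<Rightarrow> 'b) set" where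
  "homogeneous_component B \<sigma> = {monomial B b \<sigma> | b. b \<in> carrier B}"

definition identity_component ::
  "('b, 'm) ring_scheme \<Rightarrow> ('g, 'n) groupoid_data_scheme \<Rightarrow> ('g \<Rightarrow> 'g \<Rightarrow> 'b) \<Rightarrow> ('g \<Rightarrow> 'b) set" where
  "identity_component B G \<beta> =
     {(\<Oplus>\<^bsub>twisted_groupoid_ring B G \<beta>\<^esub>e \<in> E. x e) | E x.
        finite E \<and> E \<subseteq> identities G \<and> (\<forall>e \<in> E. x e \<in> homogeneous_component B e)}"

context object_twist
begin

abbreviation R where "R \<equiv> twisted_groupoid_ring B G \<beta>"

lemma twist_closed:
  "\<lbrakk>\<sigma> \<in> arrows G; \<tau> \<in> arrows G; src G \<sigma> = tgt G \<tau>\<rbrakk> \<Longrightarrow> \<beta> \<sigma> \<tau> \<in> carrier B"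
  using twist_unit by (auto simp: center_ring_def Units_def)

lemma twist_central:
  "\<lbrakk>\<sigma> \<in> arrows G; \<tau> \<in> arrows G; src G \<sigma> = tgt G \<tau>; b \<in> carrier B\<rbrakk>
    \<Longrightarrow> \<beta> \<sigma> \<tau> \<otimes>\<^bsub>B\<^esub> b = b \<otimes>\<^bsub>B\<^esub> \<beta> \<sigma> \<tau>"
  using twist_unit by (auto simp: center_ring_def Units_def)

lemma carrier_twisted:
  "f \<in> carrier R \<longleftrightarrow> (\<forall>\<sigma>. f \<sigma> \<in> carrier B) \<and> (\<forall>\<sigma>. \<sigma> \<notin> arrows G \<longrightarrow> f \<sigma> = \<zero>\<^bsub>B\<^esub>) \<and>
    finite {\<sigma>. f \<sigma> \<noteq> \<zero>\<^bsub>B\<^esub>}"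
  by (simp add: twisted_groupoid_ring_def)

lemma twisted_value_closed [simp]: "f \<in> carrier R \<Longrightarrow> f \<sigma> \<in> carrier B"
  by (simp add: carrier_twisted)

lemma twisted_add: "f \<oplus>\<^bsub>R\<^esub> g = (\<lambda>\<sigma>. f \<sigma> \<oplus>\<^bsub>B\<^esub> g \<sigma>)"
  by (simp only: twisted_groupoid_ring_def ring.select_convs)

lemma twisted_zero: "\<zero>\<^bsub>R\<^esub> = (\<lambda>\<sigma>. \<zero>\<^bsub>B\<^esub>)"
  by (simp only: twisted_groupoid_ring_def ring.select_convs)

lemma abelian_group_twisted: "abelian_group R"
proof (rule abelian_groupI)
  fix f g assume f: "f \<in> carrier R" and g: "g \<in> carrier R"
  have "{\<sigma>. f \<sigma> \<oplus>\<^bsub>B\<^esub> g \<sigma> \<noteq> \<zero>\<^bsub>B\<^esub>} \<subseteq> {\<sigma>. f \<sigma> \<noteq> \<zero>\<^bsub>B\<^esub>} \<union> {\<sigma>. g \<sigma> \<noteq> \<zero>\<^bsub>B\<^esub>}"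
    by auto
  then have "finite {\<sigma>. f \<sigma> \<oplus>\<^bsub>B\<^esub> g \<sigma> \<noteq> \<zero>\<^bsub>B\<^esub>}"
    using f g unfolding carrier_twisted by (meson finite_UnI finite_subset)
  then show "f \<oplus>\<^bsub>R\<^esub> g \<in> carrier R"
    using f g by (simp add: carrier_twisted twisted_add)
  show "f \<oplus>\<^bsub>R\<^esub> g = g \<oplus>\<^bsub>R\<^esub> f"
    using f g by (simp add: twisted_add B.a_comm)
next
  fix f g h assume "f \<in> carrier R" "g \<in> carrier R" "h \<in> carrier R"
  then show "f \<oplus>\<^bsub>R\<^esub> g \<oplus>\<^bsub>R\<^esub> h = f \<oplus>\<^bsub>R\<^esub> (g \<oplus>\<^bsub>R\<^esub> h)"
    by (simp add: twisted_add B.a_assoc)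
next
  fix f assume f: "f \<in> carrier R"
  show "\<exists>g \<in> carrier R. g \<oplus>\<^bsub>R\<^esub> f = \<zero>\<^bsub>R\<^esub>"
  proof
    have "{\<sigma>. \<ominus>\<^bsub>B\<^esub> f \<sigma> \<noteq> \<zero>\<^bsub>B\<^esub>} \<subseteq> {\<sigma>. f \<sigma> \<noteq> \<zero>\<^bsub>B\<^esub>}"
      by auto
    then have "finite {\<sigma>. \<ominus>\<^bsub>B\<^esub> f \<sigma> \<noteq> \<zero>\<^bsub>B\<^esub>}"
      using f finite_subset unfolding carrier_twisted by blast
    then show "(\<lambda>\<sigma>. \<ominus>\<^bsub>B\<^esub> f \<sigma>) \<in> carrier R"
      using f by (simp add: carrier_twisted)
    show "(\<lambda>\<sigma>. \<ominus>\<^bsub>B\<^esub> f \<sigma>) \<oplus>\<^bsub>R\<^esub> f = \<zero>\<^bsub>R\<^esub>"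
      using f by (simp add: twisted_add twisted_zero B.l_neg)
  qed
  show "\<zero>\<^bsub>R\<^esub> \<oplus>\<^bsub>R\<^esub> f = f"
    using f by (simp add: twisted_add twisted_zero)
qed (simp add: carrier_twisted twisted_zero)

sublocale RA: abelian_group R
  by (rule abelian_group_twisted)

definition composable_pairs where
  "composable_pairs E E' \<rho> = {(\<sigma>, \<tau>). \<sigma> \<in> E \<and> \<tau> \<in> E' \<and> \<sigma> \<in> arrows G \<and> \<tau> \<in> arrows G \<and> src G \<sigma> = tgt G \<tau> \<and> \<sigma> \<star>\<^bsub>G\<^esub> \<tau> = \<rho>}"

lemma finite_composable_pairs: "\<lbrakk>finite E; finite E'\<rbrakk> \<Longrightarrow> finite (composable_pairs E E' \<rho>)"
  by (rule finite_subset[of _ "E \<times> E'"]) (auto simp: composable_pairs_def)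

lemma term_closed:
  assumes "f \<in> carrier R" "g \<in> carrier R"
  shows "(\<lambda>(\<sigma>, \<tau>). f \<sigma> \<otimes>\<^bsub>B\<^esub> g \<tau> \<otimes>\<^bsub>B\<^esub> \<beta> \<sigma> \<tau>) \<in> composable_pairs E E' \<rho> \<rightarrow> carrier B"
  using assms by (auto simp: composable_pairs_def twist_closed)

lemma twisted_mult:
  assumes f: "f \<in> carrier R" and g: "g \<in> carrier R" and fin: "finite E" "finite E'"
    and sup: "{\<sigma>. f \<sigma> \<noteq> \<zero>\<^bsub>B\<^esub>} \<subseteq> E" "{\<tau>. g \<tau> \<noteq> \<zero>\<^bsub>B\<^esub>} \<subseteq> E'"
  shows "(f \<otimes>\<^bsub>R\<^esub> g) \<rho> = finsum B (\<lambda>(\<sigma>, \<tau>). f \<sigma> \<otimes>\<^bsub>B\<^esub> g \<tau> \<otimes>\<^bsub>B\<^esub> \<beta> \<sigma> \<tau>) (composable_pairs E E' \<rho>)"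
proof -
  have eq: "(f \<otimes>\<^bsub>R\<^esub> g) \<rho> = finsum B (\<lambda>(\<sigma>, \<tau>). f \<sigma> \<otimes>\<^bsub>B\<^esub> g \<tau> \<otimes>\<^bsub>B\<^esub> \<beta> \<sigma> \<tau>)
      (composable_pairs {\<sigma>. f \<sigma> \<noteq> \<zero>\<^bsub>B\<^esub>} {\<tau>. g \<tau> \<noteq> \<zero>\<^bsub>B\<^esub>} \<rho>)"
    unfolding twisted_groupoid_ring_def monoid.select_convs
    by (rule arg_cong[where f = "finsum B _"]) (unfold composable_pairs_def, blast)
  show ?thesis unfolding eq
  proof (rule B.add.finprod_mono_neutral_cong_left)
    show "finite (composable_pairs E E' \<rho>)" by (rule finite_composable_pairs[OF fin])
    show "composable_pairs {\<sigma>. f \<sigma> \<noteq> \<zero>\<^bsub>B\<^esub>} {\<tau>. g \<tau> \<noteq> \<zero>\<^bsub>B\<^esub>} \<rho> \<subseteq> composable_pairs E E' \<rho>"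
      using sup by (auto simp: composable_pairs_def)
    show "(\<lambda>(\<sigma>, \<tau>). f \<sigma> \<otimes>\<^bsub>B\<^esub> g \<tau> \<otimes>\<^bsub>B\<^esub> \<beta> \<sigma> \<tau>) \<in> composable_pairs E E' \<rho> \<rightarrow> carrier B"
      by (rule term_closed[OF f g])
    fix p assume "p \<in> composable_pairs E E' \<rho> - composable_pairs {\<sigma>. f \<sigma> \<noteq> \<zero>\<^bsub>B\<^esub>} {\<tau>. g \<tau> \<noteq> \<zero>\<^bsub>B\<^esub>} \<rho>"
    then show "(\<lambda>(\<sigma>, \<tau>). f \<sigma> \<otimes>\<^bsub>B\<^esub> g \<tau> \<otimes>\<^bsub>B\<^esub> \<beta> \<sigma> \<tau>) p = \<zero>\<^bsub>B\<^esub>"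
      using f g by (auto simp: composable_pairs_def twist_closed)
  qed simp
qed

lemma supp_finite: "f \<in> carrier R \<Longrightarrow> finite {\<sigma>. f \<sigma> \<noteq> \<zero>\<^bsub>B\<^esub>}"
  by (simp add: carrier_twisted)

lemma twisted_mult_closed:
  assumes f: "f \<in> carrier R" and g: "g \<in> carrier R"
  shows "f \<otimes>\<^bsub>R\<^esub> g \<in> carrier R"
proof -
  let ?E = "{\<sigma>. f \<sigma> \<noteq> \<zero>\<^bsub>B\<^esub>}" and ?E' = "{\<tau>. g \<tau> \<noteq> \<zero>\<^bsub>B\<^esub>}"
  note m = twisted_mult[OF f g supp_finite[OF f] supp_finite[OF g] order_refl order_refl]
  have z: "(f \<otimes>\<^bsub>R\<^esub> g) \<rho> = \<zero>\<^bsub>B\<^esub>" if "composable_pairs ?E ?E' \<rho> = {}" for \<rho>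
    unfolding m that by simp
  have "{\<rho>. (f \<otimes>\<^bsub>R\<^esub> g) \<rho> \<noteq> \<zero>\<^bsub>B\<^esub>} \<subseteq> (\<lambda>(\<sigma>, \<tau>). \<sigma> \<star>\<^bsub>G\<^esub> \<tau>) ` (?E \<times> ?E')"
  proof
    fix \<rho> assume "\<rho> \<in> {\<rho>. (f \<otimes>\<^bsub>R\<^esub> g) \<rho> \<noteq> \<zero>\<^bsub>B\<^esub>}"
    then obtain p where "p \<in> composable_pairs ?E ?E' \<rho>" using z by blast
    then have "p \<in> ?E \<times> ?E'" "\<rho> = (\<lambda>(\<sigma>, \<tau>). \<sigma> \<star>\<^bsub>G\<^esub> \<tau>) p" by (auto simp: composable_pairs_def)
    then show "\<rho> \<in> (\<lambda>(\<sigma>, \<tau>). \<sigma> \<star>\<^bsub>G\<^esub> \<tau>) ` (?E \<times> ?E')" by blast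
  qed
  then have "finite {\<rho>. (f \<otimes>\<^bsub>R\<^esub> g) \<rho> \<noteq> \<zero>\<^bsub>B\<^esub>}"
    by (rule finite_subset[OF _ finite_imageI[OF finite_cartesian_product[OF supp_finite[OF f] supp_finite[OF g]]]])
  moreover have "(f \<otimes>\<^bsub>R\<^esub> g) \<rho> \<in> carrier B" for \<rho>
    unfolding m by (rule B.finsum_closed[OF term_closed[OF f g]])
  moreover have "(f \<otimes>\<^bsub>R\<^esub> g) \<rho> = \<zero>\<^bsub>B\<^esub>" if "\<rho> \<notin> arrows G" for \<rho>
    using that comp_closed by (intro z) (auto simp: composable_pairs_def)
  ultimately show ?thesis by (simp add: carrier_twisted)
qed

lemma twisted_l_distr:
  assumes f: "f \<in> carrier R" and g: "g \<in> carrier R" and h: "h \<in> carrier R"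
  shows "(f \<oplus>\<^bsub>R\<^esub> g) \<otimes>\<^bsub>R\<^esub> h = f \<otimes>\<^bsub>R\<^esub> h \<oplus>\<^bsub>R\<^esub> g \<otimes>\<^bsub>R\<^esub> h"
proof
  fix \<rho>
  let ?E = "{\<sigma>. f \<sigma> \<noteq> \<zero>\<^bsub>B\<^esub>} \<union> {\<sigma>. g \<sigma> \<noteq> \<zero>\<^bsub>B\<^esub>}" and ?E' = "{\<tau>. h \<tau> \<noteq> \<zero>\<^bsub>B\<^esub>}"
  have fin: "finite ?E" "finite ?E'" using supp_finite f g h by auto
  have "((f \<oplus>\<^bsub>R\<^esub> g) \<otimes>\<^bsub>R\<^esub> h) \<rho> =
      finsum B (\<lambda>(\<sigma>, \<tau>). (f \<oplus>\<^bsub>R\<^esub> g) \<sigma> \<otimes>\<^bsub>B\<^esub> h \<tau> \<otimes>\<^bsub>B\<^esub> \<beta> \<sigma> \<tau>) (composable_pairs ?E ?E' \<rho>)"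
    using f g by (intro twisted_mult fin RA.a_closed h) (auto simp: twisted_add)
  also have "\<dots> = finsum B (\<lambda>p. (\<lambda>(\<sigma>, \<tau>). f \<sigma> \<otimes>\<^bsub>B\<^esub> h \<tau> \<otimes>\<^bsub>B\<^esub> \<beta> \<sigma> \<tau>) p \<oplus>\<^bsub>B\<^esub>
      (\<lambda>(\<sigma>, \<tau>). g \<sigma> \<otimes>\<^bsub>B\<^esub> h \<tau> \<otimes>\<^bsub>B\<^esub> \<beta> \<sigma> \<tau>) p) (composable_pairs ?E ?E' \<rho>)"
    using f g h by (intro B.finsum_cong') (auto simp: composable_pairs_def twisted_add B.l_distr twist_closed)
  also have "\<dots> = finsum B (\<lambda>(\<sigma>, \<tau>). f \<sigma> \<otimes>\<^bsub>B\<^esub> h \<tau> \<otimes>\<^bsub>B\<^esub> \<beta> \<sigma> \<tau>) (composable_pairs ?E ?E' \<rho>) \<oplus>\<^bsub>B\<^esub>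
      finsum B (\<lambda>(\<sigma>, \<tau>). g \<sigma> \<otimes>\<^bsub>B\<^esub> h \<tau> \<otimes>\<^bsub>B\<^esub> \<beta> \<sigma> \<tau>) (composable_pairs ?E ?E' \<rho>)"
    by (intro B.finsum_addf term_closed f g h)
  also have "\<dots> = (f \<otimes>\<^bsub>R\<^esub> h) \<rho> \<oplus>\<^bsub>B\<^esub> (g \<otimes>\<^bsub>R\<^esub> h) \<rho>"
    using twisted_mult[OF f h fin] twisted_mult[OF g h fin] by simp
  finally show "((f \<oplus>\<^bsub>R\<^esub> g) \<otimes>\<^bsub>R\<^esub> h) \<rho> = (f \<otimes>\<^bsub>R\<^esub> h \<oplus>\<^bsub>R\<^esub> g \<otimes>\<^bsub>R\<^esub> h) \<rho>"
    by (simp add: twisted_add)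
qed

lemma twisted_r_distr:
  assumes f: "f \<in> carrier R" and g: "g \<in> carrier R" and h: "h \<in> carrier R"
  shows "h \<otimes>\<^bsub>R\<^esub> (f \<oplus>\<^bsub>R\<^esub> g) = h \<otimes>\<^bsub>R\<^esub> f \<oplus>\<^bsub>R\<^esub> h \<otimes>\<^bsub>R\<^esub> g"
proof
  fix \<rho>
  let ?E = "{\<sigma>. f \<sigma> \<noteq> \<zero>\<^bsub>B\<^esub>} \<union> {\<sigma>. g \<sigma> \<noteq> \<zero>\<^bsub>B\<^esub>}" and ?E' = "{\<tau>. h \<tau> \<noteq> \<zero>\<^bsub>B\<^esub>}"
  have fin: "finite ?E'" "finite ?E" using supp_finite f g h by auto
  have "(h \<otimes>\<^bsub>R\<^esub> (f \<oplus>\<^bsub>R\<^esub> g)) \<rho> =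
      finsum B (\<lambda>(\<sigma>, \<tau>). h \<sigma> \<otimes>\<^bsub>B\<^esub> (f \<oplus>\<^bsub>R\<^esub> g) \<tau> \<otimes>\<^bsub>B\<^esub> \<beta> \<sigma> \<tau>) (composable_pairs ?E' ?E \<rho>)"
    using f g by (intro twisted_mult fin RA.a_closed h) (auto simp: twisted_add)
  also have "\<dots> = finsum B (\<lambda>p. (\<lambda>(\<sigma>, \<tau>). h \<sigma> \<otimes>\<^bsub>B\<^esub> f \<tau> \<otimes>\<^bsub>B\<^esub> \<beta> \<sigma> \<tau>) p \<oplus>\<^bsub>B\<^esub>
      (\<lambda>(\<sigma>, \<tau>). h \<sigma> \<otimes>\<^bsub>B\<^esub> g \<tau> \<otimes>\<^bsub>B\<^esub> \<beta> \<sigma> \<tau>) p) (composable_pairs ?E' ?E \<rho>)"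
    using f g h by (intro B.finsum_cong') (auto simp: composable_pairs_def twisted_add B.l_distr B.r_distr twist_closed)
  also have "\<dots> = finsum B (\<lambda>(\<sigma>, \<tau>). h \<sigma> \<otimes>\<^bsub>B\<^esub> f \<tau> \<otimes>\<^bsub>B\<^esub> \<beta> \<sigma> \<tau>) (composable_pairs ?E' ?E \<rho>) \<oplus>\<^bsub>B\<^esub>
      finsum B (\<lambda>(\<sigma>, \<tau>). h \<sigma> \<otimes>\<^bsub>B\<^esub> g \<tau> \<otimes>\<^bsub>B\<^esub> \<beta> \<sigma> \<tau>) (composable_pairs ?E' ?E \<rho>)"
    by (intro B.finsum_addf term_closed f g h)
  also have "\<dots> = (h \<otimes>\<^bsub>R\<^esub> f) \<rho> \<oplus>\<^bsub>B\<^esub> (h \<otimes>\<^bsub>R\<^esub> g) \<rho>"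
    using twisted_mult[OF h f fin] twisted_mult[OF h g fin] by simp
  finally show "(h \<otimes>\<^bsub>R\<^esub> (f \<oplus>\<^bsub>R\<^esub> g)) \<rho> = (h \<otimes>\<^bsub>R\<^esub> f \<oplus>\<^bsub>R\<^esub> h \<otimes>\<^bsub>R\<^esub> g) \<rho>"
    by (simp add: twisted_add)
qed

lemma monomial_closed:
  assumes "b \<in> carrier B" "\<sigma> \<in> arrows G"
  shows "monomial B b \<sigma> \<in> carrier R"
proof -
  have "{\<rho>. monomial B b \<sigma> \<rho> \<noteq> \<zero>\<^bsub>B\<^esub>} \<subseteq> {\<sigma>}" by (auto simp: monomial_def)
  then have "finite {\<rho>. monomial B b \<sigma> \<rho> \<noteq> \<zero>\<^bsub>B\<^esub>}" using finite_subset by blast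
  then show ?thesis using assms by (auto simp: carrier_twisted monomial_def)
qed

lemma monomial_zero: "monomial B \<zero>\<^bsub>B\<^esub> \<sigma> = \<zero>\<^bsub>R\<^esub>"
  by (auto simp: monomial_def twisted_zero)

lemma monomial_mult:
  assumes b: "b \<in> carrier B" "\<sigma> \<in> arrows G" and c: "c \<in> carrier B" "\<tau> \<in> arrows G"
  shows "monomial B b \<sigma> \<otimes>\<^bsub>R\<^esub> monomial B c \<tau> =
    (if src G \<sigma> = tgt G \<tau> then monomial B (b \<otimes>\<^bsub>B\<^esub> c \<otimes>\<^bsub>B\<^esub> \<beta> \<sigma> \<tau>) (\<sigma> \<star>\<^bsub>G\<^esub> \<tau>) else \<zero>\<^bsub>R\<^esub>)"
proof
  fix \<rho>
  have m: "(monomial B b \<sigma> \<otimes>\<^bsub>R\<^esub> monomial B c \<tau>) \<rho> = finsum B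
     (\<lambda>(\<sigma>', \<tau>'). monomial B b \<sigma> \<sigma>' \<otimes>\<^bsub>B\<^esub> monomial B c \<tau> \<tau>' \<otimes>\<^bsub>B\<^esub> \<beta> \<sigma>' \<tau>') (composable_pairs {\<sigma>} {\<tau>} \<rho>)"
    by (intro twisted_mult monomial_closed b c) (auto simp: monomial_def)
  have p: "composable_pairs {\<sigma>} {\<tau>} \<rho> = (if src G \<sigma> = tgt G \<tau> \<and> \<sigma> \<star>\<^bsub>G\<^esub> \<tau> = \<rho> then {(\<sigma>, \<tau>)} else {})"
    using b c by (auto simp: composable_pairs_def)
  show "(monomial B b \<sigma> \<otimes>\<^bsub>R\<^esub> monomial B c \<tau>) \<rho> = (if src G \<sigma> = tgt G \<tau>
      then monomial B (b \<otimes>\<^bsub>B\<^esub> c \<otimes>\<^bsub>B\<^esub> \<beta> \<sigma> \<tau>) (\<sigma> \<star>\<^bsub>G\<^esub> \<tau>) else \<zero>\<^bsub>R\<^esub>) \<rho>"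
    unfolding m p using b c by (auto simp: monomial_def twisted_zero twist_closed)
qed

lemma twisted_induct [consumes 1, case_names zero add]:
  assumes f: "f \<in> carrier R" and z: "P \<zero>\<^bsub>R\<^esub>"
    and a: "\<And>b \<sigma> g. \<lbrakk>b \<in> carrier B; \<sigma> \<in> arrows G; g \<in> carrier R; f \<sigma> \<noteq> \<zero>\<^bsub>B\<^esub>; P g\<rbrakk> \<Longrightarrow> P (monomial B b \<sigma> \<oplus>\<^bsub>R\<^esub> g)"
  shows "P f"
proof -
  have "P (\<lambda>\<sigma>. if \<sigma> \<in> E then f \<sigma> else \<zero>\<^bsub>B\<^esub>) \<and> (\<lambda>\<sigma>. if \<sigma> \<in> E then f \<sigma> else \<zero>\<^bsub>B\<^esub>) \<in> carrier R"
    if "finite E" "E \<subseteq> {\<sigma>. f \<sigma> \<noteq> \<zero>\<^bsub>B\<^esub>}" for E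
    using that
  proof (induction E)
    case empty
    then show ?case using z by (simp add: twisted_zero carrier_twisted)
  next
    case (insert \<sigma> E)
    have eq: "(\<lambda>\<rho>. if \<rho> \<in> insert \<sigma> E then f \<rho> else \<zero>\<^bsub>B\<^esub>) =
        monomial B (f \<sigma>) \<sigma> \<oplus>\<^bsub>R\<^esub> (\<lambda>\<rho>. if \<rho> \<in> E then f \<rho> else \<zero>\<^bsub>B\<^esub>)"
      using insert.hyps f by (auto simp: monomial_def twisted_add)
    have "\<sigma> \<in> arrows G" "f \<sigma> \<noteq> \<zero>\<^bsub>B\<^esub>" using insert.prems f by (auto simp: carrier_twisted)
    then show ?case
      unfolding eq using insert a f by (auto intro!: RA.a_closed monomial_closed)
  qed
  from this[OF supp_finite[OF f] order_refl]
  have "P (\<lambda>\<sigma>. if f \<sigma> \<noteq> \<zero>\<^bsub>B\<^esub> then f \<sigma> else \<zero>\<^bsub>B\<^esub>)" by simp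
  moreover have "(\<lambda>\<sigma>. if f \<sigma> \<noteq> \<zero>\<^bsub>B\<^esub> then f \<sigma> else \<zero>\<^bsub>B\<^esub>) = f" by auto
  ultimately show ?thesis by simp
qed

lemma twisted_l_null: "f \<in> carrier R \<Longrightarrow> \<zero>\<^bsub>R\<^esub> \<otimes>\<^bsub>R\<^esub> f = \<zero>\<^bsub>R\<^esub>"
  using twisted_l_distr[of "\<zero>\<^bsub>R\<^esub>" "\<zero>\<^bsub>R\<^esub>" f] twisted_mult_closed[of "\<zero>\<^bsub>R\<^esub>" f]
  by (simp add: RA.add.r_cancel_one')

lemma twisted_r_null: "f \<in> carrier R \<Longrightarrow> f \<otimes>\<^bsub>R\<^esub> \<zero>\<^bsub>R\<^esub> = \<zero>\<^bsub>R\<^esub>"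
  using twisted_r_distr[of "\<zero>\<^bsub>R\<^esub>" "\<zero>\<^bsub>R\<^esub>" f] twisted_mult_closed[of f "\<zero>\<^bsub>R\<^esub>"]
  by (simp add: RA.add.r_cancel_one')

lemma twisted_monomial_assoc:
  assumes b: "b \<in> carrier B" "\<sigma> \<in> arrows G" and c: "c \<in> carrier B" "\<tau> \<in> arrows G"
    and d: "d \<in> carrier B" "\<rho> \<in> arrows G"
  shows "monomial B b \<sigma> \<otimes>\<^bsub>R\<^esub> monomial B c \<tau> \<otimes>\<^bsub>R\<^esub> monomial B d \<rho>
    = monomial B b \<sigma> \<otimes>\<^bsub>R\<^esub> (monomial B c \<tau> \<otimes>\<^bsub>R\<^esub> monomial B d \<rho>)"
proof (cases "src G \<sigma> = tgt G \<tau> \<and> src G \<tau> = tgt G \<rho>")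
  case True
  then have st: "src G \<sigma> = tgt G \<tau>" and tr: "src G \<tau> = tgt G \<rho>" by auto
  have cl: "\<beta> \<sigma> \<tau> \<in> carrier B" "\<beta> \<tau> \<rho> \<in> carrier B" "\<beta> (\<sigma> \<star>\<^bsub>G\<^esub> \<tau>) \<rho> \<in> carrier B" "\<beta> \<sigma> (\<tau> \<star>\<^bsub>G\<^esub> \<rho>) \<in> carrier B"
    using st tr b c d by (simp_all add: twist_closed comp_closed src_comp tgt_comp)
  have "b \<otimes>\<^bsub>B\<^esub> c \<otimes>\<^bsub>B\<^esub> \<beta> \<sigma> \<tau> \<otimes>\<^bsub>B\<^esub> d \<otimes>\<^bsub>B\<^esub> \<beta> (\<sigma> \<star>\<^bsub>G\<^esub> \<tau>) \<rho>
      = b \<otimes>\<^bsub>B\<^esub> c \<otimes>\<^bsub>B\<^esub> (\<beta> \<sigma> \<tau> \<otimes>\<^bsub>B\<^esub> d) \<otimes>\<^bsub>B\<^esub> \<beta> (\<sigma> \<star>\<^bsub>G\<^esub> \<tau>) \<rho>"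
    using b c d cl by (simp add: B.m_assoc)
  also have "\<dots> = b \<otimes>\<^bsub>B\<^esub> c \<otimes>\<^bsub>B\<^esub> d \<otimes>\<^bsub>B\<^esub> (\<beta> \<sigma> \<tau> \<otimes>\<^bsub>B\<^esub> \<beta> (\<sigma> \<star>\<^bsub>G\<^esub> \<tau>) \<rho>)"
    using b c d cl st by (simp add: B.m_assoc twist_central)
  also have "\<dots> = b \<otimes>\<^bsub>B\<^esub> (c \<otimes>\<^bsub>B\<^esub> d \<otimes>\<^bsub>B\<^esub> \<beta> \<tau> \<rho>) \<otimes>\<^bsub>B\<^esub> \<beta> \<sigma> (\<tau> \<star>\<^bsub>G\<^esub> \<rho>)"
    using b c d cl st tr by (simp add: B.m_assoc cocycle)
  finally show ?thesis
    using st tr b c d cl by (simp add: monomial_mult comp_closed src_comp tgt_comp comp_assoc)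
next
  case False
  then show ?thesis
    using b c d by (auto simp: monomial_mult twisted_l_null twisted_r_null monomial_closed
        comp_closed src_comp tgt_comp twist_closed)
qed

lemma twisted_assoc:
  assumes f: "f \<in> carrier R" and g: "g \<in> carrier R" and h: "h \<in> carrier R"
  shows "f \<otimes>\<^bsub>R\<^esub> g \<otimes>\<^bsub>R\<^esub> h = f \<otimes>\<^bsub>R\<^esub> (g \<otimes>\<^bsub>R\<^esub> h)"
proof -
  have 1: "monomial B b \<sigma> \<otimes>\<^bsub>R\<^esub> monomial B c \<tau> \<otimes>\<^bsub>R\<^esub> h = monomial B b \<sigma> \<otimes>\<^bsub>R\<^esub> (monomial B c \<tau> \<otimes>\<^bsub>R\<^esub> h)"
    if "b \<in> carrier B" "\<sigma> \<in> arrows G" "c \<in> carrier B" "\<tau> \<in> arrows G" for b \<sigma> c \<tau>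
    using h that
    by (induction rule: twisted_induct)
      (simp_all add: twisted_r_null twisted_r_distr twisted_mult_closed monomial_closed twisted_monomial_assoc)
  have 2: "monomial B b \<sigma> \<otimes>\<^bsub>R\<^esub> g \<otimes>\<^bsub>R\<^esub> h = monomial B b \<sigma> \<otimes>\<^bsub>R\<^esub> (g \<otimes>\<^bsub>R\<^esub> h)"
    if "b \<in> carrier B" "\<sigma> \<in> arrows G" for b \<sigma>
    using g that
    by (induction rule: twisted_induct)
      (simp_all add: h twisted_l_null twisted_r_null twisted_l_distr twisted_r_distr twisted_mult_closed monomial_closed 1)
  show ?thesis
    using f
    by (induction rule: twisted_induct)
      (simp_all add: g h twisted_l_null twisted_l_distr twisted_mult_closed monomial_closed 2)
qed

lemma rng_twisted: "rng R"
  by (intro rng.intro abelian_group_twisted rng_axioms.intro twisted_mult_closed twisted_assoc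
      twisted_l_distr twisted_r_distr)

lemma identity_arrow: "e \<in> identities G \<Longrightarrow> e \<in> arrows G"
  by (auto simp: identities_def src_closed)

lemma component_subset: "e \<in> identities G \<Longrightarrow> homogeneous_component B e \<subseteq> carrier R"
  by (auto simp: homogeneous_component_def monomial_closed identity_arrow)

lemma finsum_twisted_value:
  assumes "finite E" "x \<in> E \<rightarrow> carrier R"
  shows "finsum R x E \<sigma> = finsum B (\<lambda>e. x e \<sigma>) E"
  using assms
proof (induction E)
  case (insert e E)
  then have "x \<in> E \<rightarrow> carrier R" "x e \<in> carrier R" by auto
  with insert show ?case
    by (simp add: twisted_add Pi_def)
qed (simp add: twisted_zero)

lemma identity_component_eq:
  "identity_component B G \<beta> = {f \<in> carrier R. \<forall>\<sigma>. f \<sigma> \<noteq> \<zero>\<^bsub>B\<^esub> \<longrightarrow> \<sigma> \<in> identities G}" (is "_ = ?S")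
proof (intro equalityI subsetI)
  fix f assume "f \<in> identity_component B G \<beta>"
  then obtain E x where E: "finite E" "E \<subseteq> identities G"
    and x: "\<And>e. e \<in> E \<Longrightarrow> x e \<in> homogeneous_component B e" and f: "f = finsum R x E"
    by (auto simp: identity_component_def)
  have xR: "x \<in> E \<rightarrow> carrier R" using x E component_subset by blast
  have "f \<sigma> = \<zero>\<^bsub>B\<^esub>" if "\<sigma> \<notin> identities G" for \<sigma>
  proof -
    have "x e \<sigma> = \<zero>\<^bsub>B\<^esub>" if "e \<in> E" for e
      using x[OF that] that E(2) \<open>\<sigma> \<notin> identities G\<close>
      by (auto simp: homogeneous_component_def monomial_def)
    then have "finsum B (\<lambda>e. x e \<sigma>) E = finsum B (\<lambda>e. \<zero>\<^bsub>B\<^esub>) E"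
      by (intro B.finsum_cong') auto
    then show ?thesis
      unfolding f finsum_twisted_value[OF E(1) xR] by simp
  qed
  then show "f \<in> ?S" using RA.finsum_closed[OF xR] f by auto
next
  fix f assume f: "f \<in> ?S"
  let ?E = "{\<sigma>. f \<sigma> \<noteq> \<zero>\<^bsub>B\<^esub>}" and ?x = "\<lambda>\<sigma>. monomial B (f \<sigma>) \<sigma>"
  have fin: "finite ?E" using f supp_finite by blast
  have sub: "?E \<subseteq> identities G" using f by blast
  have comp: "\<forall>e \<in> ?E. ?x e \<in> homogeneous_component B e"
    using f by (auto simp: homogeneous_component_def)
  have xR: "?x \<in> ?E \<rightarrow> carrier R" using f identity_arrow by (auto intro: monomial_closed)
  have "finsum R ?x ?E = f"
  proof
    fix \<sigma>
    have "finsum R ?x ?E \<sigma> = finsum B (\<lambda>e. if \<sigma> = e then f e else \<zero>\<^bsub>B\<^esub>) ?E"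
      unfolding finsum_twisted_value[OF fin xR] by (simp only: monomial_def)
    also have "\<dots> = f \<sigma>"
    proof (cases "\<sigma> \<in> ?E")
      case True
      then show ?thesis using B.finsum_singleton[OF True fin, of f] f by auto
    next
      case False
      then have "finsum B (\<lambda>e. if \<sigma> = e then f e else \<zero>\<^bsub>B\<^esub>) ?E = finsum B (\<lambda>e. \<zero>\<^bsub>B\<^esub>) ?E"
        by (intro B.finsum_cong') auto
      with False show ?thesis by simp
    qed
    finally show "finsum R ?x ?E \<sigma> = f \<sigma>" .
  qed
  then show "f \<in> identity_component B G \<beta>"
    unfolding identity_component_def using fin sub comp by (intro CollectI exI[of _ ?E] exI[of _ ?x]) simp
qed

lemma rng_extension_twisted: "rng_extension R (identity_component B G \<beta>)"
proof (intro rng_extension.intro rng_twisted rng_extension_axioms.intro)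
  interpret R: rng R by (rule rng_twisted)
  show "subgroup (identity_component B G \<beta>) (add_monoid R)"
  proof (rule group.subgroupI[OF RA.a_group])
    show "identity_component B G \<beta> \<subseteq> carrier (add_monoid R)"
      by (auto simp: identity_component_eq)
    show "identity_component B G \<beta> \<noteq> {}"
      using RA.zero_closed by (auto simp: identity_component_eq twisted_zero)
  next
    fix f assume f: "f \<in> identity_component B G \<beta>"
    then have fR: "f \<in> carrier R" by (simp add: identity_component_eq)
    have "(\<ominus>\<^bsub>R\<^esub> f) \<sigma> = \<zero>\<^bsub>B\<^esub>" if "f \<sigma> = \<zero>\<^bsub>B\<^esub>" for \<sigma>
      using RA.l_neg[OF fR] RA.a_inv_closed[OF fR] that
      by (metis B.r_zero twisted_add twisted_value_closed twisted_zero)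
    then have "\<ominus>\<^bsub>R\<^esub> f \<in> identity_component B G \<beta>"
      using f RA.a_inv_closed[OF fR] by (auto simp: identity_component_eq)
    then show "inv\<^bsub>add_monoid R\<^esub> f \<in> identity_component B G \<beta>"
      by (simp add: a_inv_def)
  next
    fix f g assume f: "f \<in> identity_component B G \<beta>" and g: "g \<in> identity_component B G \<beta>"
    then have "f \<oplus>\<^bsub>R\<^esub> g \<in> carrier R" by (simp add: identity_component_eq)
    moreover have "(f \<oplus>\<^bsub>R\<^esub> g) \<sigma> = \<zero>\<^bsub>B\<^esub>" if "\<sigma> \<notin> identities G" for \<sigma>
    proof -
      have "f \<sigma> = \<zero>\<^bsub>B\<^esub>" "g \<sigma> = \<zero>\<^bsub>B\<^esub>" using f g that by (auto simp: identity_component_eq)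
      then show ?thesis by (simp add: twisted_add)
    qed
    ultimately show "f \<otimes>\<^bsub>add_monoid R\<^esub> g \<in> identity_component B G \<beta>"
      by (auto simp: identity_component_eq)
  qed
next
  fix f g assume f: "f \<in> identity_component B G \<beta>" and g: "g \<in> identity_component B G \<beta>"
  then have fR: "f \<in> carrier R" and gR: "g \<in> carrier R" by (simp_all add: identity_component_eq)
  have "(f \<otimes>\<^bsub>R\<^esub> g) \<rho> = \<zero>\<^bsub>B\<^esub>" if "\<rho> \<notin> identities G" for \<rho>
  proof -
    have "composable_pairs {\<sigma>. f \<sigma> \<noteq> \<zero>\<^bsub>B\<^esub>} {\<tau>. g \<tau> \<noteq> \<zero>\<^bsub>B\<^esub>} \<rho> = {}"
    proof -
      have "\<sigma> \<star>\<^bsub>G\<^esub> \<tau> \<in> identities G"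
        if "\<sigma> \<in> identities G" "\<tau> \<in> identities G" "src G \<sigma> = tgt G \<tau>" for \<sigma> \<tau>
      proof -
        have "tgt G \<tau> = \<tau>" "src G \<sigma> = \<sigma>"
          using that by (auto simp: identities_def src_src tgt_src)
        then show ?thesis using that comp_src identity_arrow by metis
      qed
      then show ?thesis using f g that by (auto simp: composable_pairs_def identity_component_eq)
    qed
    then show ?thesis
      using twisted_mult[OF fR gR supp_finite[OF fR] supp_finite[OF gR] order_refl order_refl] by simp
  qed
  then show "f \<otimes>\<^bsub>R\<^esub> g \<in> identity_component B G \<beta>"
    using twisted_mult_closed[OF fR gR] by (auto simp: identity_component_eq)
qed

end

end

theory Submission
  imports Defs
begin

text \<open>
  Taking the coefficient of \<open>u\<^sub>\<sigma>\<close> on the left and of \<open>u\<^sub>\<tau>\<close> on the right is well defined on the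
  tensor product over \<open>R\<^sub>0\<close> whenever \<open>\<sigma>\<close> and \<open>\<tau>\<close> are composable. Let \<open>\<delta>\<close> be a section, \<open>e\<close> an
  identity, and let \<open>w\<^sub>\<sigma>\<close> be the coefficient of \<open>\<delta> u\<^sub>e\<close> at \<open>(\<sigma>, \<sigma>\<^sup>-\<^sup>1)\<close> times the twist at that pair,
  where \<open>\<sigma>\<close> ends in \<open>e\<close>. The \<open>w\<^sub>\<sigma>\<close> are almost all zero and sum up to 1, and they are constant on the
  orbits of \<open>\<G>(e)\<close> because \<open>\<delta> u\<^sub>e\<close> commutes with \<open>u\<^sub>\<tau>\<close> for \<open>\<tau> \<in> \<G>(e)\<close>. As the action is free, \<open>\<G>(e)\<close>
  is finite and 1 is a multiple of its order.

  Conversely, choose a base object \<open>k\<close> in every connected component and send \<open>u\<^sub>e\<close> to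
  \<open>|\<G>(k)|\<^sup>-\<^sup>1 \<Sum> u\<^sub>\<sigma> \<otimes> u\<^sub>\<sigma>\<^sup>-\<^sup>1\<close>, where \<open>\<sigma>\<close> runs over the arrows from \<open>k\<close> to \<open>e\<close> and the inverse of \<open>u\<^sub>\<sigma>\<close>
  includes the inverse of a twist. Summing over \<open>\<G>(e)\<close> instead would commute with \<open>u\<^sub>\<tau>\<close> only for
  \<open>\<tau> \<in> \<G>(e)\<close>, not for arrows between different objects.
\<close>

section \<open>Homomorphisms out of the tensor product\<close>

lemma finprod_hom:
  assumes G: "comm_group G" and H: "comm_group H" and h: "h \<in> hom G H" and f: "f \<in> A \<rightarrow> carrier G"
  shows "h (finprod G f A) = finprod H (\<lambda>i. h (f i)) A"
proof -
  interpret G: comm_group G by fact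
  interpret H: comm_group H by fact
  interpret h: group_hom G H h
    using h by (simp add: group_hom_def group_hom_axioms_def G.group_axioms H.group_axioms)
  \<comment> \<open>For infinite \<open>A\<close> both products are 1 by default, which
    \<open>h\<close> respects.\<close>
  show ?thesis
    using f by (induction A rule: infinite_finite_induct) (auto simp: Pi_iff)
qed

text \<open>Insert \<open>x \<otimes> inv x\<close> behind \<open>y\<close> and commute
  \<open>x\<close> past \<open>y\<close>. It serves for twists and for multiples of 1, since
  membership in \<open>Units B\<close> does not record that the inverse is central.\<close>

lemma (in monoid) inv_central:
  assumes "x \<in> Units G" "y \<in> carrier G" "x \<otimes> y = y \<otimes> x"
  shows "inv x \<otimes> y = y \<otimes> inv x"
proof -
  have "inv x \<otimes> y = inv x \<otimes> (y \<otimes> x) \<otimes> inv x"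
    using assms(1,2) by (simp add: m_assoc Units_closed)
  also have "\<dots> = y \<otimes> inv x"
    using assms by (simp add: Units_closed m_assoc[symmetric] flip: assms(3))
  finally show ?thesis .
qed

context rng_extension
begin

lemma tensor_class_group_hom: "group_hom (tensor_free S) (tensor_product S T) (tensor_class S T)"
  by (intro group_hom.intro group_hom_axioms.intro tensor_class_hom
      comm_group.axioms(2)[OF comm_group_tensor_free] comm_group.axioms(2)[OF comm_group_tensor_product])

text \<open>As \<open>\<zero> \<oplus> \<zero> = \<zero>\<close>, additivity makes the tensor equal
  to its own square, and in a group only the neutral element has this property.\<close>

lemma pure_tensor_zero_left:
  assumes "b \<in> carrier S"
  shows "pure_tensor S T \<zero> b = \<one>\<^bsub>tensor_product S T\<^esub>"
proof -
  interpret P: comm_group "tensor_product S T" by (rule comm_group_tensor_product)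
  show ?thesis
    using P.r_cancel_one'[THEN iffD1, OF _ _ pure_tensor_add_left[of \<zero> \<zero> b, unfolded l_zero[OF zero_closed]]]
      pure_tensor_closed[of \<zero> b] assms
    by simp
qed

lemma pure_tensor_zero_right:
  assumes "a \<in> carrier S"
  shows "pure_tensor S T a \<zero> = \<one>\<^bsub>tensor_product S T\<^esub>"
proof -
  interpret P: comm_group "tensor_product S T" by (rule comm_group_tensor_product)
  show ?thesis
    using P.r_cancel_one'[THEN iffD1, OF _ _ pure_tensor_add_right[of a \<zero> \<zero>, unfolded l_zero[OF zero_closed]]]
      pure_tensor_closed[of a \<zero>] assms
    by simp
qed

text \<open>A free abelian group arises from its generators by differences, and the classes of the
  generators are the pure tensors. The neutral element has no case of its own because it is the pure
  tensor of two zeros.\<close>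

lemma tensor_induct [consumes 1, case_names pure mult inv]:
  assumes X: "X \<in> carrier (tensor_product S T)"
    and pure: "\<And>a b. \<lbrakk>a \<in> carrier S; b \<in> carrier S\<rbrakk> \<Longrightarrow> Q (pure_tensor S T a b)"
    and mult: "\<And>X Y. \<lbrakk>X \<in> carrier (tensor_product S T); Y \<in> carrier (tensor_product S T); Q X; Q Y\<rbrakk>
      \<Longrightarrow> Q (X \<otimes>\<^bsub>tensor_product S T\<^esub> Y)"
    and inv: "\<And>X. \<lbrakk>X \<in> carrier (tensor_product S T); Q X\<rbrakk> \<Longrightarrow> Q (inv\<^bsub>tensor_product S T\<^esub> X)"
  shows "Q X"
proof -
  interpret h: group_hom "tensor_free S" "tensor_product S T" "tensor_class S T"
    by (rule tensor_class_group_hom)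
  obtain x where x: "Poly_Mapping.keys x \<subseteq> carrier S \<times> carrier S" "X = tensor_class S T x"
    using X by (auto simp: carrier_tensor_product tensor_free_def)
  \<comment> \<open>Membership is carried along because \<open>tensor_class\<close> respects the
    operations only on the carrier.\<close>
  have "x \<in> carrier (tensor_free S) \<and> Q (tensor_class S T x)"
    using x(1)
  proof (induction x rule: frag_induction)
    case zero
    have "tensor_class S T 0 = \<one>\<^bsub>tensor_product S T\<^esub>"
      using h.hom_one by (simp add: tensor_free_def)
    then show ?case
      using pure[of \<zero> \<zero>] pure_tensor_zero_left[of \<zero>] by (simp add: tensor_free_def)
  next
    case (one p)
    then show ?case using pure by (cases p) (auto simp: pure_tensor_def)
  next
    case (diff a b)
    then have "a \<otimes>\<^bsub>tensor_free S\<^esub> inv\<^bsub>tensor_free S\<^esub> b \<in> carrier (tensor_free S)"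
      "Q (tensor_class S T (a \<otimes>\<^bsub>tensor_free S\<^esub> inv\<^bsub>tensor_free S\<^esub> b))"
      by (simp_all add: mult inv del: tensor_free_add)
    then show ?case using diff by (simp add: tensor_free_inv)
  qed
  then show ?thesis using x(2) by simp
qed

text \<open>The additive extension of \<open>f\<close> to the free group sends every relator to 1,
  which is what \<open>tensor_lift_eq\<close> asks for in order to pass to cosets.\<close>

lemma tensor_universal:
  assumes "comm_group H"
    and cl: "\<And>a b. \<lbrakk>a \<in> carrier S; b \<in> carrier S\<rbrakk> \<Longrightarrow> f a b \<in> carrier H"
    and addl: "\<And>a a' b. \<lbrakk>a \<in> carrier S; a' \<in> carrier S; b \<in> carrier S\<rbrakk>
      \<Longrightarrow> f (a \<oplus> a') b = f a b \<otimes>\<^bsub>H\<^esub> f a' b"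
    and addr: "\<And>a b b'. \<lbrakk>a \<in> carrier S; b \<in> carrier S; b' \<in> carrier S\<rbrakk>
      \<Longrightarrow> f a (b \<oplus> b') = f a b \<otimes>\<^bsub>H\<^esub> f a b'"
    and bal: "\<And>a t b. \<lbrakk>a \<in> carrier S; t \<in> T; b \<in> carrier S\<rbrakk> \<Longrightarrow> f (a \<otimes> t) b = f a (t \<otimes> b)"
  obtains h where "h \<in> hom (tensor_product S T) H"
    and "\<And>a b. \<lbrakk>a \<in> carrier S; b \<in> carrier S\<rbrakk> \<Longrightarrow> h (pure_tensor S T a b) = f a b"
proof -
  interpret H: comm_group H by fact
  interpret F: comm_group "tensor_free S" by (rule comm_group_tensor_free)
  have "(\<lambda>(a, b). f a b) ` (carrier S \<times> carrier S) \<subseteq> carrier H"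
    using cl by auto
  then obtain g where g: "g \<in> hom (tensor_free S) H"
    and g_frag: "\<And>p. p \<in> carrier S \<times> carrier S \<Longrightarrow> g (frag_of p) = (\<lambda>(a, b). f a b) p"
    unfolding tensor_free_def by (rule H.free_Abelian_group_universal) blast
  interpret g: group_hom "tensor_free S" H g
    using g by (simp add: group_hom_def group_hom_axioms_def F.group_axioms H.group_axioms)
  have minus: "x - y \<in> carrier (tensor_free S)" "g (x - y) = g x \<otimes>\<^bsub>H\<^esub> inv\<^bsub>H\<^esub> g y"
    if x: "x \<in> carrier (tensor_free S)" and y: "y \<in> carrier (tensor_free S)" for x y
  proof -
    have eq: "x \<otimes>\<^bsub>tensor_free S\<^esub> inv\<^bsub>tensor_free S\<^esub> y = x - y"
      using y by (simp add: tensor_free_inv)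
    show "x - y \<in> carrier (tensor_free S)"
      unfolding eq[symmetric] using x y by (intro F.m_closed F.inv_closed)
    show "g (x - y) = g x \<otimes>\<^bsub>H\<^esub> inv\<^bsub>H\<^esub> g y"
      unfolding eq[symmetric] g.hom_mult[OF x F.inv_closed[OF y]] g.hom_inv[OF y] ..
  qed
  \<comment> \<open>Both kinds of additivity relators have this shape.\<close>
  have minus2: "g (frag_of p - frag_of q - frag_of r) = \<one>\<^bsub>H\<^esub>"
    if c: "p \<in> carrier S \<times> carrier S" "q \<in> carrier S \<times> carrier S" "r \<in> carrier S \<times> carrier S"
      and eq: "g (frag_of p) = g (frag_of q) \<otimes>\<^bsub>H\<^esub> g (frag_of r)" for p q r
  proof -
    have fr: "frag_of z \<in> carrier (tensor_free S)" if "z \<in> carrier S \<times> carrier S" for z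
      using that by auto
    have "g (frag_of p - frag_of q - frag_of r) =
        g (frag_of q) \<otimes>\<^bsub>H\<^esub> g (frag_of r) \<otimes>\<^bsub>H\<^esub> inv\<^bsub>H\<^esub> g (frag_of q) \<otimes>\<^bsub>H\<^esub> inv\<^bsub>H\<^esub> g (frag_of r)"
      using c by (simp only: minus fr eq)
    also have "\<dots> = g (frag_of r) \<otimes>\<^bsub>H\<^esub> (g (frag_of q) \<otimes>\<^bsub>H\<^esub> inv\<^bsub>H\<^esub> g (frag_of q)) \<otimes>\<^bsub>H\<^esub> inv\<^bsub>H\<^esub> g (frag_of r)"
      using H.m_comm[of "g (frag_of q)" "g (frag_of r)"] g.hom_closed[OF fr[OF c(2)]] g.hom_closed[OF fr[OF c(3)]]
      by (simp add: H.m_assoc)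
    also have "\<dots> = \<one>\<^bsub>H\<^esub>"
      using g.hom_closed[OF fr[OF c(2)]] g.hom_closed[OF fr[OF c(3)]] by simp
    finally show ?thesis .
  qed
  have rel: "g x = \<one>\<^bsub>H\<^esub>" if "x \<in> tensor_relators S T" for x
    using that unfolding tensor_relators_def
  proof (elim UnE CollectE exE conjE)
    fix a a' b assume "x = frag_of (a \<oplus> a', b) - frag_of (a, b) - frag_of (a', b)"
      "a \<in> carrier S" "a' \<in> carrier S" "b \<in> carrier S"
    then show ?thesis by (simp add: minus2 g_frag addl)
  next
    fix a b b' assume "x = frag_of (a, b \<oplus> b') - frag_of (a, b) - frag_of (a, b')"
      "a \<in> carrier S" "b \<in> carrier S" "b' \<in> carrier S"
    then show ?thesis by (simp add: minus2 g_frag addr)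
  next
    fix a t b assume *: "x = frag_of (a \<otimes> t, b) - frag_of (a, t \<otimes> b)"
      "a \<in> carrier S" "t \<in> T" "b \<in> carrier S"
    moreover have "t \<in> carrier S" using \<open>t \<in> T\<close> subring_subset by blast
    ultimately show ?thesis using cl[of a "t \<otimes> b"] by (simp add: minus g_frag bal m_closed)
  qed
  define h where "h X = the_elem (g ` X)" for X
  have h_class: "h (tensor_class S T x) = g x" if "x \<in> carrier (tensor_free S)" for x
    unfolding h_def using tensor_lift_eq[OF H.group_axioms g rel that] .
  have "h \<in> hom (tensor_product S T) H"
  proof (rule homI)
    fix X assume "X \<in> carrier (tensor_product S T)"
    then show "h X \<in> carrier H" by (auto simp: carrier_tensor_product h_class)
  next
    fix X Y assume "X \<in> carrier (tensor_product S T)" "Y \<in> carrier (tensor_product S T)"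
    then obtain x y where xy: "x \<in> carrier (tensor_free S)" "y \<in> carrier (tensor_free S)"
      "X = tensor_class S T x" "Y = tensor_class S T y"
      by (auto simp: carrier_tensor_product)
    then show "h (X \<otimes>\<^bsub>tensor_product S T\<^esub> Y) = h X \<otimes>\<^bsub>H\<^esub> h Y"
      using hom_mult[OF tensor_class_hom xy(1,2)] h_class[OF F.m_closed[OF xy(1,2)]] g.hom_mult[OF xy(1,2)]
      by (simp add: h_class)
  qed
  moreover have "h (pure_tensor S T a b) = f a b" if "a \<in> carrier S" "b \<in> carrier S" for a b
    using that by (simp add: pure_tensor_def h_class g_frag)
  ultimately show thesis by (rule that)
qed

text \<open>On representatives the action is a \<open>frag_extend\<close>, hence additive, and this
  descends to classes.\<close>

lemma tensor_left_hom:
  assumes s: "s \<in> carrier S"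
  shows "tensor_left S T s \<in> hom (tensor_product S T) (tensor_product S T)"
proof -
  interpret F: comm_group "tensor_free S" by (rule comm_group_tensor_free)
  let ?L = "frag_extend (\<lambda>(a, b). frag_of (s \<otimes> a, b))"
  have L: "?L x \<in> carrier (tensor_free S)" if "x \<in> carrier (tensor_free S)" for x
    using that s keys_frag_extend[of "\<lambda>(a, b). frag_of (s \<otimes> a, b)" x]
    by (fastforce simp: tensor_free_def m_closed split: prod.splits)
  show ?thesis
  proof (rule homI)
    fix X assume "X \<in> carrier (tensor_product S T)"
    then show "tensor_left S T s X \<in> carrier (tensor_product S T)"
      using s L by (auto simp: carrier_tensor_product tensor_left_class)
  next
    fix X Y assume "X \<in> carrier (tensor_product S T)" "Y \<in> carrier (tensor_product S T)"
    then obtain x y where xy: "x \<in> carrier (tensor_free S)" "y \<in> carrier (tensor_free S)"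
      "X = tensor_class S T x" "Y = tensor_class S T y"
      by (auto simp: carrier_tensor_product)
    then show "tensor_left S T s (X \<otimes>\<^bsub>tensor_product S T\<^esub> Y) =
        tensor_left S T s X \<otimes>\<^bsub>tensor_product S T\<^esub> tensor_left S T s Y"
      using s hom_mult[OF tensor_class_hom xy(1,2)] tensor_left_class[OF s F.m_closed[OF xy(1,2)]]
        hom_mult[OF tensor_class_hom L[OF xy(1)] L[OF xy(2)]]
      by (simp add: tensor_left_class frag_extend_add)
  qed
qed

lemma tensor_right_hom:
  assumes s: "s \<in> carrier S"
  shows "(\<lambda>X. tensor_right S T X s) \<in> hom (tensor_product S T) (tensor_product S T)"
proof -
  interpret F: comm_group "tensor_free S" by (rule comm_group_tensor_free)
  let ?L = "frag_extend (\<lambda>(a, b). frag_of (a, b \<otimes> s))"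
  have L: "?L x \<in> carrier (tensor_free S)" if "x \<in> carrier (tensor_free S)" for x
    using that s keys_frag_extend[of "\<lambda>(a, b). frag_of (a, b \<otimes> s)" x]
    by (fastforce simp: tensor_free_def m_closed split: prod.splits)
  show ?thesis
  proof (rule homI)
    fix X assume "X \<in> carrier (tensor_product S T)"
    then show "tensor_right S T X s \<in> carrier (tensor_product S T)"
      using s L by (auto simp: carrier_tensor_product tensor_right_class)
  next
    fix X Y assume "X \<in> carrier (tensor_product S T)" "Y \<in> carrier (tensor_product S T)"
    then obtain x y where xy: "x \<in> carrier (tensor_free S)" "y \<in> carrier (tensor_free S)"
      "X = tensor_class S T x" "Y = tensor_class S T y"
      by (auto simp: carrier_tensor_product)
    then show "tensor_right S T (X \<otimes>\<^bsub>tensor_product S T\<^esub> Y) s =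
        tensor_right S T X s \<otimes>\<^bsub>tensor_product S T\<^esub> tensor_right S T Y s"
      using s hom_mult[OF tensor_class_hom xy(1,2)] tensor_right_class[OF s F.m_closed[OF xy(1,2)]]
        hom_mult[OF tensor_class_hom L[OF xy(1)] L[OF xy(2)]]
      by (simp add: tensor_right_class frag_extend_add)
  qed
qed

end

text \<open>Pure tensors generate the tensor product. Identities that are additive in a tensor are
  thereby reduced to pure tensors.\<close>

lemma (in rng_extension) tensor_hom_ext:
  assumes H: "group H" and h: "h \<in> hom (tensor_product S T) H" "h' \<in> hom (tensor_product S T) H"
    and eq: "\<And>a b. \<lbrakk>a \<in> carrier S; b \<in> carrier S\<rbrakk> \<Longrightarrow> h (pure_tensor S T a b) = h' (pure_tensor S T a b)"
    and X: "X \<in> carrier (tensor_product S T)"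
  shows "h X = h' X"
proof -
  have P: "group (tensor_product S T)" by (rule comm_group.axioms(2)[OF comm_group_tensor_product])
  interpret h: group_hom "tensor_product S T" H h using P H h by (intro group_hom.intro group_hom_axioms.intro)
  interpret h': group_hom "tensor_product S T" H h' using P H h by (intro group_hom.intro group_hom_axioms.intro)
  show ?thesis using X by (induction rule: tensor_induct) (simp_all add: eq)
qed

section \<open>Arrows between objects of a groupoid\<close>

context groupoid
begin

text \<open>\<open>inverse_exists\<close> only asserts existence, so one inverse is fixed by choice;
  \<open>ginv_unique\<close> shows that there is no other.\<close>

definition ginv where
  "ginv \<sigma> = (SOME \<tau>. \<tau> \<in> arrows G \<and> src G \<tau> = tgt G \<sigma> \<and> tgt G \<tau> = src G \<sigma> \<and>
    \<tau> \<star> \<sigma> = src G \<sigma> \<and> \<sigma> \<star> \<tau> = tgt G \<sigma>)"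

lemma ginv:
  assumes "\<sigma> \<in> arrows G"
  shows "ginv \<sigma> \<in> arrows G" "src G (ginv \<sigma>) = tgt G \<sigma>" "tgt G (ginv \<sigma>) = src G \<sigma>"
    "ginv \<sigma> \<star> \<sigma> = src G \<sigma>" "\<sigma> \<star> ginv \<sigma> = tgt G \<sigma>"
  using someI_ex[OF inverse_exists[OF assms, unfolded Bex_def]] unfolding ginv_def by blast+

definition arrows_between where
  "arrows_between k e = {\<sigma> \<in> arrows G. src G \<sigma> = k \<and> tgt G \<sigma> = e}"

lemma isotropy_eq: "isotropy G e = arrows_between e e"
  by (simp add: isotropy_def arrows_between_def)

lemma identitiesD:
  assumes "e \<in> identities G"
  shows "e \<in> arrows G" "src G e = e" "tgt G e = e"
  using assms by (auto simp: identities_def src_closed src_src tgt_src)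

lemma src_identity: "\<sigma> \<in> arrows G \<Longrightarrow> src G \<sigma> \<in> identities G"
  by (simp add: identities_def)

lemma tgt_identity: "\<sigma> \<in> arrows G \<Longrightarrow> tgt G \<sigma> \<in> identities G"
  by (metis identities_def image_eqI src_tgt tgt_closed)

lemma ginv_comp_cancel:
  assumes "\<tau> \<in> arrows G" "\<sigma> \<in> arrows G"
  shows "src G \<tau> = tgt G \<sigma> \<Longrightarrow> ginv \<tau> \<star> (\<tau> \<star> \<sigma>) = \<sigma>"
    and "tgt G \<tau> = tgt G \<sigma> \<Longrightarrow> \<tau> \<star> (ginv \<tau> \<star> \<sigma>) = \<sigma>"
    and "src G \<sigma> = tgt G \<tau> \<Longrightarrow> (\<sigma> \<star> \<tau>) \<star> ginv \<tau> = \<sigma>"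
    and "src G \<sigma> = src G \<tau> \<Longrightarrow> (\<sigma> \<star> ginv \<tau>) \<star> \<tau> = \<sigma>"
proof -
  show "ginv \<tau> \<star> (\<tau> \<star> \<sigma>) = \<sigma>" if "src G \<tau> = tgt G \<sigma>"
    using that assms comp_assoc[of "ginv \<tau>" \<tau> \<sigma>] tgt_comp_self[of \<sigma>] by (simp add: ginv)
  show "\<tau> \<star> (ginv \<tau> \<star> \<sigma>) = \<sigma>" if "tgt G \<tau> = tgt G \<sigma>"
    using that assms comp_assoc[of \<tau> "ginv \<tau>" \<sigma>] tgt_comp_self[of \<sigma>] by (simp add: ginv)
  show "(\<sigma> \<star> \<tau>) \<star> ginv \<tau> = \<sigma>" if "src G \<sigma> = tgt G \<tau>"
    using that assms comp_assoc[of \<sigma> \<tau> "ginv \<tau>"] comp_src[of \<sigma>] by (simp add: ginv)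
  show "(\<sigma> \<star> ginv \<tau>) \<star> \<tau> = \<sigma>" if "src G \<sigma> = src G \<tau>"
    using that assms comp_assoc[of \<sigma> "ginv \<tau>" \<tau>] comp_src[of \<sigma>] by (simp add: ginv)
qed

text \<open>Cancel \<open>\<sigma>\<close> from the left: \<open>\<tau>\<close> is
  \<open>ginv \<sigma> \<star> (\<sigma> \<star> \<tau>)\<close>, and
  \<open>\<sigma> \<star> \<tau>\<close> is the identity at the source of
  \<open>ginv \<sigma>\<close>.\<close>

lemma ginv_unique:
  assumes "\<sigma> \<in> arrows G" "\<tau> \<in> arrows G" "src G \<sigma> = tgt G \<tau>" "\<sigma> \<star> \<tau> = tgt G \<sigma>"
  shows "\<tau> = ginv \<sigma>"
  using assms ginv_comp_cancel(1)[of \<sigma> \<tau>] comp_src[of "ginv \<sigma>"] by (simp add: ginv)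

text \<open>By uniqueness it suffices that the left side is a right inverse of
  \<open>\<sigma>\<close>. This form of the inverse of a product is the one that arises when
  \<open>\<tau>\<close> multiplies \<open>ginv (\<tau> \<star> \<sigma>)\<close> from the
  right.\<close>

lemma ginv_comp:
  assumes "\<tau> \<in> arrows G" "\<sigma> \<in> arrows G" "src G \<tau> = tgt G \<sigma>"
  shows "ginv (\<tau> \<star> \<sigma>) \<star> \<tau> = ginv \<sigma>"
proof (rule ginv_unique)
  have *: "\<tau> \<star> \<sigma> \<in> arrows G" "src G (\<tau> \<star> \<sigma>) = src G \<sigma>" "tgt G (\<tau> \<star> \<sigma>) = tgt G \<tau>"
    using assms by (simp_all add: comp_closed src_comp tgt_comp)
  show "ginv (\<tau> \<star> \<sigma>) \<star> \<tau> \<in> arrows G" "src G \<sigma> = tgt G (ginv (\<tau> \<star> \<sigma>) \<star> \<tau>)"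
    using assms by (simp_all add: * ginv comp_closed tgt_comp)
  \<comment> \<open>Insert \<open>ginv \<tau> \<star> \<tau>\<close> in front, so that
    \<open>\<tau> \<star> \<sigma>\<close> appears and cancels against its inverse.\<close>
  have "\<sigma> \<star> (ginv (\<tau> \<star> \<sigma>) \<star> \<tau>) = ginv \<tau> \<star> (\<tau> \<star> (\<sigma> \<star> (ginv (\<tau> \<star> \<sigma>) \<star> \<tau>)))"
    using assms by (intro ginv_comp_cancel(1)[symmetric]) (simp_all add: * ginv comp_closed tgt_comp)
  also have "\<tau> \<star> (\<sigma> \<star> (ginv (\<tau> \<star> \<sigma>) \<star> \<tau>)) = (\<tau> \<star> \<sigma>) \<star> (ginv (\<tau> \<star> \<sigma>) \<star> \<tau>)"
    using assms by (intro comp_assoc[symmetric]) (simp_all add: * ginv comp_closed tgt_comp)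
  also have "\<dots> = \<tau>"
    using assms by (intro ginv_comp_cancel(2)) (simp_all add: *)
  finally show "\<sigma> \<star> (ginv (\<tau> \<star> \<sigma>) \<star> \<tau>) = tgt G \<sigma>"
    using assms by (simp add: ginv)
qed (use assms in simp)

section \<open>Translations by arrows, base objects and fibres\<close>

lemma bij_betw_comp_left:
  assumes "\<tau> \<in> arrows_between e f"
  shows "bij_betw (\<lambda>\<sigma>. \<tau> \<star> \<sigma>) (arrows_between k e) (arrows_between k f)"
  by (rule bij_betw_byWitness[where f' = "\<lambda>\<sigma>. ginv \<tau> \<star> \<sigma>"])
    (use assms in \<open>auto simp: arrows_between_def ginv ginv_comp_cancel comp_closed src_comp tgt_comp\<close>)

text \<open>For \<open>f = e\<close> this expresses that the isotropy group at \<open>e\<close> acts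
  freely and transitively by left multiplication on the arrows from \<open>k\<close> to
  \<open>e\<close>: the map is the orbit map of \<open>\<tau>\<close>.\<close>

lemma bij_betw_comp_right:
  assumes "\<tau> \<in> arrows_between k e"
  shows "bij_betw (\<lambda>\<sigma>. \<sigma> \<star> \<tau>) (arrows_between e f) (arrows_between k f)"
  by (rule bij_betw_byWitness[where f' = "\<lambda>\<sigma>. \<sigma> \<star> ginv \<tau>"])
    (use assms in \<open>auto simp: arrows_between_def ginv ginv_comp_cancel comp_closed src_comp tgt_comp\<close>)

text \<open>A base object of the connected component of \<open>e\<close>. The predicate under the
  choice depends only on the component, which makes \<open>base_src\<close> true.\<close>

definition base where
  "base e = (SOME k. k \<in> identities G \<and> arrows_between k e \<noteq> {})"

lemma base:
  assumes "e \<in> identities G"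
  shows "base e \<in> identities G" "arrows_between (base e) e \<noteq> {}"
proof -
  have "e \<in> identities G \<and> arrows_between e e \<noteq> {}"
    using assms identitiesD[OF assms] by (auto simp: arrows_between_def)
  from someI[of "\<lambda>k. k \<in> identities G \<and> arrows_between k e \<noteq> {}", OF this]
  show "base e \<in> identities G" "arrows_between (base e) e \<noteq> {}"
    unfolding base_def by auto
qed

text \<open>Composition with \<open>\<tau>\<close> turns arrows into its source into arrows into its
  target, bijectively. The two predicates under \<open>SOME\<close> are therefore equal, and so are
  the chosen objects.\<close>

lemma base_src:
  assumes "\<tau> \<in> arrows G"
  shows "base (src G \<tau>) = base (tgt G \<tau>)"
proof -
  have "arrows_between k (src G \<tau>) \<noteq> {} \<longleftrightarrow> arrows_between k (tgt G \<tau>) \<noteq> {}" for k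
    using bij_betw_comp_left[of \<tau> "src G \<tau>" "tgt G \<tau>" k] assms
    by (auto simp: arrows_between_def bij_betw_def)
  then show ?thesis by (simp add: base_def)
qed

text \<open>The index set of the separability element attached to \<open>e\<close>.\<close>

definition fibre where
  "fibre e = arrows_between (base e) e"

lemma fibreD:
  assumes "\<sigma> \<in> fibre e"
  shows "\<sigma> \<in> arrows G" "tgt G \<sigma> = e" "src G \<sigma> = base e"
  using assms by (auto simp: fibre_def arrows_between_def)

text \<open>Any single arrow from the base object to \<open>e\<close> translates the isotropy group
  at the base onto the fibre; this determines the size of the fibre.\<close>

lemma bij_betw_fibre:
  assumes "e \<in> identities G"
  obtains h where "bij_betw h (isotropy G (base e)) (fibre e)"
proof -
  obtain \<sigma> where "\<sigma> \<in> arrows_between (base e) e" using base(2)[OF assms] by blast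
  from that[OF bij_betw_comp_left[OF this, of "base e", folded isotropy_eq fibre_def]] show thesis .
qed

text \<open>Both fibres start at the same base object by \<open>base_src\<close>, so
  \<open>\<tau>\<close> carries one onto the other even when its source and target differ.\<close>

lemma bij_betw_fibre_comp:
  assumes "\<tau> \<in> arrows G"
  shows "bij_betw (\<lambda>\<sigma>. \<tau> \<star> \<sigma>) (fibre (src G \<tau>)) (fibre (tgt G \<tau>))"
  unfolding fibre_def base_src[OF assms]
  using assms by (intro bij_betw_comp_left) (simp add: arrows_between_def)

end

section \<open>Coefficients of tensors\<close>

context object_twist
begin

abbreviation T where "T \<equiv> identity_component B G \<beta>"
abbreviation P where "P \<equiv> tensor_product R T"

sublocale Ext: rng_extension R T
  by (rule rng_extension_twisted)

lemma twist_Units: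
  "\<lbrakk>\<sigma> \<in> arrows G; \<tau> \<in> arrows G; src G \<sigma> = tgt G \<tau>\<rbrakk> \<Longrightarrow> \<beta> \<sigma> \<tau> \<in> Units B"
  using twist_unit[of \<sigma> \<tau>] by (fastforce simp: center_ring_def Units_def)

section \<open>Coefficients of products with monomials and with elements of \<open>T\<close>;
  consequences of the cocycle condition\<close>

lemma monomial_mult_left:
  assumes "c \<in> carrier B" "\<tau> \<in> arrows G" "\<sigma> \<in> arrows G" "src G \<tau> = tgt G \<sigma>" and a: "a \<in> carrier R"
  shows "(monomial B c \<tau> \<otimes>\<^bsub>R\<^esub> a) (\<tau> \<star>\<^bsub>G\<^esub> \<sigma>) = c \<otimes>\<^bsub>B\<^esub> a \<sigma> \<otimes>\<^bsub>B\<^esub> \<beta> \<tau> \<sigma>"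
proof -
  \<comment> \<open>\<open>\<sigma>\<close> is added to the support so that the index set below is
    exactly one pair even if \<open>a \<sigma>\<close> vanishes.\<close>
  let ?E = "insert \<sigma> {\<sigma>. a \<sigma> \<noteq> \<zero>\<^bsub>B\<^esub>}"
  \<comment> \<open>\<open>\<tau>'\<close> names the outer arrow, which the bound
    \<open>\<tau>\<close> of the summand hides.\<close>
  have "(monomial B c \<tau> \<otimes>\<^bsub>R\<^esub> a) (\<tau> \<star>\<^bsub>G\<^esub> \<sigma>) = finsum B
      (\<lambda>(\<tau>, \<sigma>). monomial B c \<tau>' \<tau> \<otimes>\<^bsub>B\<^esub> a \<sigma> \<otimes>\<^bsub>B\<^esub> \<beta> \<tau> \<sigma>) (composable_pairs {\<tau>} ?E (\<tau> \<star>\<^bsub>G\<^esub> \<sigma>))" if "\<tau>' = \<tau>" for \<tau>'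
    using assms supp_finite[OF a] unfolding that
    by (intro twisted_mult monomial_closed) (auto simp: monomial_def)
  moreover have "composable_pairs {\<tau>} ?E (\<tau> \<star>\<^bsub>G\<^esub> \<sigma>) = {(\<tau>, \<sigma>)}"
    using assms ginv_comp_cancel(1)[of \<tau>] by (auto simp: composable_pairs_def) metis+
  ultimately show ?thesis
    using assms by (simp add: monomial_def twist_closed)
qed

lemma monomial_mult_right:
  assumes "c \<in> carrier B" "\<tau> \<in> arrows G" "\<sigma> \<in> arrows G" "src G \<sigma> = tgt G \<tau>" and a: "a \<in> carrier R"
  shows "(a \<otimes>\<^bsub>R\<^esub> monomial B c \<tau>) (\<sigma> \<star>\<^bsub>G\<^esub> \<tau>) = a \<sigma> \<otimes>\<^bsub>B\<^esub> c \<otimes>\<^bsub>B\<^esub> \<beta> \<sigma> \<tau>"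
proof -
  let ?E = "insert \<sigma> {\<sigma>. a \<sigma> \<noteq> \<zero>\<^bsub>B\<^esub>}"
  have "(a \<otimes>\<^bsub>R\<^esub> monomial B c \<tau>) (\<sigma> \<star>\<^bsub>G\<^esub> \<tau>) = finsum B
      (\<lambda>(\<sigma>, \<tau>). a \<sigma> \<otimes>\<^bsub>B\<^esub> monomial B c \<tau>' \<tau> \<otimes>\<^bsub>B\<^esub> \<beta> \<sigma> \<tau>) (composable_pairs ?E {\<tau>} (\<sigma> \<star>\<^bsub>G\<^esub> \<tau>))" if "\<tau>' = \<tau>" for \<tau>'
    using assms supp_finite[OF a] unfolding that
    by (intro twisted_mult monomial_closed) (auto simp: monomial_def)
  moreover have "composable_pairs ?E {\<tau>} (\<sigma> \<star>\<^bsub>G\<^esub> \<tau>) = {(\<sigma>, \<tau>)}"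
    using assms ginv_comp_cancel(3)[of \<tau>] by (auto simp: composable_pairs_def) metis+
  ultimately show ?thesis
    using assms by (simp add: monomial_def twist_closed)
qed

text \<open>Only identities occur in \<open>t\<close>, and the only identity that composes on the
  right with an arrow to give \<open>\<sigma>\<close> is \<open>src G \<sigma>\<close>; the twist
  there is 1.\<close>

lemma identity_component_mult_right:
  assumes a: "a \<in> carrier R" and t: "t \<in> T" and \<sigma>: "\<sigma> \<in> arrows G"
  shows "(a \<otimes>\<^bsub>R\<^esub> t) \<sigma> = a \<sigma> \<otimes>\<^bsub>B\<^esub> t (src G \<sigma>)"
proof -
  let ?E = "insert \<sigma> {\<sigma>. a \<sigma> \<noteq> \<zero>\<^bsub>B\<^esub>}" and ?F = "insert (src G \<sigma>) {\<sigma>. t \<sigma> \<noteq> \<zero>\<^bsub>B\<^esub>}"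
  have tR: "t \<in> carrier R" and t0: "\<And>\<tau>. t \<tau> \<noteq> \<zero>\<^bsub>B\<^esub> \<Longrightarrow> \<tau> \<in> identities G"
    using t by (auto simp: identity_component_eq)
  have "(a \<otimes>\<^bsub>R\<^esub> t) \<sigma> = finsum B (\<lambda>(\<sigma>, \<tau>). a \<sigma> \<otimes>\<^bsub>B\<^esub> t \<tau> \<otimes>\<^bsub>B\<^esub> \<beta> \<sigma> \<tau>) (composable_pairs ?E ?F \<sigma>)"
    using a tR supp_finite[OF a] supp_finite[OF tR] by (intro twisted_mult) auto
  also have "composable_pairs ?E ?F \<sigma> = {(\<sigma>, src G \<sigma>)}"
    using \<sigma> t0 by (fastforce simp: composable_pairs_def comp_src src_closed tgt_src dest!: t0 identitiesD(3) dest: src_identity)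
  finally show ?thesis
    using a tR \<sigma> by (simp add: twist_src)
qed

lemma identity_component_mult_left:
  assumes a: "a \<in> carrier R" and t: "t \<in> T" and \<sigma>: "\<sigma> \<in> arrows G"
  shows "(t \<otimes>\<^bsub>R\<^esub> a) \<sigma> = t (tgt G \<sigma>) \<otimes>\<^bsub>B\<^esub> a \<sigma>"
proof -
  let ?E = "insert \<sigma> {\<sigma>. a \<sigma> \<noteq> \<zero>\<^bsub>B\<^esub>}" and ?F = "insert (tgt G \<sigma>) {\<sigma>. t \<sigma> \<noteq> \<zero>\<^bsub>B\<^esub>}"
  have tR: "t \<in> carrier R" and t0: "\<And>\<tau>. t \<tau> \<noteq> \<zero>\<^bsub>B\<^esub> \<Longrightarrow> \<tau> \<in> identities G"
    using t by (auto simp: identity_component_eq)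
  have F: "?F \<subseteq> identities G" using t0 tgt_identity[OF \<sigma>] by auto
  have "(t \<otimes>\<^bsub>R\<^esub> a) \<sigma> = finsum B (\<lambda>(\<sigma>, \<tau>). t \<sigma> \<otimes>\<^bsub>B\<^esub> a \<tau> \<otimes>\<^bsub>B\<^esub> \<beta> \<sigma> \<tau>) (composable_pairs ?F ?E \<sigma>)"
    using a tR supp_finite[OF a] supp_finite[OF tR] by (intro twisted_mult) auto
  also have "composable_pairs ?F ?E \<sigma> = {(tgt G \<sigma>, \<sigma>)}"
  proof -
    have "p = tgt G \<sigma> \<and> q = \<sigma>" if "(p, q) \<in> composable_pairs ?F ?E \<sigma>" for p q
    proof -
      have "p \<in> identities G" "q \<in> arrows G" "src G p = tgt G q" "p \<star>\<^bsub>G\<^esub> q = \<sigma>"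
        using that F by (auto simp: composable_pairs_def)
      then show ?thesis using identitiesD(2)[of p] tgt_comp_self[of q] by auto
    qed
    moreover have "(tgt G \<sigma>, \<sigma>) \<in> composable_pairs ?F ?E \<sigma>"
      using \<sigma> by (simp add: composable_pairs_def tgt_closed src_tgt tgt_comp_self)
    ultimately show ?thesis by auto
  qed
  finally show ?thesis
    using a tR \<sigma> by (simp add: twist_tgt)
qed

text \<open>These are the cocycle conditions for the triples
  \<open>\<tau>, \<sigma>, ginv \<sigma>\<close> and \<open>\<tau> \<star> \<sigma>, ginv (\<tau>
  \<star> \<sigma>), \<tau>\<close>. In each of them one inner product is an identity, where the
  twist is 1.\<close>

lemma twist_ginv_comp:
  assumes \<tau>: "\<tau> \<in> arrows G" and \<sigma>: "\<sigma> \<in> arrows G" and st: "src G \<tau> = tgt G \<sigma>"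
  shows "\<beta> \<tau> \<sigma> \<otimes>\<^bsub>B\<^esub> \<beta> (\<tau> \<star>\<^bsub>G\<^esub> \<sigma>) (ginv \<sigma>) = \<beta> \<sigma> (ginv \<sigma>)"
    and "\<beta> (ginv (\<tau> \<star>\<^bsub>G\<^esub> \<sigma>)) \<tau> \<otimes>\<^bsub>B\<^esub> \<beta> (\<tau> \<star>\<^bsub>G\<^esub> \<sigma>) (ginv \<sigma>) = \<beta> (\<tau> \<star>\<^bsub>G\<^esub> \<sigma>) (ginv (\<tau> \<star>\<^bsub>G\<^esub> \<sigma>))"
proof -
  have c: "\<tau> \<star>\<^bsub>G\<^esub> \<sigma> \<in> arrows G" "src G (\<tau> \<star>\<^bsub>G\<^esub> \<sigma>) = src G \<sigma>" "tgt G (\<tau> \<star>\<^bsub>G\<^esub> \<sigma>) = tgt G \<tau>"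
    using assms by (simp_all add: comp_closed src_comp tgt_comp)
  show "\<beta> \<tau> \<sigma> \<otimes>\<^bsub>B\<^esub> \<beta> (\<tau> \<star>\<^bsub>G\<^esub> \<sigma>) (ginv \<sigma>) = \<beta> \<sigma> (ginv \<sigma>)"
    using cocycle[OF \<tau> \<sigma> ginv(1)[OF \<sigma>] st] \<sigma> \<tau> st twist_src[OF \<tau>] by (simp add: ginv twist_closed)
  show "\<beta> (ginv (\<tau> \<star>\<^bsub>G\<^esub> \<sigma>)) \<tau> \<otimes>\<^bsub>B\<^esub> \<beta> (\<tau> \<star>\<^bsub>G\<^esub> \<sigma>) (ginv \<sigma>) = \<beta> (\<tau> \<star>\<^bsub>G\<^esub> \<sigma>) (ginv (\<tau> \<star>\<^bsub>G\<^esub> \<sigma>))"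
    using cocycle[OF c(1) ginv(1)[OF c(1)] \<tau>] assms c twist_tgt[OF \<tau>]
    by (simp add: ginv ginv_comp twist_closed)
qed

section \<open>Coefficient functionals on the tensor product\<close>

definition tensor_coeff where
  "tensor_coeff \<sigma> \<tau> = (SOME h. h \<in> hom P (add_monoid B) \<and>
    (\<forall>a \<in> carrier R. \<forall>b \<in> carrier R. h (pure_tensor R T a b) = a \<sigma> \<otimes>\<^bsub>B\<^esub> b \<tau>))"

text \<open>Let \<open>k\<close> be the common object \<open>src G \<sigma> = tgt G \<tau>\<close>.
  Both \<open>a \<otimes> t, b\<close> and \<open>a, t \<otimes> b\<close> yield
  \<open>a \<sigma> \<otimes> t k \<otimes> b \<tau>\<close>, so the map is balanced over
  \<open>T\<close> and the universal property applies. The chosen functional is determined on the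
  carrier, as pure tensors generate.\<close>

lemma tensor_coeff:
  assumes "\<sigma> \<in> arrows G" "\<tau> \<in> arrows G" "src G \<sigma> = tgt G \<tau>"
  shows tensor_coeff_hom: "tensor_coeff \<sigma> \<tau> \<in> hom P (add_monoid B)"
    and tensor_coeff_pure: "\<lbrakk>a \<in> carrier R; b \<in> carrier R\<rbrakk>
      \<Longrightarrow> tensor_coeff \<sigma> \<tau> (pure_tensor R T a b) = a \<sigma> \<otimes>\<^bsub>B\<^esub> b \<tau>"
proof -
  have T: "t \<in> carrier R" if "t \<in> T" for t
    using that by (simp add: identity_component_eq)
  obtain h where "h \<in> hom P (add_monoid B)"
    "\<And>a b. \<lbrakk>a \<in> carrier R; b \<in> carrier R\<rbrakk> \<Longrightarrow> h (pure_tensor R T a b) = a \<sigma> \<otimes>\<^bsub>B\<^esub> b \<tau>"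
    by (rule Ext.tensor_universal[of "add_monoid B" "\<lambda>a b. a \<sigma> \<otimes>\<^bsub>B\<^esub> b \<tau>"])
      (use assms T in \<open>auto simp: B.a_comm_group twisted_add B.l_distr B.r_distr B.m_assoc
        identity_component_mult_left identity_component_mult_right\<close>)
  then have "\<exists>h. h \<in> hom P (add_monoid B) \<and>
      (\<forall>a \<in> carrier R. \<forall>b \<in> carrier R. h (pure_tensor R T a b) = a \<sigma> \<otimes>\<^bsub>B\<^esub> b \<tau>)" by blast
  from someI_ex[OF this, folded tensor_coeff_def]
  show "tensor_coeff \<sigma> \<tau> \<in> hom P (add_monoid B)"
    and "\<lbrakk>a \<in> carrier R; b \<in> carrier R\<rbrakk>
      \<Longrightarrow> tensor_coeff \<sigma> \<tau> (pure_tensor R T a b) = a \<sigma> \<otimes>\<^bsub>B\<^esub> b \<tau>" by blast+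
qed

lemma tensor_coeff_closed:
  "\<lbrakk>\<sigma> \<in> arrows G; \<tau> \<in> arrows G; src G \<sigma> = tgt G \<tau>; X \<in> carrier P\<rbrakk> \<Longrightarrow> tensor_coeff \<sigma> \<tau> X \<in> carrier B"
  using hom_in_carrier[OF tensor_coeff_hom] by fastforce

text \<open>Both sides are additive in \<open>X\<close>. For a pure tensor, multiplication by
  \<open>\<tau>\<close> adds the factor \<open>\<beta> \<tau> \<sigma>\<close> behind the
  coefficient of \<open>a\<close>, and centrality brings it to the front.\<close>

lemma tensor_coeff_left:
  assumes \<tau>: "\<tau> \<in> arrows G" and \<sigma>: "\<sigma> \<in> arrows G" and \<rho>: "\<rho> \<in> arrows G"
    and st: "src G \<tau> = tgt G \<sigma>" "src G \<sigma> = tgt G \<rho>" and X: "X \<in> carrier P"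
  shows "tensor_coeff (\<tau> \<star>\<^bsub>G\<^esub> \<sigma>) \<rho> (tensor_left R T (monomial B \<one>\<^bsub>B\<^esub> \<tau>) X) = \<beta> \<tau> \<sigma> \<otimes>\<^bsub>B\<^esub> tensor_coeff \<sigma> \<rho> X"
proof -
  have m: "monomial B \<one>\<^bsub>B\<^esub> \<tau> \<in> carrier R" using \<tau> by (simp add: monomial_closed)
  have c: "\<tau> \<star>\<^bsub>G\<^esub> \<sigma> \<in> arrows G" "src G (\<tau> \<star>\<^bsub>G\<^esub> \<sigma>) = tgt G \<rho>"
    using assms by (simp_all add: comp_closed src_comp)
  have "(tensor_coeff (\<tau> \<star>\<^bsub>G\<^esub> \<sigma>) \<rho> \<circ> tensor_left R T (monomial B \<one>\<^bsub>B\<^esub> \<tau>)) X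
      = (\<lambda>X. \<beta> \<tau> \<sigma> \<otimes>\<^bsub>B\<^esub> tensor_coeff \<sigma> \<rho> X) X"
  proof (rule Ext.tensor_hom_ext[OF B.a_group _ _ _ X])
    show "tensor_coeff (\<tau> \<star>\<^bsub>G\<^esub> \<sigma>) \<rho> \<circ> tensor_left R T (monomial B \<one>\<^bsub>B\<^esub> \<tau>) \<in> hom P (add_monoid B)"
      by (rule hom_compose[OF Ext.tensor_left_hom[OF m] tensor_coeff_hom[OF c(1) \<rho> c(2)]])
    show "(\<lambda>X. \<beta> \<tau> \<sigma> \<otimes>\<^bsub>B\<^esub> tensor_coeff \<sigma> \<rho> X) \<in> hom P (add_monoid B)"
      using hom_mult[OF tensor_coeff_hom[OF \<sigma> \<rho> st(2)]] tensor_coeff_closed[OF \<sigma> \<rho> st(2)] twist_closed[OF \<tau> \<sigma> st(1)]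
      by (intro homI) (simp_all add: B.r_distr)
  next
    fix a b assume ab: "a \<in> carrier R" "b \<in> carrier R"
    then show "(tensor_coeff (\<tau> \<star>\<^bsub>G\<^esub> \<sigma>) \<rho> \<circ> tensor_left R T (monomial B \<one>\<^bsub>B\<^esub> \<tau>)) (pure_tensor R T a b)
        = \<beta> \<tau> \<sigma> \<otimes>\<^bsub>B\<^esub> tensor_coeff \<sigma> \<rho> (pure_tensor R T a b)"
      using \<tau> \<sigma> \<rho> st c m
      by (simp add: Ext.tensor_left_pure tensor_coeff_pure monomial_mult_left twisted_mult_closed
          twist_closed twist_central B.m_assoc[symmetric])
  qed
  then show ?thesis by simp
qed

lemma tensor_coeff_right:
  assumes \<tau>: "\<tau> \<in> arrows G" and \<sigma>: "\<sigma> \<in> arrows G" and \<rho>: "\<rho> \<in> arrows G"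
    and st: "src G \<sigma> = tgt G \<rho>" "src G \<rho> = tgt G \<tau>" and X: "X \<in> carrier P"
  shows "tensor_coeff \<sigma> (\<rho> \<star>\<^bsub>G\<^esub> \<tau>) (tensor_right R T X (monomial B \<one>\<^bsub>B\<^esub> \<tau>)) = tensor_coeff \<sigma> \<rho> X \<otimes>\<^bsub>B\<^esub> \<beta> \<rho> \<tau>"
proof -
  have m: "monomial B \<one>\<^bsub>B\<^esub> \<tau> \<in> carrier R" using \<tau> by (simp add: monomial_closed)
  have c: "\<rho> \<star>\<^bsub>G\<^esub> \<tau> \<in> arrows G" "src G \<sigma> = tgt G (\<rho> \<star>\<^bsub>G\<^esub> \<tau>)"
    using assms by (simp_all add: comp_closed tgt_comp)
  have "(tensor_coeff \<sigma> (\<rho> \<star>\<^bsub>G\<^esub> \<tau>) \<circ> (\<lambda>X. tensor_right R T X (monomial B \<one>\<^bsub>B\<^esub> \<tau>))) X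
      = (\<lambda>X. tensor_coeff \<sigma> \<rho> X \<otimes>\<^bsub>B\<^esub> \<beta> \<rho> \<tau>) X"
  proof (rule Ext.tensor_hom_ext[OF B.a_group _ _ _ X])
    show "tensor_coeff \<sigma> (\<rho> \<star>\<^bsub>G\<^esub> \<tau>) \<circ> (\<lambda>X. tensor_right R T X (monomial B \<one>\<^bsub>B\<^esub> \<tau>)) \<in> hom P (add_monoid B)"
      by (rule hom_compose[OF Ext.tensor_right_hom[OF m] tensor_coeff_hom[OF \<sigma> c]])
    show "(\<lambda>X. tensor_coeff \<sigma> \<rho> X \<otimes>\<^bsub>B\<^esub> \<beta> \<rho> \<tau>) \<in> hom P (add_monoid B)"
      using hom_mult[OF tensor_coeff_hom[OF \<sigma> \<rho> st(1)]] tensor_coeff_closed[OF \<sigma> \<rho> st(1)] twist_closed[OF \<rho> \<tau> st(2)]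
      by (intro homI) (simp_all add: B.l_distr)
  next
    fix a b assume ab: "a \<in> carrier R" "b \<in> carrier R"
    then show "(tensor_coeff \<sigma> (\<rho> \<star>\<^bsub>G\<^esub> \<tau>) \<circ> (\<lambda>X. tensor_right R T X (monomial B \<one>\<^bsub>B\<^esub> \<tau>))) (pure_tensor R T a b)
        = tensor_coeff \<sigma> \<rho> (pure_tensor R T a b) \<otimes>\<^bsub>B\<^esub> \<beta> \<rho> \<tau>"
      using \<tau> \<sigma> \<rho> st c m
      by (simp add: Ext.tensor_right_pure tensor_coeff_pure monomial_mult_right twisted_mult_closed
          twist_closed B.m_assoc)
  qed
  then show ?thesis by simp
qed

text \<open>A product of two arrows is the identity \<open>e\<close> only for pairs
  \<open>\<sigma>, ginv \<sigma>\<close> with \<open>\<sigma>\<close> ending in \<open>e\<close>, so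
  these coefficients determine the value of the product at \<open>e\<close>. The formula is claimed
  for all finite \<open>E\<close> above \<open>F\<close> so that two tensors can be compared over
  one index set.\<close>

lemma tensor_mult_coeff:
  assumes "X \<in> carrier P" and e: "e \<in> identities G"
  obtains F where "finite F" "\<And>\<sigma>. \<lbrakk>\<sigma> \<in> arrows G; \<sigma> \<notin> F\<rbrakk> \<Longrightarrow> tensor_coeff \<sigma> (ginv \<sigma>) X = \<zero>\<^bsub>B\<^esub>"
    and "\<And>E. \<lbrakk>finite E; F \<subseteq> E\<rbrakk> \<Longrightarrow> tensor_mult R X e =
      (\<Oplus>\<^bsub>B\<^esub>\<sigma> \<in> {\<sigma> \<in> E. \<sigma> \<in> arrows G \<and> tgt G \<sigma> = e}. tensor_coeff \<sigma> (ginv \<sigma>) X \<otimes>\<^bsub>B\<^esub> \<beta> \<sigma> (ginv \<sigma>))"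
proof -
  let ?N = "\<lambda>E. {\<sigma> \<in> E. \<sigma> \<in> arrows G \<and> tgt G \<sigma> = e}"
  let ?h = "\<lambda>E X. \<Oplus>\<^bsub>B\<^esub>\<sigma> \<in> ?N E. tensor_coeff \<sigma> (ginv \<sigma>) X \<otimes>\<^bsub>B\<^esub> \<beta> \<sigma> (ginv \<sigma>)"
  interpret P: comm_group P by (rule Ext.comm_group_tensor_product)
  have coeff_hom: "group_hom P (add_monoid B) (tensor_coeff \<sigma> (ginv \<sigma>))" if "\<sigma> \<in> arrows G" for \<sigma>
    using that tensor_coeff_hom[of \<sigma> "ginv \<sigma>"]
    by (intro group_hom.intro group_hom_axioms.intro P.group_axioms B.a_group) (simp add: ginv)
  have cl: "tensor_coeff \<sigma> (ginv \<sigma>) X \<in> carrier B" if "\<sigma> \<in> arrows G" "X \<in> carrier P" for \<sigma> X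
    using that by (simp add: tensor_coeff_closed ginv)
  have add: "tensor_coeff \<sigma> (ginv \<sigma>) (X \<otimes>\<^bsub>P\<^esub> Y) = tensor_coeff \<sigma> (ginv \<sigma>) X \<oplus>\<^bsub>B\<^esub> tensor_coeff \<sigma> (ginv \<sigma>) Y"
    if "\<sigma> \<in> arrows G" "X \<in> carrier P" "Y \<in> carrier P" for \<sigma> X Y
    using group_hom.hom_mult[OF coeff_hom[OF that(1)] that(2,3)] by simp
  have neg: "tensor_coeff \<sigma> (ginv \<sigma>) (inv\<^bsub>P\<^esub> X) = \<ominus>\<^bsub>B\<^esub> tensor_coeff \<sigma> (ginv \<sigma>) X"
    if "\<sigma> \<in> arrows G" "X \<in> carrier P" for \<sigma> X
    using group_hom.hom_inv[OF coeff_hom[OF that(1)] that(2)] by (simp add: a_inv_def)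
  have tw: "\<beta> \<sigma> (ginv \<sigma>) \<in> carrier B" if "\<sigma> \<in> arrows G" for \<sigma>
    using that by (simp add: twist_closed ginv)
  have h: "group_hom P (add_monoid B) (?h E)" for E
  proof (intro group_hom.intro group_hom_axioms.intro P.group_axioms B.a_group homI)
    fix X assume X: "X \<in> carrier P"
    then show "?h E X \<in> carrier (add_monoid B)"
      by (auto intro!: B.finsum_closed simp: cl tw)
    fix Y assume Y: "Y \<in> carrier P"
    have "?h E (X \<otimes>\<^bsub>P\<^esub> Y) = (\<Oplus>\<^bsub>B\<^esub>\<sigma> \<in> ?N E. tensor_coeff \<sigma> (ginv \<sigma>) X \<otimes>\<^bsub>B\<^esub> \<beta> \<sigma> (ginv \<sigma>) \<oplus>\<^bsub>B\<^esub>
        tensor_coeff \<sigma> (ginv \<sigma>) Y \<otimes>\<^bsub>B\<^esub> \<beta> \<sigma> (ginv \<sigma>))"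
      using X Y by (intro B.finsum_cong') (auto simp: add cl tw B.l_distr)
    also have "\<dots> = ?h E X \<oplus>\<^bsub>B\<^esub> ?h E Y"
      using X Y by (intro B.finsum_addf) (auto simp: cl tw)
    finally show "?h E (X \<otimes>\<^bsub>P\<^esub> Y) = ?h E X \<otimes>\<^bsub>add_monoid B\<^esub> ?h E Y" by simp
  qed
  have m: "group_hom P (add_monoid B) (\<lambda>X. tensor_mult R X e)"
    using hom_mult[OF Ext.tensor_mult_hom] hom_in_carrier[OF Ext.tensor_mult_hom]
    by (intro group_hom.intro group_hom_axioms.intro P.group_axioms B.a_group homI) (auto simp: twisted_add)
  have "\<exists>F. finite F \<and> (\<forall>\<sigma> \<in> arrows G. \<sigma> \<notin> F \<longrightarrow> tensor_coeff \<sigma> (ginv \<sigma>) X = \<zero>\<^bsub>B\<^esub>) \<and>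
    (\<forall>E. finite E \<longrightarrow> F \<subseteq> E \<longrightarrow> tensor_mult R X e = ?h E X)"
    using assms(1)
  proof (induction rule: Ext.tensor_induct)
    case (pure a b)
    \<comment> \<open>For a pure tensor the support of the left factor already bounds the relevant
      arrows.\<close>
    let ?F = "{\<sigma>. a \<sigma> \<noteq> \<zero>\<^bsub>B\<^esub>}" and ?B = "{\<sigma>. b \<sigma> \<noteq> \<zero>\<^bsub>B\<^esub>}"
    have "tensor_coeff \<sigma> (ginv \<sigma>) (pure_tensor R T a b) = \<zero>\<^bsub>B\<^esub>" if "\<sigma> \<in> arrows G" "\<sigma> \<notin> ?F" for \<sigma>
      using that pure by (simp add: tensor_coeff_pure ginv)
    moreover have "tensor_mult R (pure_tensor R T a b) e = ?h E (pure_tensor R T a b)"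
      if E: "finite E" "?F \<subseteq> E" for E
    proof -
      let ?f = "\<lambda>(\<sigma>, \<tau>). a \<sigma> \<otimes>\<^bsub>B\<^esub> b \<tau> \<otimes>\<^bsub>B\<^esub> \<beta> \<sigma> \<tau>" and ?p = "\<lambda>\<sigma>. (\<sigma>, ginv \<sigma>)"
      \<comment> \<open>The second index set contains the support of \<open>b\<close>, as
        \<open>twisted_mult\<close> requires, and the inverses of \<open>E\<close>, so that no pair
        is missing.\<close>
      have "composable_pairs E (?B \<union> ginv ` E) e = ?p ` ?N E"
      proof (intro equalityI subsetI)
        fix q assume "q \<in> composable_pairs E (?B \<union> ginv ` E) e"
        then obtain \<sigma> \<tau> where q: "q = (\<sigma>, \<tau>)" "\<sigma> \<in> E" "\<sigma> \<in> arrows G" "\<tau> \<in> arrows G" "src G \<sigma> = tgt G \<tau>" "\<sigma> \<star>\<^bsub>G\<^esub> \<tau> = e"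
          by (auto simp: composable_pairs_def)
        then have "tgt G \<sigma> = e" using tgt_comp[of \<sigma> \<tau>] identitiesD(3)[OF e] by simp
        with q ginv_unique[of \<sigma> \<tau>] show "q \<in> ?p ` ?N E" by auto
      qed (auto simp: composable_pairs_def ginv)
      moreover have "(a \<otimes>\<^bsub>R\<^esub> b) e = finsum B ?f (composable_pairs E (?B \<union> ginv ` E) e)"
        using pure E supp_finite[of b] by (intro twisted_mult) auto
      moreover have "finsum B ?f (?p ` ?N E) = finsum B (\<lambda>\<sigma>. ?f (?p \<sigma>)) (?N E)"
        using pure by (intro B.add.finprod_reindex) (auto simp: inj_on_def tw)
      moreover have "\<dots> = ?h E (pure_tensor R T a b)"
        using pure by (intro B.finsum_cong') (auto simp: tensor_coeff_pure ginv tw)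
      ultimately show ?thesis using pure by (simp add: Ext.tensor_mult_pure)
    qed
    ultimately show ?case using supp_finite[OF pure(1)] by (intro exI[of _ ?F]) simp
  next
    case (mult X Y)
    then obtain F F' where F: "finite F" "\<forall>\<sigma> \<in> arrows G. \<sigma> \<notin> F \<longrightarrow> tensor_coeff \<sigma> (ginv \<sigma>) X = \<zero>\<^bsub>B\<^esub>"
      "\<forall>E. finite E \<longrightarrow> F \<subseteq> E \<longrightarrow> tensor_mult R X e = ?h E X"
      and F': "finite F'" "\<forall>\<sigma> \<in> arrows G. \<sigma> \<notin> F' \<longrightarrow> tensor_coeff \<sigma> (ginv \<sigma>) Y = \<zero>\<^bsub>B\<^esub>"
      "\<forall>E. finite E \<longrightarrow> F' \<subseteq> E \<longrightarrow> tensor_mult R Y e = ?h E Y" by blast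
    \<comment> \<open>The freedom in \<open>E\<close> is used here: a set above
      \<open>F \<union> F'\<close> is large enough for both tensors.\<close>
    have "tensor_mult R (X \<otimes>\<^bsub>P\<^esub> Y) e = ?h E (X \<otimes>\<^bsub>P\<^esub> Y)" if "finite E" "F \<union> F' \<subseteq> E" for E
      using F(3) F'(3) that unfolding group_hom.hom_mult[OF h mult(1,2)] group_hom.hom_mult[OF m mult(1,2)] by simp
    then show ?case using F(1,2) F'(1,2) mult(1,2) by (intro exI[of _ "F \<union> F'"]) (simp add: add)
  next
    case (inv X)
    then obtain F where F: "finite F" "\<forall>\<sigma> \<in> arrows G. \<sigma> \<notin> F \<longrightarrow> tensor_coeff \<sigma> (ginv \<sigma>) X = \<zero>\<^bsub>B\<^esub>"
      "\<forall>E. finite E \<longrightarrow> F \<subseteq> E \<longrightarrow> tensor_mult R X e = ?h E X" by blast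
    have "tensor_mult R (inv\<^bsub>P\<^esub> X) e = ?h E (inv\<^bsub>P\<^esub> X)" if "finite E" "F \<subseteq> E" for E
      using F(3) that unfolding group_hom.hom_inv[OF h inv(1)] group_hom.hom_inv[OF m inv(1)] by simp
    then show ?case using F(1,2) inv(1) by (intro exI[of _ F]) (simp add: neg)
  qed
  then show thesis using that by blast
qed

subsection \<open>Finiteness and invertibility of the isotropy groups\<close>

text \<open>A multiple can be moved onto either factor of a product, so \<open>b\<close> is an
  inverse on both sides.\<close>

lemma add_pow_one_Units:
  assumes "b \<in> carrier B" "add_pow B (n::nat) b = \<one>\<^bsub>B\<^esub>"
  shows "add_pow B n \<one>\<^bsub>B\<^esub> \<in> Units B"
proof -
  have "add_pow B n \<one>\<^bsub>B\<^esub> \<otimes>\<^bsub>B\<^esub> b = \<one>\<^bsub>B\<^esub>" "b \<otimes>\<^bsub>B\<^esub> add_pow B n \<one>\<^bsub>B\<^esub> = \<one>\<^bsub>B\<^esub>"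
    using assms by (simp_all add: B.add_pow_ldistr B.add_pow_rdistr)
  then show ?thesis
    using assms(1) B.add.nat_pow_closed[of "\<one>\<^bsub>B\<^esub>" n] unfolding Units_def by auto
qed

text \<open>\<open>\<xi>\<close> commutes with \<open>u\<^sub>\<tau>\<close>. Comparing the
  coefficients of the two products at \<open>\<tau> \<star> \<sigma>\<close> and
  \<open>ginv \<sigma>\<close> relates the coefficients of \<open>\<xi>\<close> at
  \<open>\<sigma>\<close> and at \<open>\<tau> \<star> \<sigma>\<close> up to twists, and the
  cocycle condition absorbs these.\<close>

lemma section_coeff_invariant:
  assumes \<delta>: "bimodule_section R T \<delta>" and \<tau>: "\<tau> \<in> isotropy G e" and \<sigma>: "\<sigma> \<in> arrows G" "tgt G \<sigma> = e"
  defines "\<xi> \<equiv> \<delta> (monomial B \<one>\<^bsub>B\<^esub> e)"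
  shows "tensor_coeff (\<tau> \<star>\<^bsub>G\<^esub> \<sigma>) (ginv (\<tau> \<star>\<^bsub>G\<^esub> \<sigma>)) \<xi> \<otimes>\<^bsub>B\<^esub> \<beta> (\<tau> \<star>\<^bsub>G\<^esub> \<sigma>) (ginv (\<tau> \<star>\<^bsub>G\<^esub> \<sigma>)) =
    tensor_coeff \<sigma> (ginv \<sigma>) \<xi> \<otimes>\<^bsub>B\<^esub> \<beta> \<sigma> (ginv \<sigma>)"
proof -
  let ?u = "monomial B \<one>\<^bsub>B\<^esub>" and ?\<pi> = "\<tau> \<star>\<^bsub>G\<^esub> \<sigma>"
  have t: "\<tau> \<in> arrows G" "src G \<tau> = e" "tgt G \<tau> = e" using \<tau> by (auto simp: isotropy_def)
  have e: "e \<in> arrows G" "src G e = e" "tgt G e = e"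
    using identitiesD tgt_identity[OF \<sigma>(1)] \<sigma>(2) by auto
  have p: "?\<pi> \<in> arrows G" "src G ?\<pi> = src G \<sigma>" "tgt G ?\<pi> = e"
    using t \<sigma> by (simp_all add: comp_closed src_comp tgt_comp)
  have u: "?u e \<in> carrier R" "?u \<tau> \<in> carrier R" using e t by (simp_all add: monomial_closed)
  have X: "\<xi> \<in> carrier P"
    using \<delta> u(1) hom_in_carrier[of \<delta> "add_monoid R" P] by (auto simp: bimodule_section_def \<xi>_def)
  \<comment> \<open>As \<open>\<tau>\<close> starts and ends in \<open>e\<close>, left and right
    linearity of \<open>\<delta>\<close> both compute \<open>\<delta> u\<^sub>\<tau>\<close> from
    \<open>\<xi>\<close>.\<close>
  have "?u \<tau> \<otimes>\<^bsub>R\<^esub> ?u e = ?u \<tau>" "?u e \<otimes>\<^bsub>R\<^esub> ?u \<tau> = ?u \<tau>"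
    using t e comp_src[OF t(1)] tgt_comp_self[OF t(1)] twist_src[OF t(1)] twist_tgt[OF t(1)]
    by (simp_all add: monomial_mult)
  then have comm: "tensor_left R T (?u \<tau>) \<xi> = tensor_right R T \<xi> (?u \<tau>)"
    using \<delta> u unfolding bimodule_section_def \<xi>_def by metis
  have "\<beta> \<tau> \<sigma> \<otimes>\<^bsub>B\<^esub> tensor_coeff \<sigma> (ginv \<sigma>) \<xi> = tensor_coeff ?\<pi> (ginv \<sigma>) (tensor_left R T (?u \<tau>) \<xi>)"
    using t \<sigma> X by (simp add: tensor_coeff_left ginv)
  also have "\<dots> = tensor_coeff ?\<pi> (ginv ?\<pi>) \<xi> \<otimes>\<^bsub>B\<^esub> \<beta> (ginv ?\<pi>) \<tau>"
    using tensor_coeff_right[of \<tau> ?\<pi> "ginv ?\<pi>" \<xi>] t \<sigma> X p by (simp add: comm ginv ginv_comp)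
  finally have eq: "\<beta> \<tau> \<sigma> \<otimes>\<^bsub>B\<^esub> tensor_coeff \<sigma> (ginv \<sigma>) \<xi> = tensor_coeff ?\<pi> (ginv ?\<pi>) \<xi> \<otimes>\<^bsub>B\<^esub> \<beta> (ginv ?\<pi>) \<tau>" .
  have cl: "tensor_coeff \<sigma> (ginv \<sigma>) \<xi> \<in> carrier B" "tensor_coeff ?\<pi> (ginv ?\<pi>) \<xi> \<in> carrier B"
    "\<beta> \<tau> \<sigma> \<in> carrier B" "\<beta> (ginv ?\<pi>) \<tau> \<in> carrier B" "\<beta> ?\<pi> (ginv \<sigma>) \<in> carrier B"
    using t \<sigma> X p by (simp_all add: tensor_coeff_closed twist_closed ginv)
  \<comment> \<open>Multiply \<open>eq\<close> by \<open>\<beta> ?\<pi> (ginv \<sigma>)\<close>; the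
    two parts of \<open>twist_ginv_comp\<close> evaluate the twists on either side.\<close>
  have "tensor_coeff ?\<pi> (ginv ?\<pi>) \<xi> \<otimes>\<^bsub>B\<^esub> \<beta> ?\<pi> (ginv ?\<pi>) = \<beta> \<tau> \<sigma> \<otimes>\<^bsub>B\<^esub> tensor_coeff \<sigma> (ginv \<sigma>) \<xi> \<otimes>\<^bsub>B\<^esub> \<beta> ?\<pi> (ginv \<sigma>)"
    using twist_ginv_comp(2)[OF t(1) \<sigma>(1)] t \<sigma> cl by (simp add: eq B.m_assoc)
  also have "\<dots> = tensor_coeff \<sigma> (ginv \<sigma>) \<xi> \<otimes>\<^bsub>B\<^esub> \<beta> \<sigma> (ginv \<sigma>)"
    using twist_ginv_comp(1)[OF t(1) \<sigma>(1)] t \<sigma> cl twist_central[of \<tau> \<sigma> "tensor_coeff \<sigma> (ginv \<sigma>) \<xi>"]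
    by (simp add: B.m_assoc)
  finally show ?thesis .
qed

lemma isotropy_if_separable:
  assumes \<delta>: "bimodule_section R T \<delta>" and e: "e \<in> identities G"
  shows "finite (isotropy G e) \<and> add_pow B (card (isotropy G e)) \<one>\<^bsub>B\<^esub> \<in> Units B"
proof -
  let ?u = "monomial B \<one>\<^bsub>B\<^esub> e" and ?G = "isotropy G e"
  define \<xi> where "\<xi> = \<delta> ?u"
  define w where "w \<sigma> = tensor_coeff \<sigma> (ginv \<sigma>) \<xi> \<otimes>\<^bsub>B\<^esub> \<beta> \<sigma> (ginv \<sigma>)" for \<sigma>
  have u: "?u \<in> carrier R" using identitiesD[OF e] by (simp add: monomial_closed)
  have X: "\<xi> \<in> carrier P"
    using \<delta> u hom_in_carrier[of \<delta> "add_monoid R" P] by (auto simp: bimodule_section_def \<xi>_def)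
  have w_closed: "w \<sigma> \<in> carrier B" if "\<sigma> \<in> arrows G" for \<sigma>
    using that X by (simp add: w_def tensor_coeff_closed twist_closed ginv)
  have inv: "w (\<tau> \<star>\<^bsub>G\<^esub> \<sigma>) = w \<sigma>" if "\<tau> \<in> ?G" "\<sigma> \<in> arrows G" "tgt G \<sigma> = e" for \<tau> \<sigma>
    using section_coeff_invariant[OF \<delta> that] by (simp add: w_def \<xi>_def)
  \<comment> \<open>This is the section property for \<open>u\<^sub>e\<close>, read at the
    coefficient \<open>e\<close>.\<close>
  have one: "tensor_mult R \<xi> e = \<one>\<^bsub>B\<^esub>"
    using \<delta> u by (simp add: bimodule_section_def \<xi>_def monomial_def)
  obtain F where F: "finite F" "\<And>\<sigma>. \<lbrakk>\<sigma> \<in> arrows G; \<sigma> \<notin> F\<rbrakk> \<Longrightarrow> tensor_coeff \<sigma> (ginv \<sigma>) \<xi> = \<zero>\<^bsub>B\<^esub>"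
    "\<And>E. \<lbrakk>finite E; F \<subseteq> E\<rbrakk> \<Longrightarrow> tensor_mult R \<xi> e = (\<Oplus>\<^bsub>B\<^esub>\<sigma> \<in> {\<sigma> \<in> E. \<sigma> \<in> arrows G \<and> tgt G \<sigma> = e}. w \<sigma>)"
    by (rule tensor_mult_coeff[OF X e, folded w_def]) (rule that)
  have w0: "w \<sigma> = \<zero>\<^bsub>B\<^esub>" if "\<sigma> \<in> arrows G" "\<sigma> \<notin> F" for \<sigma>
    using that F(2) by (simp add: w_def twist_closed ginv)
  have orbit: "bij_betw (\<lambda>\<tau>. \<tau> \<star>\<^bsub>G\<^esub> \<sigma>) ?G (arrows_between (src G \<sigma>) e)" if "\<sigma> \<in> arrows G" "tgt G \<sigma> = e" for \<sigma>
    unfolding isotropy_eq using that by (intro bij_betw_comp_right) (simp add: arrows_between_def)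
  \<comment> \<open>If the group is infinite, so is the orbit of each \<open>\<sigma>\<close>, which
    then leaves the finite set \<open>F\<close>. By invariance every weight vanishes, contradicting
    the sum 1.\<close>
  have fin: "finite ?G"
  proof (rule ccontr)
    assume inf: "infinite ?G"
    have "w \<sigma> = \<zero>\<^bsub>B\<^esub>" if \<sigma>: "\<sigma> \<in> arrows G" "tgt G \<sigma> = e" for \<sigma>
    proof -
      have "infinite ((\<lambda>\<tau>. \<tau> \<star>\<^bsub>G\<^esub> \<sigma>) ` ?G)"
        using finite_image_iff[OF bij_betw_imp_inj_on[OF orbit[OF \<sigma>]]] inf by blast
      then obtain \<tau> where "\<tau> \<in> ?G" "\<tau> \<star>\<^bsub>G\<^esub> \<sigma> \<notin> F"
        using F(1) by (meson finite_subset image_subsetI)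
      then show ?thesis
        using inv[of \<tau> \<sigma>] w0[of "\<tau> \<star>\<^bsub>G\<^esub> \<sigma>"] \<sigma> comp_closed[of \<tau> \<sigma>] by (auto simp: isotropy_def)
    qed
    then have "(\<Oplus>\<^bsub>B\<^esub>\<sigma> \<in> {\<sigma> \<in> F. \<sigma> \<in> arrows G \<and> tgt G \<sigma> = e}. w \<sigma>) = (\<Oplus>\<^bsub>B\<^esub>\<sigma> \<in> {\<sigma> \<in> F. \<sigma> \<in> arrows G \<and> tgt G \<sigma> = e}. \<zero>\<^bsub>B\<^esub>)"
      by (intro B.finsum_cong') auto
    then show False using F(3)[OF F(1) order_refl] one nonzero by simp
  qed
  have fin_between: "finite (arrows_between (src G \<sigma>) e)" "card (arrows_between (src G \<sigma>) e) = card ?G"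
    if "\<sigma> \<in> arrows G" "tgt G \<sigma> = e" for \<sigma>
    using orbit[OF that] fin bij_betw_finite bij_betw_same_card by metis+
  let ?N = "{\<sigma> \<in> F. \<sigma> \<in> arrows G \<and> tgt G \<sigma> = e}"
  \<comment> \<open>Arrows into \<open>e\<close> with a fixed source form one orbit, so the orbits
    that meet \<open>F\<close> are indexed by their sources; \<open>s\<close> picks a representative
    of each.\<close>
  let ?K = "src G ` ?N"
  define s where "s k = (SOME \<sigma>. \<sigma> \<in> ?N \<and> src G \<sigma> = k)" for k
  have s: "s k \<in> arrows G" "tgt G (s k) = e" "src G (s k) = k" if "k \<in> ?K" for k
    using someI_ex[of "\<lambda>\<sigma>. \<sigma> \<in> ?N \<and> src G \<sigma> = k"] that unfolding s_def by blast+
  let ?U = "\<Union>k\<in>?K. arrows_between k e"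
  have w_src: "w \<sigma> = w (s k)" if "k \<in> ?K" "\<sigma> \<in> arrows_between k e" for k \<sigma>
  proof -
    have "\<sigma> \<in> (\<lambda>\<tau>. \<tau> \<star>\<^bsub>G\<^esub> s k) ` ?G"
      using that orbit[OF s(1,2)[OF that(1)]] s(3)[OF that(1)] by (auto simp: bij_betw_def)
    then show ?thesis using inv s[OF that(1)] by blast
  qed
  \<comment> \<open>Adding \<open>?U\<close> to \<open>F\<close> completes the orbits. The arrows of
    \<open>F\<close> into \<open>e\<close> lie in \<open>?U\<close> already, so the sum splits into
    full orbits with constant weight.\<close>
  have "\<one>\<^bsub>B\<^esub> = (\<Oplus>\<^bsub>B\<^esub>\<sigma> \<in> {\<sigma> \<in> F \<union> ?U. \<sigma> \<in> arrows G \<and> tgt G \<sigma> = e}. w \<sigma>)"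
    using one F(1) fin_between by (subst (asm) F(3)[of "F \<union> ?U"]) auto
  also have "{\<sigma> \<in> F \<union> ?U. \<sigma> \<in> arrows G \<and> tgt G \<sigma> = e} = ?U"
    by (auto simp: arrows_between_def)
  also have "(\<Oplus>\<^bsub>B\<^esub>\<sigma> \<in> ?U. w \<sigma>) = (\<Oplus>\<^bsub>B\<^esub>k \<in> ?K. \<Oplus>\<^bsub>B\<^esub>\<sigma> \<in> arrows_between k e. w \<sigma>)"
    using F(1) fin_between w_closed
    by (intro B.add.finprod_UN_disjoint) (auto simp: pairwise_def disjnt_def arrows_between_def)
  also have "\<dots> = (\<Oplus>\<^bsub>B\<^esub>k \<in> ?K. add_pow B (card ?G) \<one>\<^bsub>B\<^esub> \<otimes>\<^bsub>B\<^esub> w (s k))"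
  proof (rule B.finsum_cong'[OF refl])
    fix k assume k: "k \<in> ?K"
    note sk = s[OF k]
    have "(\<Oplus>\<^bsub>B\<^esub>\<sigma> \<in> arrows_between k e. w \<sigma>) = (\<Oplus>\<^bsub>B\<^esub>\<sigma> \<in> arrows_between k e. w (s k))"
      using w_src[OF k] w_closed[OF sk(1)] by (intro B.finsum_cong') auto
    also have "\<dots> = add_pow B (card ?G) (w (s k))"
      using B.add.finprod_const[OF w_closed[OF sk(1)], of "arrows_between k e"]
        fin_between(2)[OF sk(1,2)] sk(3) by simp
    finally show "(\<Oplus>\<^bsub>B\<^esub>\<sigma> \<in> arrows_between k e. w \<sigma>) = add_pow B (card ?G) \<one>\<^bsub>B\<^esub> \<otimes>\<^bsub>B\<^esub> w (s k)"
      using w_closed[OF sk(1)] by (simp add: B.add_pow_ldistr)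
  qed (use s(1) w_closed in auto)
  also have "\<dots> = add_pow B (card ?G) \<one>\<^bsub>B\<^esub> \<otimes>\<^bsub>B\<^esub> (\<Oplus>\<^bsub>B\<^esub>k \<in> ?K. w (s k))"
    using F(1) s(1) w_closed by (intro B.finsum_rdistr[symmetric]) auto
  also have "\<dots> = add_pow B (card ?G) (\<Oplus>\<^bsub>B\<^esub>k \<in> ?K. w (s k))"
    using s(1) w_closed by (subst B.add_pow_ldistr) (auto intro!: B.finsum_closed)
  finally have "add_pow B (card ?G) (\<Oplus>\<^bsub>B\<^esub>k \<in> ?K. w (s k)) = \<one>\<^bsub>B\<^esub>" ..
  moreover have "(\<Oplus>\<^bsub>B\<^esub>k \<in> ?K. w (s k)) \<in> carrier B"
    using s(1) w_closed by (auto intro!: B.finsum_closed)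
  ultimately show ?thesis using fin add_pow_one_Units by blast
qed

subsection \<open>Support on the source objects\<close>

lemma twisted_mult_nonzero:
  assumes f: "f \<in> carrier R" and g: "g \<in> carrier R" and nz: "(f \<otimes>\<^bsub>R\<^esub> g) \<rho> \<noteq> \<zero>\<^bsub>B\<^esub>"
  obtains \<sigma> \<tau> where "\<sigma> \<in> arrows G" "\<tau> \<in> arrows G" "src G \<sigma> = tgt G \<tau>" "\<sigma> \<star>\<^bsub>G\<^esub> \<tau> = \<rho>"
    "f \<sigma> \<noteq> \<zero>\<^bsub>B\<^esub>" "g \<tau> \<noteq> \<zero>\<^bsub>B\<^esub>"
proof -
  have "composable_pairs {\<sigma>. f \<sigma> \<noteq> \<zero>\<^bsub>B\<^esub>} {\<tau>. g \<tau> \<noteq> \<zero>\<^bsub>B\<^esub>} \<rho> \<noteq> {}"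
    using nz twisted_mult[OF f g supp_finite[OF f] supp_finite[OF g] order_refl order_refl, of \<rho>] by auto
  then show thesis using that by (auto simp: composable_pairs_def)
qed

text \<open>The objects \<open>e\<close> with \<open>x u\<^sub>e \<noteq> 0\<close>. They replace a
  unit, which is absent when there are infinitely many objects: \<open>x\<close> is the finite sum
  of its products with these \<open>u\<^sub>e\<close>.\<close>

definition src_support where
  "src_support x = src G ` {\<sigma>. x \<sigma> \<noteq> \<zero>\<^bsub>B\<^esub>}"

lemma src_support_finite: "x \<in> carrier R \<Longrightarrow> finite (src_support x)"
  by (simp add: src_support_def supp_finite)

lemma src_support_identities: "x \<in> carrier R \<Longrightarrow> src_support x \<subseteq> identities G"
  by (auto simp: src_support_def identities_def carrier_twisted)

lemma src_support_add:
  "src_support (x \<oplus>\<^bsub>R\<^esub> y) \<subseteq> src_support x \<union> src_support y"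
proof -
  have "{\<sigma>. x \<sigma> \<oplus>\<^bsub>B\<^esub> y \<sigma> \<noteq> \<zero>\<^bsub>B\<^esub>} \<subseteq> {\<sigma>. x \<sigma> \<noteq> \<zero>\<^bsub>B\<^esub>} \<union> {\<sigma>. y \<sigma> \<noteq> \<zero>\<^bsub>B\<^esub>}"
    by auto
  then show ?thesis unfolding src_support_def twisted_add by blast
qed

lemma src_support_mult:
  assumes "s \<in> carrier R" "x \<in> carrier R"
  shows "src_support (s \<otimes>\<^bsub>R\<^esub> x) \<subseteq> src_support x"
proof
  fix e assume "e \<in> src_support (s \<otimes>\<^bsub>R\<^esub> x)"
  then obtain \<rho> where \<rho>: "(s \<otimes>\<^bsub>R\<^esub> x) \<rho> \<noteq> \<zero>\<^bsub>B\<^esub>" "e = src G \<rho>" by (auto simp: src_support_def)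
  obtain \<sigma> \<tau> where "\<sigma> \<in> arrows G" "\<tau> \<in> arrows G" "src G \<sigma> = tgt G \<tau>" "\<sigma> \<star>\<^bsub>G\<^esub> \<tau> = \<rho>" "x \<tau> \<noteq> \<zero>\<^bsub>B\<^esub>"
    by (rule twisted_mult_nonzero[OF assms \<rho>(1)])
  then have "e = src G \<tau>" "\<tau> \<in> {\<tau>. x \<tau> \<noteq> \<zero>\<^bsub>B\<^esub>}" using \<rho>(2) src_comp by auto
  then show "e \<in> src_support x" unfolding src_support_def by (rule image_eqI)
qed

lemma src_support_monomial: "src_support (monomial B c \<tau>) \<subseteq> {src G \<tau>}"
  by (auto simp: src_support_def monomial_def)

text \<open>No arrow in the support of \<open>x\<close> starts where \<open>\<sigma>\<close> ends.
  Hence terms outside the source support are trivial and index sets may be enlarged.\<close>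

lemma mult_monomial_zero:
  assumes "x \<in> carrier R" "c \<in> carrier B" "\<sigma> \<in> arrows G" "tgt G \<sigma> \<notin> src_support x"
  shows "x \<otimes>\<^bsub>R\<^esub> monomial B c \<sigma> = \<zero>\<^bsub>R\<^esub>"
proof
  fix \<rho>
  have "(x \<otimes>\<^bsub>R\<^esub> monomial B c \<sigma>) \<rho> = \<zero>\<^bsub>B\<^esub>"
  proof (rule ccontr)
    assume "\<not> ?thesis"
    then obtain \<pi> \<tau> where "src G \<pi> = tgt G \<tau>" "x \<pi> \<noteq> \<zero>\<^bsub>B\<^esub>" "monomial B c \<sigma> \<tau> \<noteq> \<zero>\<^bsub>B\<^esub>"
      using twisted_mult_nonzero[OF assms(1) monomial_closed[OF assms(2,3)]] by blast
    then have "\<tau> = \<sigma>" by (auto simp: monomial_def split: if_splits)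
    moreover have "src G \<pi> \<in> src_support x"
      using \<open>x \<pi> \<noteq> \<zero>\<^bsub>B\<^esub>\<close> unfolding src_support_def by blast
    ultimately show False using assms(4) \<open>src G \<pi> = tgt G \<tau>\<close> by simp
  qed
  then show "(x \<otimes>\<^bsub>R\<^esub> monomial B c \<sigma>) \<rho> = \<zero>\<^bsub>R\<^esub> \<rho>" by (simp add: twisted_zero)
qed

lemma add_pow_monomial:
  assumes "c \<in> carrier B" "\<rho> \<in> arrows G"
  shows "add_pow R (n::nat) (monomial B c \<rho>) = monomial B (add_pow B n c) \<rho>"
proof (induction n)
  case 0
  then show ?case by (simp add: monomial_zero)
next
  case (Suc n)
  then show ?case
    using assms by (auto simp: twisted_add monomial_def)
qed

end

section \<open>The bimodule section\<close>

locale isotropy_invertible = object_twist +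
  assumes isotropy_finite: "e \<in> identities G \<Longrightarrow> finite (isotropy G e)"
    and isotropy_unit: "e \<in> identities G \<Longrightarrow> add_pow B (card (isotropy G e)) \<one>\<^bsub>B\<^esub> \<in> Units B"
begin

lemma fibre_finite:
  assumes e: "e \<in> identities G"
  shows "finite (fibre e)"
proof -
  obtain h where "bij_betw h (isotropy G (base e)) (fibre e)" by (rule bij_betw_fibre[OF e])
  then show ?thesis using isotropy_finite[OF base(1)[OF e]] bij_betw_finite by blast
qed

lemma card_fibre:
  assumes e: "e \<in> identities G"
  shows "card (fibre e) = card (isotropy G (base e))"
proof -
  obtain h where "bij_betw h (isotropy G (base e)) (fibre e)" by (rule bij_betw_fibre[OF e])
  then show ?thesis using bij_betw_same_card by fastforce
qed

section \<open>Weights and tensor factors of the separability elements\<close>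

definition weight where
  "weight k = inv\<^bsub>B\<^esub> (add_pow B (card (isotropy G k)) \<one>\<^bsub>B\<^esub>)"

lemma weight_closed: "k \<in> identities G \<Longrightarrow> weight k \<in> carrier B"
  by (simp add: weight_def isotropy_unit)

lemma weight_central:
  assumes "k \<in> identities G" "b \<in> carrier B"
  shows "weight k \<otimes>\<^bsub>B\<^esub> b = b \<otimes>\<^bsub>B\<^esub> weight k"
  unfolding weight_def
  using assms by (intro B.inv_central isotropy_unit) (simp_all add: B.add_pow_ldistr B.add_pow_rdistr)

lemma card_weight:
  assumes "k \<in> identities G" "b \<in> carrier B"
  shows "add_pow B (card (isotropy G k)) (b \<otimes>\<^bsub>B\<^esub> weight k) = b"
proof -
  let ?n = "card (isotropy G k)"
  have "add_pow B ?n (b \<otimes>\<^bsub>B\<^esub> weight k) = b \<otimes>\<^bsub>B\<^esub> (add_pow B ?n \<one>\<^bsub>B\<^esub> \<otimes>\<^bsub>B\<^esub> weight k)"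
    using assms weight_closed[OF assms(1)] by (simp add: B.add_pow_ldistr B.add_pow_rdistr)
  then show ?thesis using assms isotropy_unit by (simp add: weight_def)
qed

text \<open>For \<open>\<sigma>\<close> in a fibre the source is the base object, so the weight is
  the same along the fibre and does not change under left translation by an arrow.\<close>

definition left_factor where
  "left_factor \<sigma> = monomial B (weight (src G \<sigma>)) \<sigma>"

text \<open>The inverse of \<open>u\<^sub>\<sigma>\<close>: the product of
  \<open>u\<^sub>\<sigma>\<close> with it is the monomial with coefficient 1 at
  \<open>tgt G \<sigma>\<close>.\<close>

definition right_factor where
  "right_factor \<sigma> = monomial B (inv\<^bsub>B\<^esub> (\<beta> \<sigma> (ginv \<sigma>))) (ginv \<sigma>)"

lemma twist_ginv_Units: "\<sigma> \<in> arrows G \<Longrightarrow> \<beta> \<sigma> (ginv \<sigma>) \<in> Units B"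
  by (simp add: twist_Units ginv)

lemma left_factor_closed: "\<sigma> \<in> arrows G \<Longrightarrow> left_factor \<sigma> \<in> carrier R"
  by (simp add: left_factor_def monomial_closed weight_closed src_identity)

lemma right_factor_closed: "\<sigma> \<in> arrows G \<Longrightarrow> right_factor \<sigma> \<in> carrier R"
  by (simp add: right_factor_def monomial_closed ginv twist_ginv_Units)

lemma left_factor_mult_right_factor:
  assumes \<sigma>: "\<sigma> \<in> arrows G"
  shows "left_factor \<sigma> \<otimes>\<^bsub>R\<^esub> right_factor \<sigma> = monomial B (weight (src G \<sigma>)) (tgt G \<sigma>)"
  using assms weight_closed[OF src_identity[OF \<sigma>]] twist_ginv_Units[OF \<sigma>]
  by (simp add: left_factor_def right_factor_def monomial_mult ginv B.m_assoc B.Units_closed)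

text \<open>The two summands differ by an element of \<open>T\<close> moved across the tensor sign.\<close>

lemma factor_shift:
  assumes x: "x \<in> carrier R" and c: "c \<in> carrier B" and \<tau>: "\<tau> \<in> arrows G" and \<sigma>: "\<sigma> \<in> arrows G"
    and st: "src G \<tau> = tgt G \<sigma>"
  shows "pure_tensor R T (x \<otimes>\<^bsub>R\<^esub> left_factor (\<tau> \<star>\<^bsub>G\<^esub> \<sigma>)) (right_factor (\<tau> \<star>\<^bsub>G\<^esub> \<sigma>) \<otimes>\<^bsub>R\<^esub> monomial B c \<tau>) =
    pure_tensor R T (x \<otimes>\<^bsub>R\<^esub> monomial B c \<tau> \<otimes>\<^bsub>R\<^esub> left_factor \<sigma>) (right_factor \<sigma>)"
proof -
  let ?\<pi> = "\<tau> \<star>\<^bsub>G\<^esub> \<sigma>" and ?k = "src G \<sigma>"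
  \<comment> \<open>The element of \<open>T\<close> that is moved across. It sits at the common
    source of \<open>\<sigma>\<close> and \<open>?\<pi>\<close>, and its coefficient is the one for
    which \<open>u\<^sub>?\<pi> ?t = c u\<^sub>\<tau> u\<^sub>\<sigma>\<close>.\<close>
  let ?t = "monomial B (c \<otimes>\<^bsub>B\<^esub> \<beta> \<tau> \<sigma>) ?k"
  have p: "?\<pi> \<in> arrows G" "src G ?\<pi> = src G \<sigma>" "tgt G ?\<pi> = tgt G \<tau>"
    using \<tau> \<sigma> st by (simp_all add: comp_closed src_comp tgt_comp)
  have k: "?k \<in> identities G" "?k \<in> arrows G" "src G ?k = ?k" "tgt G ?k = ?k"
    using \<sigma> by (simp_all add: src_identity src_closed src_src tgt_src)
  have cl: "\<beta> \<tau> \<sigma> \<in> carrier B" "\<beta> (ginv ?\<pi>) \<tau> \<in> carrier B" "\<beta> ?\<pi> (ginv \<sigma>) \<in> carrier B" "weight ?k \<in> carrier B"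
    using \<tau> \<sigma> st p k by (simp_all add: twist_closed ginv weight_closed)
  define i where "i = inv\<^bsub>B\<^esub> (\<beta> \<sigma> (ginv \<sigma>))"
  define j where "j = inv\<^bsub>B\<^esub> (\<beta> ?\<pi> (ginv ?\<pi>))"
  have ij: "i \<in> carrier B" "j \<in> carrier B" "\<beta> \<sigma> (ginv \<sigma>) \<otimes>\<^bsub>B\<^esub> i = \<one>\<^bsub>B\<^esub>" "j \<otimes>\<^bsub>B\<^esub> \<beta> ?\<pi> (ginv ?\<pi>) = \<one>\<^bsub>B\<^esub>"
    unfolding i_def j_def using \<sigma> p by (simp_all add: twist_ginv_Units)
  have jc: "j \<otimes>\<^bsub>B\<^esub> c = c \<otimes>\<^bsub>B\<^esub> j"
    unfolding j_def using c p by (intro B.inv_central twist_ginv_Units twist_central) (simp_all add: ginv)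
  have tT: "?t \<in> T"
  proof -
    have "?t \<in> carrier R" using c cl k by (simp add: monomial_closed)
    then show ?thesis using k by (auto simp: identity_component_eq monomial_def split: if_splits)
  qed
  have tR: "?t \<in> carrier R" using tT by (simp add: identity_component_eq)
  \<comment> \<open>Insert \<open>\<beta> \<sigma> (ginv \<sigma>) \<otimes> i = 1\<close> and
    expand it by the first cocycle relation; the second one then cancels \<open>j\<close>.\<close>
  have "j \<otimes>\<^bsub>B\<^esub> \<beta> (ginv ?\<pi>) \<tau> = j \<otimes>\<^bsub>B\<^esub> \<beta> (ginv ?\<pi>) \<tau> \<otimes>\<^bsub>B\<^esub> (\<beta> \<sigma> (ginv \<sigma>) \<otimes>\<^bsub>B\<^esub> i)"
    using ij cl by simp
  also have "\<dots> = j \<otimes>\<^bsub>B\<^esub> \<beta> (ginv ?\<pi>) \<tau> \<otimes>\<^bsub>B\<^esub> (\<beta> ?\<pi> (ginv \<sigma>) \<otimes>\<^bsub>B\<^esub> \<beta> \<tau> \<sigma> \<otimes>\<^bsub>B\<^esub> i)"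
    using twist_ginv_comp(1)[OF \<tau> \<sigma> st] twist_central[OF \<tau> \<sigma> st cl(3)] by simp
  also have "\<dots> = j \<otimes>\<^bsub>B\<^esub> (\<beta> (ginv ?\<pi>) \<tau> \<otimes>\<^bsub>B\<^esub> \<beta> ?\<pi> (ginv \<sigma>)) \<otimes>\<^bsub>B\<^esub> (\<beta> \<tau> \<sigma> \<otimes>\<^bsub>B\<^esub> i)"
    using ij cl by (simp add: B.m_assoc)
  also have "\<dots> = \<beta> \<tau> \<sigma> \<otimes>\<^bsub>B\<^esub> i"
    using ij cl by (simp add: twist_ginv_comp(2)[OF \<tau> \<sigma> st])
  finally have ji: "j \<otimes>\<^bsub>B\<^esub> \<beta> (ginv ?\<pi>) \<tau> = \<beta> \<tau> \<sigma> \<otimes>\<^bsub>B\<^esub> i" .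
  have "right_factor ?\<pi> \<otimes>\<^bsub>R\<^esub> monomial B c \<tau> = monomial B (c \<otimes>\<^bsub>B\<^esub> (\<beta> \<tau> \<sigma> \<otimes>\<^bsub>B\<^esub> i)) (ginv \<sigma>)"
    using p \<tau> \<sigma> st c ij cl
    by (simp add: right_factor_def j_def[symmetric] monomial_mult ginv ginv_comp jc ji B.m_assoc)
  also have "\<dots> = ?t \<otimes>\<^bsub>R\<^esub> right_factor \<sigma>"
    using \<sigma> c ij(1) cl k tgt_comp_self[of "ginv \<sigma>"] twist_tgt[of "ginv \<sigma>"]
    by (simp add: right_factor_def i_def[symmetric] monomial_mult ginv B.m_assoc)
  finally have right: "right_factor ?\<pi> \<otimes>\<^bsub>R\<^esub> monomial B c \<tau> = ?t \<otimes>\<^bsub>R\<^esub> right_factor \<sigma>" .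
  have "left_factor ?\<pi> \<otimes>\<^bsub>R\<^esub> ?t = monomial B (weight ?k \<otimes>\<^bsub>B\<^esub> (c \<otimes>\<^bsub>B\<^esub> \<beta> \<tau> \<sigma>)) ?\<pi>"
    using p k c cl comp_src[OF p(1)] twist_src[OF p(1)]
    by (simp add: left_factor_def monomial_mult)
  also have "\<dots> = monomial B c \<tau> \<otimes>\<^bsub>R\<^esub> left_factor \<sigma>"
    using \<sigma> \<tau> st c cl k by (simp add: left_factor_def monomial_mult weight_central B.m_assoc[symmetric])
  finally have left: "left_factor ?\<pi> \<otimes>\<^bsub>R\<^esub> ?t = monomial B c \<tau> \<otimes>\<^bsub>R\<^esub> left_factor \<sigma>" .
  have m: "monomial B c \<tau> \<in> carrier R" using c \<tau> by (simp add: monomial_closed)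
  show ?thesis
    using Ext.pure_tensor_balanced[of "x \<otimes>\<^bsub>R\<^esub> left_factor ?\<pi>" ?t "right_factor \<sigma>"] tT tR m x
      left_factor_closed[OF p(1)] left_factor_closed[OF \<sigma>] right_factor_closed[OF \<sigma>]
    by (simp add: right twisted_assoc left twisted_mult_closed)
qed

text \<open>The sum of \<open>x\<close> times the separability elements of the objects in
  \<open>src_support x\<close>, with \<open>x\<close> absorbed into the left tensor factor. It
  appears as a product because the tensor group is written multiplicatively.\<close>

definition section_map where
  "section_map x = finprod P (\<lambda>\<sigma>. pure_tensor R T (x \<otimes>\<^bsub>R\<^esub> left_factor \<sigma>) (right_factor \<sigma>))
    (\<Union>e \<in> src_support x. fibre e)"

section \<open>Additivity, bilinearity and the section property of
  \<open>section_map\<close>\<close>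

sublocale P: comm_group P
  by (rule Ext.comm_group_tensor_product)

lemma section_term_closed:
  "\<lbrakk>x \<in> carrier R; \<sigma> \<in> arrows G\<rbrakk> \<Longrightarrow> pure_tensor R T (x \<otimes>\<^bsub>R\<^esub> left_factor \<sigma>) (right_factor \<sigma>) \<in> carrier P"
  by (intro Ext.pure_tensor_closed twisted_mult_closed left_factor_closed right_factor_closed)

lemma section_term_right_closed:
  "\<lbrakk>x \<in> carrier R; \<sigma> \<in> arrows G; s \<in> carrier R\<rbrakk>
    \<Longrightarrow> pure_tensor R T (x \<otimes>\<^bsub>R\<^esub> left_factor \<sigma>) (right_factor \<sigma> \<otimes>\<^bsub>R\<^esub> s) \<in> carrier P"
  by (intro Ext.pure_tensor_closed twisted_mult_closed left_factor_closed right_factor_closed)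

text \<open>An arrow ending outside \<open>src_support x\<close> has a left factor that
  \<open>x\<close> annihilates, so it contributes the neutral element. This permits a common index
  set for several ring elements.\<close>

lemma section_map_eq:
  assumes x: "x \<in> carrier R" and E: "finite E" "E \<subseteq> identities G" "src_support x \<subseteq> E"
  shows "section_map x = finprod P (\<lambda>\<sigma>. pure_tensor R T (x \<otimes>\<^bsub>R\<^esub> left_factor \<sigma>) (right_factor \<sigma>)) (\<Union>e \<in> E. fibre e)"
  unfolding section_map_def
proof (rule P.finprod_mono_neutral_cong_left)
  show "finite (\<Union>e \<in> E. fibre e)" using E fibre_finite by blast
  show "(\<Union>e \<in> src_support x. fibre e) \<subseteq> (\<Union>e \<in> E. fibre e)" using E by blast
  fix \<sigma> assume "\<sigma> \<in> (\<Union>e \<in> E. fibre e) - (\<Union>e \<in> src_support x. fibre e)"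
  then have "\<sigma> \<in> arrows G" "tgt G \<sigma> \<notin> src_support x" by (auto dest: fibreD)
  then show "pure_tensor R T (x \<otimes>\<^bsub>R\<^esub> left_factor \<sigma>) (right_factor \<sigma>) = \<one>\<^bsub>P\<^esub>"
    using x by (simp add: left_factor_def mult_monomial_zero weight_closed src_identity
        Ext.pure_tensor_zero_left right_factor_closed)
qed (use x in \<open>auto intro: section_term_closed fibreD\<close>)

lemma section_map_hom: "section_map \<in> hom (add_monoid R) P"
proof (rule homI)
  fix x assume "x \<in> carrier (add_monoid R)"
  then show "section_map x \<in> carrier P"
    unfolding section_map_def by (auto intro!: P.finprod_closed section_term_closed fibreD)
next
  fix x y assume "x \<in> carrier (add_monoid R)" "y \<in> carrier (add_monoid R)"
  then have xy: "x \<in> carrier R" "y \<in> carrier R" by auto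
  \<comment> \<open>The support of a sum may shrink, so all three values are computed over the
    union.\<close>
  let ?E = "src_support x \<union> src_support y"
  let ?U = "\<Union>e \<in> ?E. fibre e"
  let ?f = "\<lambda>x \<sigma>. pure_tensor R T (x \<otimes>\<^bsub>R\<^esub> left_factor \<sigma>) (right_factor \<sigma>)"
  have E: "finite ?E" "?E \<subseteq> identities G" "src_support (x \<oplus>\<^bsub>R\<^esub> y) \<subseteq> ?E"
    using xy src_support_finite src_support_identities src_support_add by auto
  have "section_map (x \<oplus>\<^bsub>R\<^esub> y) = finprod P (?f (x \<oplus>\<^bsub>R\<^esub> y)) ?U"
    using xy E by (intro section_map_eq) auto
  also have "\<dots> = finprod P (\<lambda>\<sigma>. ?f x \<sigma> \<otimes>\<^bsub>P\<^esub> ?f y \<sigma>) ?U"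
  proof (rule P.finprod_cong'[OF refl])
    show "(\<lambda>\<sigma>. ?f x \<sigma> \<otimes>\<^bsub>P\<^esub> ?f y \<sigma>) \<in> ?U \<rightarrow> carrier P"
      using xy by (auto intro!: P.m_closed section_term_closed fibreD)
    fix \<sigma> assume "\<sigma> \<in> ?U"
    then have "\<sigma> \<in> arrows G" by (auto dest: fibreD)
    then show "?f (x \<oplus>\<^bsub>R\<^esub> y) \<sigma> = ?f x \<sigma> \<otimes>\<^bsub>P\<^esub> ?f y \<sigma>"
      using xy by (simp add: twisted_l_distr left_factor_closed right_factor_closed twisted_mult_closed Ext.pure_tensor_add_left)
  qed
  also have "\<dots> = finprod P (?f x) ?U \<otimes>\<^bsub>P\<^esub> finprod P (?f y) ?U"
    using xy by (intro P.finprod_multf) (auto intro!: section_term_closed fibreD)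
  also have "\<dots> = section_map x \<otimes>\<^bsub>P\<^esub> section_map y"
    using xy E by (simp add: section_map_eq[of _ ?E])
  finally show "section_map (x \<otimes>\<^bsub>add_monoid R\<^esub> y) = section_map x \<otimes>\<^bsub>P\<^esub> section_map y" by simp
qed

text \<open>\<open>s\<close> acts on the first tensor factor, where it multiplies \<open>x\<close>.
  The sources of \<open>s \<otimes> x\<close> are among those of \<open>x\<close>, so the same index
  set serves both sides.\<close>

lemma section_map_left:
  assumes s: "s \<in> carrier R" and x: "x \<in> carrier R"
  shows "section_map (s \<otimes>\<^bsub>R\<^esub> x) = tensor_left R T s (section_map x)"
proof -
  let ?U = "\<Union>e \<in> src_support x. fibre e"
  let ?f = "\<lambda>x \<sigma>. pure_tensor R T (x \<otimes>\<^bsub>R\<^esub> left_factor \<sigma>) (right_factor \<sigma>)"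
  have "tensor_left R T s (section_map x) = finprod P (\<lambda>\<sigma>. tensor_left R T s (?f x \<sigma>)) ?U"
    unfolding section_map_def using x
    by (intro finprod_hom P.comm_group_axioms Ext.tensor_left_hom s) (auto intro!: section_term_closed fibreD)
  also have "\<dots> = finprod P (?f (s \<otimes>\<^bsub>R\<^esub> x)) ?U"
  proof (rule P.finprod_cong'[OF refl])
    show "?f (s \<otimes>\<^bsub>R\<^esub> x) \<in> ?U \<rightarrow> carrier P"
      using s x by (auto intro!: section_term_closed twisted_mult_closed fibreD)
    fix \<sigma> assume "\<sigma> \<in> ?U"
    then have "\<sigma> \<in> arrows G" by (auto dest: fibreD)
    then show "tensor_left R T s (?f x \<sigma>) = ?f (s \<otimes>\<^bsub>R\<^esub> x) \<sigma>"
      using s x by (simp add: Ext.tensor_left_pure twisted_mult_closed left_factor_closed right_factor_closed twisted_assoc)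
  qed
  also have "\<dots> = section_map (s \<otimes>\<^bsub>R\<^esub> x)"
    by (rule section_map_eq[OF twisted_mult_closed[OF s x] src_support_finite[OF x]
          src_support_identities[OF x] src_support_mult[OF s x], symmetric])
  finally show ?thesis ..
qed

lemma tensor_right_section_map:
  assumes s: "s \<in> carrier R" and x: "x \<in> carrier R"
    and E: "finite E" "E \<subseteq> identities G" "src_support x \<subseteq> E"
  shows "tensor_right R T (section_map x) s =
    finprod P (\<lambda>\<sigma>. pure_tensor R T (x \<otimes>\<^bsub>R\<^esub> left_factor \<sigma>) (right_factor \<sigma> \<otimes>\<^bsub>R\<^esub> s)) (\<Union>e \<in> E. fibre e)"
proof -
  let ?f = "\<lambda>\<sigma>. pure_tensor R T (x \<otimes>\<^bsub>R\<^esub> left_factor \<sigma>) (right_factor \<sigma>)"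
  have "tensor_right R T (section_map x) s = finprod P (\<lambda>\<sigma>. tensor_right R T (?f \<sigma>) s) (\<Union>e \<in> E. fibre e)"
    unfolding section_map_eq[OF x E] using x
    by (intro finprod_hom[where h = "\<lambda>X. tensor_right R T X s"] P.comm_group_axioms Ext.tensor_right_hom s)
      (auto intro!: section_term_closed fibreD)
  also have "\<dots> = finprod P (\<lambda>\<sigma>. pure_tensor R T (x \<otimes>\<^bsub>R\<^esub> left_factor \<sigma>) (right_factor \<sigma> \<otimes>\<^bsub>R\<^esub> s)) (\<Union>e \<in> E. fibre e)"
  proof (rule P.finprod_cong'[OF refl])
    fix \<sigma> assume "\<sigma> \<in> (\<Union>e \<in> E. fibre e)"
    then have "\<sigma> \<in> arrows G" by (auto dest: fibreD)
    then show "tensor_right R T (?f \<sigma>) s = pure_tensor R T (x \<otimes>\<^bsub>R\<^esub> left_factor \<sigma>) (right_factor \<sigma> \<otimes>\<^bsub>R\<^esub> s)"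
      using s x by (simp add: Ext.tensor_right_pure twisted_mult_closed left_factor_closed right_factor_closed)
  qed (use s x in \<open>auto intro!: section_term_right_closed dest: fibreD\<close>)
  finally show ?thesis .
qed

text \<open>A right factor composes with \<open>\<tau>\<close> only if its arrow lies in the fibre
  over \<open>tgt G \<tau>\<close>. Translation by \<open>\<tau>\<close> reindexes that fibre by the
  one over \<open>src G \<tau>\<close>, and \<open>factor_shift\<close> turns each term into the
  corresponding term for \<open>x \<otimes> s\<close>.\<close>

lemma section_map_right_monomial:
  assumes c: "c \<in> carrier B" and \<tau>: "\<tau> \<in> arrows G" and x: "x \<in> carrier R"
  defines "s \<equiv> monomial B c \<tau>"
  shows "section_map (x \<otimes>\<^bsub>R\<^esub> s) = tensor_right R T (section_map x) s"
proof -
  \<comment> \<open>\<open>tgt G \<tau>\<close> is inserted so that its fibre belongs to the index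
    set even if \<open>x\<close> does not meet that object.\<close>
  let ?E = "insert (tgt G \<tau>) (src_support x)"
  let ?f = "\<lambda>x \<sigma>. pure_tensor R T (x \<otimes>\<^bsub>R\<^esub> left_factor \<sigma>) (right_factor \<sigma>)"
  let ?g = "\<lambda>\<sigma>. pure_tensor R T (x \<otimes>\<^bsub>R\<^esub> left_factor \<sigma>) (right_factor \<sigma> \<otimes>\<^bsub>R\<^esub> s)"
  have s: "s \<in> carrier R" using c \<tau> by (simp add: s_def monomial_closed)
  have E: "finite ?E" "?E \<subseteq> identities G" "src_support x \<subseteq> ?E"
    using x \<tau> src_support_finite src_support_identities by (auto simp: tgt_identity)
  have g: "?g \<sigma> \<in> carrier P" if "\<sigma> \<in> arrows G" for \<sigma>
    using that s x by (simp add: section_term_right_closed)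
  have "tensor_right R T (section_map x) s = finprod P ?g (\<Union>e \<in> ?E. fibre e)"
    by (rule tensor_right_section_map[OF s x E])
  also have "\<dots> = finprod P ?g (fibre (tgt G \<tau>))"
  proof (rule P.finprod_mono_neutral_cong_right)
    show "finite (\<Union>e \<in> ?E. fibre e)" using E fibre_finite by blast
    show "?g \<in> (\<Union>e \<in> ?E. fibre e) \<rightarrow> carrier P" using g by (auto dest: fibreD(1))
    fix \<sigma> assume "\<sigma> \<in> (\<Union>e \<in> ?E. fibre e) - fibre (tgt G \<tau>)"
    then obtain e where "\<sigma> \<in> fibre e" "e \<noteq> tgt G \<tau>" by blast
    then have \<sigma>: "\<sigma> \<in> arrows G" "tgt G \<sigma> \<noteq> tgt G \<tau>" using fibreD by auto
    then have "right_factor \<sigma> \<otimes>\<^bsub>R\<^esub> s = \<zero>\<^bsub>R\<^esub>"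
      using c \<tau> by (simp add: right_factor_def s_def monomial_mult ginv twist_ginv_Units)
    then show "?g \<sigma> = \<one>\<^bsub>P\<^esub>"
      using \<sigma> x by (simp add: Ext.pure_tensor_zero_right twisted_mult_closed left_factor_closed)
  qed auto
  \<comment> \<open>Each surviving arrow is uniquely \<open>\<tau> \<star> \<sigma>\<close> with
    \<open>\<sigma>\<close> in the fibre over the source of \<open>\<tau>\<close>.\<close>
  also have "\<dots> = finprod P ?g ((\<lambda>\<sigma>. \<tau> \<star>\<^bsub>G\<^esub> \<sigma>) ` fibre (src G \<tau>))"
    using bij_betw_fibre_comp[OF \<tau>] by (simp add: bij_betw_def)
  also have "\<dots> = finprod P (\<lambda>\<sigma>. ?g (\<tau> \<star>\<^bsub>G\<^esub> \<sigma>)) (fibre (src G \<tau>))"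
    using bij_betw_fibre_comp[OF \<tau>] g by (intro P.finprod_reindex) (auto simp: bij_betw_def dest: fibreD(1))
  also have "\<dots> = finprod P (?f (x \<otimes>\<^bsub>R\<^esub> s)) (fibre (src G \<tau>))"
  proof (rule P.finprod_cong'[OF refl])
    fix \<sigma> assume "\<sigma> \<in> fibre (src G \<tau>)"
    then have "\<sigma> \<in> arrows G" "src G \<tau> = tgt G \<sigma>" by (auto dest: fibreD)
    then show "?g (\<tau> \<star>\<^bsub>G\<^esub> \<sigma>) = ?f (x \<otimes>\<^bsub>R\<^esub> s) \<sigma>"
      unfolding s_def by (rule factor_shift[OF x c \<tau>])
  qed (use twisted_mult_closed[OF x s] in \<open>auto intro!: section_term_closed dest: fibreD(1)\<close>)
  also have "\<dots> = finprod P (?f (x \<otimes>\<^bsub>R\<^esub> s)) (\<Union>e \<in> {src G \<tau>}. fibre e)" by simp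
  also have "\<dots> = section_map (x \<otimes>\<^bsub>R\<^esub> s)"
  proof (rule section_map_eq[OF twisted_mult_closed[OF x s], symmetric])
    show "src_support (x \<otimes>\<^bsub>R\<^esub> s) \<subseteq> {src G \<tau>}"
      using src_support_mult[OF x s] src_support_monomial[of c \<tau>] by (auto simp: s_def)
  qed (use src_identity[OF \<tau>] in auto)
  finally show ?thesis ..
qed

text \<open>Both sides are additive in \<open>s\<close>, so the case of monomials suffices.\<close>

lemma section_map_right:
  assumes s: "s \<in> carrier R" and x: "x \<in> carrier R"
  shows "section_map (x \<otimes>\<^bsub>R\<^esub> s) = tensor_right R T (section_map x) s"
proof -
  note E = src_support_finite[OF x] src_support_identities[OF x] subset_refl[of "src_support x"]
  have g: "(\<lambda>\<sigma>. pure_tensor R T (x \<otimes>\<^bsub>R\<^esub> left_factor \<sigma>) (right_factor \<sigma> \<otimes>\<^bsub>R\<^esub> s)) \<in> (\<Union>e \<in> src_support x. fibre e) \<rightarrow> carrier P"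
    if "s \<in> carrier R" for s
  proof
    fix \<sigma> assume "\<sigma> \<in> (\<Union>e \<in> src_support x. fibre e)"
    then have "\<sigma> \<in> arrows G" by (auto dest: fibreD(1))
    then show "pure_tensor R T (x \<otimes>\<^bsub>R\<^esub> left_factor \<sigma>) (right_factor \<sigma> \<otimes>\<^bsub>R\<^esub> s) \<in> carrier P"
      using that x section_term_right_closed by blast
  qed
  \<comment> \<open>Additivity in the acting element is read off the expansion of
    \<open>section_map x\<close> into pure tensors.\<close>
  have right_add: "tensor_right R T (section_map x) (s \<oplus>\<^bsub>R\<^esub> s') =
      tensor_right R T (section_map x) s \<otimes>\<^bsub>P\<^esub> tensor_right R T (section_map x) s'"
    if "s \<in> carrier R" "s' \<in> carrier R" for s s'
  proof -
    have "tensor_right R T (section_map x) (s \<oplus>\<^bsub>R\<^esub> s') = finprod P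
        (\<lambda>\<sigma>. pure_tensor R T (x \<otimes>\<^bsub>R\<^esub> left_factor \<sigma>) (right_factor \<sigma> \<otimes>\<^bsub>R\<^esub> s) \<otimes>\<^bsub>P\<^esub>
          pure_tensor R T (x \<otimes>\<^bsub>R\<^esub> left_factor \<sigma>) (right_factor \<sigma> \<otimes>\<^bsub>R\<^esub> s')) (\<Union>e \<in> src_support x. fibre e)"
      unfolding tensor_right_section_map[OF RA.a_closed[OF that] x E]
    proof (rule P.finprod_cong'[OF refl])
      fix \<sigma> assume "\<sigma> \<in> (\<Union>e \<in> src_support x. fibre e)"
      then have "\<sigma> \<in> arrows G" by (auto dest: fibreD)
      then show "pure_tensor R T (x \<otimes>\<^bsub>R\<^esub> left_factor \<sigma>) (right_factor \<sigma> \<otimes>\<^bsub>R\<^esub> (s \<oplus>\<^bsub>R\<^esub> s')) =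
          pure_tensor R T (x \<otimes>\<^bsub>R\<^esub> left_factor \<sigma>) (right_factor \<sigma> \<otimes>\<^bsub>R\<^esub> s) \<otimes>\<^bsub>P\<^esub>
          pure_tensor R T (x \<otimes>\<^bsub>R\<^esub> left_factor \<sigma>) (right_factor \<sigma> \<otimes>\<^bsub>R\<^esub> s')"
        using that x by (simp add: twisted_r_distr left_factor_closed right_factor_closed
            twisted_mult_closed Ext.pure_tensor_add_right)
    qed (use g[OF that(1)] g[OF that(2)] in auto)
    also have "\<dots> = tensor_right R T (section_map x) s \<otimes>\<^bsub>P\<^esub> tensor_right R T (section_map x) s'"
      unfolding tensor_right_section_map[OF that(1) x E] tensor_right_section_map[OF that(2) x E]
      by (rule P.finprod_multf[OF g[OF that(1)] g[OF that(2)]])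
    finally show ?thesis .
  qed
  show ?thesis
    using s
  proof (induction rule: twisted_induct)
    case zero
    have "section_map (x \<otimes>\<^bsub>R\<^esub> \<zero>\<^bsub>R\<^esub>) = \<one>\<^bsub>P\<^esub>"
      unfolding twisted_r_null[OF x] by (simp add: section_map_def src_support_def twisted_zero)
    moreover have "tensor_right R T (section_map x) \<zero>\<^bsub>R\<^esub> = \<one>\<^bsub>P\<^esub>"
      unfolding tensor_right_section_map[OF RA.zero_closed x E]
    proof (rule P.finprod_one_eqI)
      fix \<sigma> assume "\<sigma> \<in> (\<Union>e \<in> src_support x. fibre e)"
      then have "\<sigma> \<in> arrows G" by (auto dest: fibreD)
      then show "pure_tensor R T (x \<otimes>\<^bsub>R\<^esub> left_factor \<sigma>) (right_factor \<sigma> \<otimes>\<^bsub>R\<^esub> \<zero>\<^bsub>R\<^esub>) = \<one>\<^bsub>P\<^esub>"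
        using x by (simp add: twisted_r_null right_factor_closed left_factor_closed twisted_mult_closed Ext.pure_tensor_zero_right)
    qed
    ultimately show ?case by simp
  next
    case (add b \<sigma> g)
    then show ?case
      using x hom_mult[OF section_map_hom, of "x \<otimes>\<^bsub>R\<^esub> monomial B b \<sigma>" "x \<otimes>\<^bsub>R\<^esub> g"]
      by (simp add: right_add monomial_closed twisted_r_distr twisted_mult_closed section_map_right_monomial)
  qed
qed

text \<open>By additivity it suffices to treat monomials. There every arrow of the fibre contributes
  the same monomial, scaled by the weight, and the fibre has as many elements as the group whose
  order the weight inverts.\<close>

lemma tensor_mult_section_map:
  assumes "x \<in> carrier R"
  shows "tensor_mult R (section_map x) = x"
proof -
  have "group_hom (add_monoid R) (add_monoid R) (tensor_mult R \<circ> section_map)"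
    by (intro group_hom.intro group_hom_axioms.intro RA.a_group hom_compose[OF section_map_hom Ext.tensor_mult_hom])
  then interpret h: group_hom "add_monoid R" "add_monoid R" "tensor_mult R \<circ> section_map" .
  have mono: "tensor_mult R (section_map (monomial B b \<rho>)) = monomial B b \<rho>"
    if b: "b \<in> carrier B" and \<rho>: "\<rho> \<in> arrows G" for b \<rho>
  proof -
    let ?x = "monomial B b \<rho>" and ?e = "src G \<rho>"
    let ?c = "b \<otimes>\<^bsub>B\<^esub> weight (base ?e)"
    have e: "?e \<in> identities G" "base ?e \<in> identities G"
      using src_identity[OF \<rho>] base(1) by auto
    have x: "?x \<in> carrier R" using b \<rho> by (rule monomial_closed)
    have c: "?c \<in> carrier B" using b weight_closed[OF e(2)] by simp
    have cR: "monomial B ?c \<rho> \<in> carrier R" using c \<rho> by (rule monomial_closed)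
    have "section_map ?x = finprod P (\<lambda>\<sigma>. pure_tensor R T (?x \<otimes>\<^bsub>R\<^esub> left_factor \<sigma>) (right_factor \<sigma>)) (fibre ?e)"
      using section_map_eq[OF x, of "{?e}"] src_support_monomial[of b \<rho>] e by simp
    then have "tensor_mult R (section_map ?x) = finprod (add_monoid R)
        (\<lambda>\<sigma>. tensor_mult R (pure_tensor R T (?x \<otimes>\<^bsub>R\<^esub> left_factor \<sigma>) (right_factor \<sigma>))) (fibre ?e)"
      using x by (simp only:)
        (intro finprod_hom P.comm_group_axioms RA.a_comm_group Ext.tensor_mult_hom Pi_I section_term_closed fibreD(1))
    also have "\<dots> = (\<Oplus>\<^bsub>R\<^esub>\<sigma> \<in> fibre ?e. monomial B ?c \<rho>)"
      unfolding finsum_def[symmetric]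
    proof (rule RA.finsum_cong'[OF refl])
      fix \<sigma> assume "\<sigma> \<in> fibre ?e"
      note \<sigma> = fibreD[OF this]
      have "tensor_mult R (pure_tensor R T (?x \<otimes>\<^bsub>R\<^esub> left_factor \<sigma>) (right_factor \<sigma>)) =
          ?x \<otimes>\<^bsub>R\<^esub> monomial B (weight (base ?e)) ?e"
        using x \<sigma> left_factor_mult_right_factor[OF \<sigma>(1)]
        by (simp add: Ext.tensor_mult_pure twisted_mult_closed left_factor_closed right_factor_closed twisted_assoc)
      also have "\<dots> = monomial B ?c \<rho>"
        using b \<rho> c e weight_closed[OF e(2)] comp_src[OF \<rho>] twist_src[OF \<rho>] identitiesD[OF e(1)]
        by (simp add: monomial_mult)
      finally show "tensor_mult R (pure_tensor R T (?x \<otimes>\<^bsub>R\<^esub> left_factor \<sigma>) (right_factor \<sigma>)) = monomial B ?c \<rho>" .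
    qed (use cR in auto)
    also have "\<dots> = add_pow R (card (fibre ?e)) (monomial B ?c \<rho>)"
      by (rule RA.add.finprod_const[OF cR])
    also have "\<dots> = ?x"
      using add_pow_monomial[OF c \<rho>] card_fibre[OF e(1)] card_weight[OF e(2) b] by simp
    finally show ?thesis .
  qed
  show ?thesis
    using assms
  proof (induction rule: twisted_induct)
    case zero
    then show ?case using h.hom_one by simp
  next
    case (add b \<sigma> g)
    then show ?case
      using h.hom_mult[of "monomial B b \<sigma>" g] by (simp add: monomial_closed mono)
  qed
qed

lemma bimodule_section_section_map: "bimodule_section R T section_map"
  unfolding bimodule_section_def
  by (intro conjI ballI section_map_hom section_map_left section_map_right tensor_mult_section_map)

end

theorem proposition46:
  fixes B :: "('b, 'm) ring_scheme"
    and G :: "('g, 'n) groupoid_data_scheme"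
    and \<beta> :: "'g \<Rightarrow> 'g \<Rightarrow> 'b"
  assumes "object_twist B G \<beta>"
  shows "separable_extension (twisted_groupoid_ring B G \<beta>) (identity_component B G \<beta>) \<longleftrightarrow>
    (\<forall>e \<in> identities G. finite (isotropy G e) \<and>
       add_pow B (card (isotropy G e)) \<one>\<^bsub>B\<^esub> \<in> Units B)"
proof -
  interpret object_twist B G \<beta> by fact
  show ?thesis
  proof
    assume *: "\<forall>e \<in> identities G. finite (isotropy G e) \<and> add_pow B (card (isotropy G e)) \<one>\<^bsub>B\<^esub> \<in> Units B"
    interpret isotropy_invertible B G \<beta>
      by unfold_locales (use * in auto)
    show "separable_extension R T"
      unfolding separable_extension_def
      using rng_extension_twisted bimodule_section_section_map by blast
  qed (use isotropy_if_separable in \<open>auto simp: separable_extension_def\<close>)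
qed

end
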